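(* Let $A\in\mathbb{Z}^{m\times n}$ and $G\in\mathbb{Z}^{(n-m)\times n}$ be such that $\binom{A}{G}$ is an $n\times n$ unimodular matrix, $S\in\mathbb{Z}^{(n-m)\times(n-m)}$ a nonsingular matrix in Smith normal form, $g\in\mathbb{Z}^{n-m}$, $b\in\mathbb{Z}^m$, $c\in\mathbb{Z}^n_{\ge0}$, and consider $\min\{c^\top x: Ax=b,\ Gx\equiv g\pmod S,\ x\in\mathbb{Z}^n_{\ge0}\}$. Let $\Delta=\Delta(A)$ and let $\rho\in\mathbb{Z}_{>0}$ be such that $\|z^*\|_1\le(6/5)^\rho$ for some optimal integer solution $z^*$. Let $B$ be a nonsingular $m\times m$ submatrix of $A$ and $\kappa=\Delta/|\det(B)|$. Then the problem can be solved by an algorithm with complexity $\rho\cdot m\cdot O(\kappa\cdot\eta_m)^{2m}\cdot\Delta^2\cdot|\det(S)|^2\cdot\max\{1,\log|\det(S)|\}$.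
   Context: $\Delta(A)$ is the maximum absolute value of $m\times m$ minors of $A$. Smith normal form: diagonal with positive entries each dividing the next; $Gx\equiv g\pmod S$ means $Gx-g\in S\mathbb{Z}^{n-m}$. For a real matrix $M$ with $n'$ columns, $\operatorname{disc}(M)=\min_{z\in\{-1/2,1/2\}^{n'}}\|Mz\|_\infty$ and $\operatorname{herdisc}(M)=\max_{I}\operatorname{disc}(M_{*I})$ over column subsets $I$. $\eta_m$ denotes a number depending only on $m$ such that $\operatorname{herdisc}(M)\le 2\operatorname{disc}(M)\le\eta_m\cdot\|M\|_{\max}$ for every real matrix $M$ with $m$ rows (known results give $\eta_m\le12\sqrt m$).
   Formalization: The running time has an added term linear in the number of input integers, since the stated bound ignores n and fails for m=1, A=(1,…,1), S=I; and herdisc(M) ≤ 2disc(M), false for (1 1), is replaced by herdisc(M) ≤ η_m‖M‖_max alongside 2disc(M) ≤ η_m‖M‖_max. *)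

theory Defs
  imports
    "Jordan_Normal_Form.Determinant"
    "Jordan_Normal_Form.DL_Submatrix"
    "HOL-Library.Log_Nat"
begin

section \<open>Subdeterminants, unimodularity, Smith normal form\<close>

text \<open>\<open>max_minor A\<close> is \<open>\<Delta>(A)\<close>: the minors are those of order \<open>dim_row A\<close>, so for \<open>dim_row A \<le> dim_col A\<close>
  the maximum ranges over a nonempty finite set.\<close>

definition max_minor :: "int mat \<Rightarrow> int" where
  "max_minor A =
     Max ((\<lambda>J. \<bar>det (submatrix A UNIV J)\<bar>) ` {J. J \<subseteq> {..<dim_col A} \<and> card J = dim_row A})"

definition unimodular_mat :: "int mat \<Rightarrow> bool" where
  "unimodular_mat U \<longleftrightarrow> square_mat U \<and> det U \<in> {1, -1}"

definition smith_normal_form :: "int mat \<Rightarrow> bool" where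
  "smith_normal_form S \<longleftrightarrow> square_mat S \<and> diagonal_mat S \<and>
     (\<forall>i<dim_row S. S $$ (i, i) > 0) \<and>
     (\<forall>i. Suc i < dim_row S \<longrightarrow> S $$ (i, i) dvd S $$ (Suc i, Suc i))"


section \<open>Discrepancy\<close>

text \<open>The element 0 only matters for vectors and matrices without entries.\<close>

definition linf_norm_vec :: "real vec \<Rightarrow> real" where
  "linf_norm_vec v = Max (insert 0 {\<bar>v $ i\<bar> |i. i < dim_vec v})"

definition max_norm_mat :: "real mat \<Rightarrow> real" where
  "max_norm_mat M = Max (insert 0 (abs ` elements_mat M))"

definition half_vecs :: "nat \<Rightarrow> real vec set" where
  "half_vecs k = {z \<in> carrier_vec k. \<forall>i<k. z $ i \<in> {-1/2, 1/2}}"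

definition disc :: "real mat \<Rightarrow> real" where
  "disc M = Min ((\<lambda>z. linf_norm_vec (M *\<^sub>v z)) ` half_vecs (dim_col M))"

definition herdisc :: "real mat \<Rightarrow> real" where
  "herdisc M = Max ((\<lambda>I. disc (submatrix M UNIV I)) ` Pow {..<dim_col M})"

text \<open>The relation \<open>herdisc M \<le> 2 * disc M\<close> is not required: it fails for the
  \<open>1 \<times> 2\<close> matrix \<open>(1 1)\<close>, where \<open>disc = 0\<close> and \<open>herdisc = 1/2\<close>.\<close>

definition discrepancy_bound :: "nat \<Rightarrow> real \<Rightarrow> bool" where
  "discrepancy_bound m h \<longleftrightarrow>
     (\<forall>M. dim_row M = m \<longrightarrow>
        herdisc M \<le> h * max_norm_mat M \<and> 2 * disc M \<le> h * max_norm_mat M)"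


section \<open>The integer program with a group constraint\<close>

definition feasible ::
  "int mat \<Rightarrow> int mat \<Rightarrow> int mat \<Rightarrow> int vec \<Rightarrow> int vec \<Rightarrow> int vec \<Rightarrow> bool" where
  "feasible A G S g b x \<longleftrightarrow>
     x \<in> carrier_vec (dim_col A) \<and> (\<forall>i<dim_col A. 0 \<le> x $ i) \<and>
     A *\<^sub>v x = b \<and> (\<exists>y\<in>carrier_vec (dim_col S). G *\<^sub>v x - g = S *\<^sub>v y)"

definition optimal_solution ::
  "int mat \<Rightarrow> int mat \<Rightarrow> int mat \<Rightarrow> int vec \<Rightarrow> int vec \<Rightarrow> int vec \<Rightarrow> int vec \<Rightarrow> bool" where
  "optimal_solution A G S g b c x \<longleftrightarrow>
     feasible A G S g b x \<and> (\<forall>y. feasible A G S g b y \<longrightarrow> c \<bullet> x \<le> c \<bullet> y)"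


section \<open>A random access machine with unit-cost integer arithmetic\<close>

text \<open>The memory consists of finitely many arrays of integers, addressed by name; a scalar
  variable is cell 0 of an array. A test succeeds iff its value is positive.\<close>

type_synonym vname = string
type_synonym store = "vname \<Rightarrow> int \<Rightarrow> int"

datatype aexp =
    Const int
  | Load vname aexp
  | Add aexp aexp
  | Sub aexp aexp
  | Mul aexp aexp
  | Div aexp aexp

datatype com =
    Skip
  | Store vname aexp aexp
  | Seq com com
  | IfPos aexp com com
  | WhilePos aexp com

fun aval :: "aexp \<Rightarrow> store \<Rightarrow> int" where
  "aval (Const k) s = k"
| "aval (Load x e) s = s x (aval e s)"
| "aval (Add e f) s = aval e s + aval f s"
| "aval (Sub e f) s = aval e s - aval f s"
| "aval (Mul e f) s = aval e s * aval f s"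
| "aval (Div e f) s = aval e s div aval f s"

fun acost :: "aexp \<Rightarrow> nat" where
  "acost (Const k) = 1"
| "acost (Load x e) = 1 + acost e"
| "acost (Add e f) = 1 + acost e + acost f"
| "acost (Sub e f) = 1 + acost e + acost f"
| "acost (Mul e f) = 1 + acost e + acost f"
| "acost (Div e f) = 1 + acost e + acost f"

text \<open>\<open>exec W p s t s'\<close>: started in \<open>s\<close>, program \<open>p\<close> halts in \<open>s'\<close> after \<open>t\<close> elementary operations,
  and no address or value of absolute value exceeding \<open>W\<close> is ever used in a memory write.
  Bounding \<open>W\<close> prevents unit-cost arithmetic from being abused on huge numbers; intermediate values
  inside expressions need no separate check, since the expressions of a fixed program have
  bounded size.\<close>

inductive exec :: "int \<Rightarrow> com \<Rightarrow> store \<Rightarrow> nat \<Rightarrow> store \<Rightarrow> bool" for W :: int where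
  Skip: "exec W Skip s 1 s"
| Store: "\<bar>aval i s\<bar> \<le> W \<Longrightarrow> \<bar>aval e s\<bar> \<le> W \<Longrightarrow>
    exec W (Store x i e) s (1 + acost i + acost e) (s(x := (s x)(aval i s := aval e s)))"
| Seq: "exec W p s t s' \<Longrightarrow> exec W q s' u s'' \<Longrightarrow> exec W (Seq p q) s (t + u) s''"
| IfTrue: "aval e s > 0 \<Longrightarrow> exec W p s t s' \<Longrightarrow>
    exec W (IfPos e p q) s (1 + acost e + t) s'"
| IfFalse: "\<not> aval e s > 0 \<Longrightarrow> exec W q s t s' \<Longrightarrow>
    exec W (IfPos e p q) s (1 + acost e + t) s'"
| WhileFalse: "\<not> aval e s > 0 \<Longrightarrow> exec W (WhilePos e p) s (1 + acost e) s"
| WhileTrue: "aval e s > 0 \<Longrightarrow> exec W p s t s' \<Longrightarrow> exec W (WhilePos e p) s' u s'' \<Longrightarrow>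
    exec W (WhilePos e p) s (1 + acost e + t + u) s''"

text \<open>Runs are unique, so exhibiting one run with given properties describes the behaviour
  of the program.\<close>

lemma exec_deterministic:
  assumes "exec W p s t s'" "exec W' p s u s''"
  shows "t = u \<and> s' = s''"
  using assms
proof (induction arbitrary: u s'' rule: exec.induct)
  case (Seq p s t s' q v s3)
  from Seq.prems obtain t1 t2 r where
    "exec W' p s t1 r" "exec W' q r t2 s''" "u = t1 + t2"
    by (auto elim: exec.cases)
  with Seq.IH show ?case by blast
next
  case (WhileTrue e s p t s' v s3)
  from WhileTrue.prems WhileTrue.hyps(1) obtain t1 t2 r where
    "exec W' p s t1 r" "exec W' (WhilePos e p) r t2 s''" "u = 1 + acost e + t1 + t2"
    by (auto elim: exec.cases)
  with WhileTrue.IH show ?case by blast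
next
  case (IfTrue e s p t s' q)
  from IfTrue.prems IfTrue.hyps(1) obtain t1 where
    "exec W' p s t1 s''" "u = 1 + acost e + t1"
    by (auto elim: exec.cases)
  with IfTrue.IH show ?case by blast
next
  case (IfFalse e s q t s' p)
  from IfFalse.prems IfFalse.hyps(1) obtain t1 where
    "exec W' q s t1 s''" "u = 1 + acost e + t1"
    by (auto elim: exec.cases)
  with IfFalse.IH show ?case by blast
qed (auto elim: exec.cases)


section \<open>Encoding of instances\<close>

text \<open>An input is a list of named integer arrays. Cells not occupied by the input hold 0.\<close>

type_synonym input = "(vname \<times> int list) list"

definition initial_store :: "input \<Rightarrow> store" where
  "initial_store inp x k =
     (case map_of inp x of
        None \<Rightarrow> 0
      | Some xs \<Rightarrow> if 0 \<le> k \<and> k < int (length xs) then xs ! nat k else 0)"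

text \<open>Number of integers in the input, and the total length of their binary representations.\<close>

definition input_length :: "input \<Rightarrow> nat" where
  "input_length inp = (\<Sum>(x, xs)\<leftarrow>inp. length xs)"

definition input_bits :: "input \<Rightarrow> nat" where
  "input_bits inp = (\<Sum>(x, xs)\<leftarrow>inp. \<Sum>v\<leftarrow>xs. 1 + nat (bitlen \<bar>v\<bar>))"

definition row_major :: "int mat \<Rightarrow> int list" where
  "row_major M = concat (map list_of_vec (rows M))"

text \<open>The nonsingular submatrix \<open>B\<close> is given by the increasing list of its column indices \<open>J\<close>,
  and the real number \<open>h\<close> (the discrepancy constant for \<open>m\<close> rows) by its integer ceiling.
  Neither \<open>\<Delta>\<close> nor any determinant is part of the input.\<close>

definition problem_input ::
  "nat \<Rightarrow> nat \<Rightarrow> int mat \<Rightarrow> int mat \<Rightarrow> int mat \<Rightarrow> int vec \<Rightarrow> int vec \<Rightarrow> int vec \<Rightarrow>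
   nat \<Rightarrow> nat set \<Rightarrow> real \<Rightarrow> input" where
  "problem_input m n A G S g b c \<rho> J h =
     [(''m'', [int m]),
      (''n'', [int n]),
      (''A'', row_major A),
      (''G'', row_major G),
      (''S'', row_major S),
      (''g'', list_of_vec g),
      (''b'', list_of_vec b),
      (''c'', list_of_vec c),
      (''rho'', [int \<rho>]),
      (''B'', map int (sorted_list_of_set J)),
      (''eta'', [\<lceil>h\<rceil>])]"

definition holds_vec :: "store \<Rightarrow> vname \<Rightarrow> int vec \<Rightarrow> bool" where
  "holds_vec s x v \<longleftrightarrow> (\<forall>i<dim_vec v. s x (int i) = v $ i)"

end

theory Submission
  imports Defs "Jordan_Normal_Form.Column_Operations"
begin

text \<open>
  Fraction-free Gauss-Jordan elimination on the columns \<open>J\<close> replaces \<open>A x = b\<close> by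
  \<open>adj(B) A x = adj(B) b\<close>. The new entries are minors of \<open>A\<close>, hence at most \<open>\<Delta> = \<kappa> |det B|\<close>.
  Rows of \<open>G\<close> whose elementary divisor is 1 impose nothing and are dropped, so that at most
  \<open>m + log |det S|\<close> coordinates remain.

  A solution \<open>x\<close> is a multiset of columns. Since hereditary discrepancy is bounded, a multiset of size
  at most \<open>(6/5)^(k+1)\<close> whose sum is close to \<open>b / 2^(\<rho>-k-1)\<close> splits into two multisets of size
  at most \<open>(6/5)^k\<close> whose sums are close to \<open>b / 2^(\<rho>-k)\<close>. Hence \<open>\<rho>\<close> rounds, each of which combines all
  pairs of states near the current target point, reach an optimal solution. The states near
  a target lie in few classes modulo \<open>det B\<close>, because the sums are of the form \<open>adj(B) y\<close>, and each class has
  few points in the box around the target.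

  A state is stored in a hash table under its Horner code. Its best cost and a multiset attaining it
  are kept together in a single integer: the column \<open>j\<close> weighs \<open>c\<^sub>j Q^n + Q^j\<close>, where \<open>Q\<close> exceeds all
  multiplicities. Comparing these integers compares costs first, and the base-\<open>Q\<close> digits of the integer
  found for the final target are an optimal solution.
\<close>

section \<open>Correctness and running time of machine programs\<close>

text \<open>A coloring of small discrepancy controls sums but not cardinalities, so a part may keep
  well over half of the elements; the base 6/5 leaves room for this. The same half-width
  \<open>2 * \<lceil>h\<rceil> * H0\<close> of the box serves every scale: halving the scale halves
  the old deviation, and the split adds back the other half. Since neither \<Delta> nor
  \<open>det B\<close> is given, H0 is read off the eliminated table as its largest entry, which is
  at most \<Delta>. With K states per target a round costs K^2 pairs of w coordinates, which is
  where the squares and the exponent 2m come from: K is at most \<Delta> times the m-th power of 9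
  \<kappa> h times det S. All n columns must be touched once; this happens in an initial round that
  pairs columns with the empty multiset only, so that its cost is linear in the input. The table is
  addressed directly by codes and never cleared: cells that point below the current segment count as
  empty. Codes and packed values are large, so much of the work is to show that all numbers have
  O(N^3) bits, where N is the bit length of the input plus \<rho>.\<close>

definition wp :: "int \<Rightarrow> com \<Rightarrow> (nat \<Rightarrow> store \<Rightarrow> bool) \<Rightarrow> store \<Rightarrow> bool" where
  "wp W p Q s \<longleftrightarrow> (\<exists>t s'. exec W p s t s' \<and> Q t s')"

lemma wp_conseq: "wp W p Q s \<Longrightarrow> (\<And>t s'. Q t s' \<Longrightarrow> Q' t s') \<Longrightarrow> wp W p Q' s"
  unfolding wp_def by blast

lemma wp_Skip: "wp W Skip Q s \<longleftrightarrow> Q 1 s"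
  unfolding wp_def by (metis exec.Skip exec_deterministic)

lemma wp_Store: "wp W (Store x i e) Q s \<longleftrightarrow>
    \<bar>aval i s\<bar> \<le> W \<and> \<bar>aval e s\<bar> \<le> W \<and>
    Q (1 + acost i + acost e) (s(x := (s x)(aval i s := aval e s)))"
  unfolding wp_def
proof
  assume "\<exists>t s'. exec W (Store x i e) s t s' \<and> Q t s'"
  then show "\<bar>aval i s\<bar> \<le> W \<and> \<bar>aval e s\<bar> \<le> W \<and>
    Q (1 + acost i + acost e) (s(x := (s x)(aval i s := aval e s)))"
    by (auto elim: exec.cases)
qed (blast intro: exec.Store)

lemma wp_Seq: "wp W (Seq p q) Q s \<longleftrightarrow> wp W p (\<lambda>t s'. wp W q (\<lambda>u s''. Q (t + u) s'') s') s"
  unfolding wp_def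
proof
  assume "\<exists>t s'. exec W (Seq p q) s t s' \<and> Q t s'"
  then obtain t s' where e: "exec W (Seq p q) s t s'" and Q: "Q t s'" by blast
  from e show "\<exists>t s'. exec W p s t s' \<and> (\<exists>u s''. exec W q s' u s'' \<and> Q (t + u) s'')"
    by cases (use Q in blast)
qed (blast intro: exec.Seq)

lemma wp_IfPos: "wp W (IfPos e p q) Q s \<longleftrightarrow>
    (if aval e s > 0 then wp W p (\<lambda>t. Q (1 + acost e + t)) s
     else wp W q (\<lambda>t. Q (1 + acost e + t)) s)"
proof (cases "aval e s > 0")
  case True
  have "exec W (IfPos e p q) s t s' \<longleftrightarrow> (\<exists>u. exec W p s u s' \<and> t = 1 + acost e + u)" for t s'
    using True by (blast elim: exec.cases intro: exec.IfTrue)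
  then show ?thesis using True unfolding wp_def by auto
next
  case False
  have "exec W (IfPos e p q) s t s' \<longleftrightarrow> (\<exists>u. exec W q s u s' \<and> t = 1 + acost e + u)" for t s'
    using False by (blast elim: exec.cases intro: exec.IfFalse)
  then show ?thesis using False unfolding wp_def by auto
qed

text \<open>Being equivalences, these rules let the simplifier evaluate straight-line code
  symbolically, time included.\<close>

lemmas wp_simps = wp_Skip wp_Store wp_Seq wp_IfPos

lemma wp_IfPosI:
  assumes "aval e s > 0 \<Longrightarrow> wp W p (\<lambda>t. Q (1 + acost e + t)) s"
    and "\<not> aval e s > 0 \<Longrightarrow> wp W q (\<lambda>t. Q (1 + acost e + t)) s"
  shows "wp W (IfPos e p q) Q s"
  using assms by (simp add: wp_IfPos)

lemma wp_SeqI: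
  assumes "wp W p P s" and "\<And>t s'. P t s' \<Longrightarrow> wp W q (\<lambda>u s''. Q (t + u) s'') s'"
  shows "wp W (Seq p q) Q s"
  unfolding wp_Seq using assms by (blast intro: wp_conseq)

text \<open>The number N of iterations is fixed in advance and the invariant is indexed by the
  iteration, so termination, final state and an additive time bound come out together.\<close>

lemma wp_WhilePos:
  fixes N :: nat
  assumes "I 0 s"
    and "\<And>k s. k < N \<Longrightarrow> I k s \<Longrightarrow> aval e s > 0 \<and> wp W p (\<lambda>t s'. t \<le> c k \<and> I (Suc k) s') s"
    and "\<And>s. I N s \<Longrightarrow> \<not> aval e s > 0"
    and "\<And>t s'. I N s' \<Longrightarrow> t \<le> (\<Sum>k<N. 1 + acost e + c k) + (1 + acost e) \<Longrightarrow> Q t s'"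
  shows "wp W (WhilePos e p) Q s"
proof -
  \<comment> \<open>Generalized to a start at iteration j and proved by descending induction, so
    that the bound is the cost of the remaining iterations.\<close>
  have "wp W (WhilePos e p) (\<lambda>t s'. I N s' \<and> t \<le> (\<Sum>k=j..<N. 1 + acost e + c k) + (1 + acost e)) s"
    if "j \<le> N" "I j s" for j s
    using that
  proof (induction j arbitrary: s rule: inc_induct)
    case base
    have "exec W (WhilePos e p) s (1 + acost e) s"
      by (rule exec.WhileFalse) (use assms(3) base in blast)
    with base show ?case unfolding wp_def
      by (intro exI[of _ "1 + acost e"] exI[of _ s]) auto
  next
    case (step j)
    from assms(2)[OF step.hyps(2) step.prems] obtain t1 s1 where
      "aval e s > 0" "exec W p s t1 s1" "t1 \<le> c j" "I (Suc j) s1" unfolding wp_def by blast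
    moreover from step.IH[OF this(4)] obtain t2 s2 where
      "exec W (WhilePos e p) s1 t2 s2" "I N s2"
      "t2 \<le> (\<Sum>k=Suc j..<N. 1 + acost e + c k) + (1 + acost e)" unfolding wp_def by blast
    moreover have "(\<Sum>k=j..<N. 1 + acost e + c k) = 1 + acost e + c j + (\<Sum>k=Suc j..<N. 1 + acost e + c k)"
      using step.hyps by (simp add: sum.atLeast_Suc_lessThan)
    moreover have "exec W (WhilePos e p) s (1 + acost e + t1 + t2) s2"
      using calculation(1,2,5) by (rule exec.WhileTrue)
    ultimately show ?case unfolding wp_def
      by (intro exI[of _ "1 + acost e + t1 + t2"] exI[of _ s2]) auto
  qed
  from this[of 0 s] assms(1,4) show ?thesis
    by (auto simp: atLeast0LessThan intro: wp_conseq)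
qed

section \<open>Counting loops and frame conditions\<close>

abbreviation Var :: "vname \<Rightarrow> aexp" where
  "Var x \<equiv> Load x (Const 0)"

abbreviation Assign :: "vname \<Rightarrow> aexp \<Rightarrow> com" (infix \<open>::=\<close> 62) where
  "x ::= e \<equiv> Store x (Const 0) e"

abbreviation Seq_syn :: "com \<Rightarrow> com \<Rightarrow> com" (infixr \<open>;;\<close> 60) where
  "p ;; q \<equiv> Seq p q"

definition For :: "vname \<Rightarrow> aexp \<Rightarrow> com \<Rightarrow> com" where
  "For x e p = WhilePos (Sub e (Var x)) (p ;; x ::= Add (Var x) (Const 1))"

text \<open>The body may use but not change the counter \<open>x\<close>; the invariant must not depend on \<open>x\<close>.\<close>

lemma wp_For:
  fixes N l :: nat
  assumes "s x 0 = int l" "l \<le> N" "I l s"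
    and step: "\<And>k s. l \<le> k \<Longrightarrow> k < N \<Longrightarrow> I k s \<Longrightarrow> s x 0 = int k \<Longrightarrow>
      wp W p (\<lambda>t s'. t \<le> c \<and> s' x 0 = int k \<and> I (Suc k) s') s"
    and ub: "\<And>k s. l \<le> k \<Longrightarrow> k \<le> N \<Longrightarrow> I k s \<Longrightarrow> aval e s = int N"
    and indep: "\<And>k s v. I k s \<Longrightarrow> I k (s(x := (s x)(0 := v)))"
    and W: "int N \<le> W"
    and post: "\<And>t s'. I N s' \<Longrightarrow> s' x 0 = int N \<Longrightarrow> t \<le> (N - l) * (c + acost e + 10) + acost e + 4 \<Longrightarrow> Q t s'"
  shows "wp W (For x e p) Q s"
  unfolding For_def
proof (rule wp_WhilePos[where N = "N - l" and c = "\<lambda>_. c + 6" and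
    I = "\<lambda>k s. I (l + k) s \<and> s x 0 = int (l + k)"], goal_cases)
  case 1
  then show ?case using assms(1,3) by simp
next
  case (2 k s)
  then have k: "l \<le> l + k" "l + k < N" by auto
  show ?case
  proof
    show "aval (Sub e (Var x)) s > 0" using ub[OF k(1), of s] 2 k by auto
    show "wp W (p ;; x ::= Add (Var x) (Const 1))
      (\<lambda>t s'. t \<le> c + 6 \<and> I (l + Suc k) s' \<and> s' x 0 = int (l + Suc k)) s"
      by (rule wp_SeqI[OF step[OF k]]) (use 2 k W indep in \<open>auto simp: wp_simps\<close>)
  qed
next
  case (3 s)
  then show ?case using ub[of N s] assms(2) by auto
next
  case (4 t s')
  then show ?case using assms(2) by (intro post) (auto simp: algebra_simps)
qed

text \<open>Frame condition by array name: a phase lists the arrays it may write, and everything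
  known about the others carries over.\<close>

definition unchanged :: "vname set \<Rightarrow> store \<Rightarrow> store \<Rightarrow> bool" where
  "unchanged X s s' \<longleftrightarrow> (\<forall>x. x \<notin> X \<longrightarrow> s' x = s x)"

lemma unchanged_refl: "unchanged X s s" by (simp add: unchanged_def)

lemma unchanged_trans: "unchanged X s s' \<Longrightarrow> unchanged Y s' s'' \<Longrightarrow> X \<subseteq> Z \<Longrightarrow> Y \<subseteq> Z \<Longrightarrow> unchanged Z s s''"
  unfolding unchanged_def by (metis subsetD)

section \<open>Minors and fraction-free pivoting\<close>

text \<open>Leibniz expansion into m! products. The crude bound suffices because it only enters bit
  lengths, never the running time.\<close>

lemma abs_det_le:
  fixes A :: "int mat"
  assumes A: "A \<in> carrier_mat m m" and b: "\<And>i j. i < m \<Longrightarrow> j < m \<Longrightarrow> \<bar>A $$ (i, j)\<bar> \<le> \<beta>"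
  shows "\<bar>det A\<bar> \<le> fact m * \<beta> ^ m"
proof -
  have "\<bar>det A\<bar> \<le> (\<Sum>p | p permutes {0..<m}. \<bar>of_int (sign p) * (\<Prod>i = 0..<m. A $$ (i, p i))\<bar>)"
    using A by (simp add: det_def)
  also have "\<dots> \<le> (\<Sum>p | p permutes {0..<m}. \<beta> ^ m)"
  proof (rule sum_mono)
    fix p assume "p \<in> {p. p permutes {0..<m}}"
    then have p: "i < m \<Longrightarrow> p i < m" for i using permutes_in_image[of p "{0..<m}" i] by auto
    have "\<bar>of_int (sign p) * (\<Prod>i = 0..<m. A $$ (i, p i))\<bar> = (\<Prod>i = 0..<m. \<bar>A $$ (i, p i)\<bar>)"
      by (simp add: abs_mult abs_prod sign_def)
    also have "\<dots> \<le> (\<Prod>i = 0..<m. \<beta>)" by (rule prod_mono) (use b p in auto)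
    finally show "\<bar>of_int (sign p) * (\<Prod>i = 0..<m. A $$ (i, p i))\<bar> \<le> \<beta> ^ m" by simp
  qed
  also have "\<dots> = fact m * \<beta> ^ m" by (simp add: card_permutations)
  finally show ?thesis .
qed

text \<open>Unlike \<open>submatrix\<close>, this keeps the columns in the order of f and admits
  repetitions, which is the form in which pivoting produces them.\<close>

definition select_cols :: "int mat \<Rightarrow> (nat \<Rightarrow> nat) \<Rightarrow> int mat" where
  "select_cols A f = mat (dim_row A) (dim_row A) (\<lambda>(i, j). A $$ (i, f j))"

lemma submatrix_eq_select_cols:
  assumes A: "A \<in> carrier_mat m n" and J: "J \<subseteq> {..<n}" "card J = m"
  shows "submatrix A UNIV J = select_cols A (pick J)"
proof -
  have "{j. j < n \<and> j \<in> J} = J" using J by auto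
  then show ?thesis unfolding submatrix_def select_cols_def using A J
    by (intro eq_matI) (auto simp: pick_UNIV)
qed

text \<open>The two matrices have the same columns up to a permutation, which affects only the sign
  of the determinant.\<close>

lemma abs_det_select_cols_bij:
  assumes A: "A \<in> carrier_mat m n" and J: "J \<subseteq> {..<n}" and f: "bij_betw f {..<m} J"
  shows "\<bar>det (select_cols A f)\<bar> = \<bar>det (submatrix A UNIV J)\<bar>"
proof -
  have cJ: "card J = m" using f by (simp add: bij_betw_same_card[symmetric])
  have fin: "finite J" using J finite_subset by auto
  \<comment> \<open>The rank of \<open>f j\<close> within J, which \<open>pick J\<close> turns back
    into \<open>f j\<close>.\<close>
  define p where "p j = (if j < m then card {a \<in> J. a < f j} else j)" for j
  have fJ: "f j \<in> J" if "j < m" for j using f that by (auto simp: bij_betw_def)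
  have pick: "pick J (p j) = f j" if "j < m" for j
    using fJ[OF that] that by (simp add: p_def pick_card_in_set)
  have plt: "p j < m" if "j < m" for j
  proof -
    have "{a \<in> J. a < f j} \<subset> J" using fJ[OF that] by auto
    from psubset_card_mono[OF fin this] show ?thesis using that by (simp add: p_def cJ)
  qed
  have inj: "inj_on p {0..<m}"
    using f pick by (intro inj_onI) (metis atLeastLessThan_iff bij_betw_def inj_onD lessThan_iff)
  have "bij_betw p {0..<m} {0..<m}"
    using inj endo_inj_surj[of "{0..<m}" p] plt by (force simp: bij_betw_def)
  then have p: "p permutes {0..<m}"
    by (rule bij_imp_permutes) (simp add: p_def)
  let ?P = "select_cols A (pick J)"
  have c: "?P \<in> carrier_mat m m" "select_cols A f \<in> carrier_mat m m" using A by (auto simp: select_cols_def)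
  have "(select_cols A f)\<^sup>T = mat m m (\<lambda>(i, j). ?P\<^sup>T $$ (p i, j))"
    using A plt pick by (intro eq_matI) (auto simp: select_cols_def)
  then have "det (select_cols A f) = of_int (sign p) * det ?P"
    using det_permute_rows[OF transpose_carrier_mat[THEN iffD2, OF c(1)] p] det_transpose[OF c(1)] det_transpose[OF c(2)] by simp
  then show ?thesis using submatrix_eq_select_cols[OF A J cJ] by (auto simp: sign_def abs_mult)
qed

text \<open>A repeated column makes the determinant zero, and otherwise it is, up to sign, one of
  the minors. \<open>m \<le> n\<close> provides at least one minor, so the maximum is
  nonnegative.\<close>

lemma abs_det_select_cols_le_max_minor:
  assumes A: "A \<in> carrier_mat m n" and mn: "m \<le> n" and f: "\<And>j. j < m \<Longrightarrow> f j < n"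
  shows "\<bar>det (select_cols A f)\<bar> \<le> max_minor A"
proof -
  let ?T = "{J. J \<subseteq> {..<dim_col A} \<and> card J = dim_row A}"
  have fin: "finite ?T" by (rule finite_subset[of _ "Pow {..<dim_col A}"]) auto
  have *: "\<bar>det (submatrix A UNIV J)\<bar> \<le> max_minor A" if "J \<in> ?T" for J
    unfolding max_minor_def using fin that by (intro Max_ge) auto
  show ?thesis
  proof (cases "inj_on f {..<m}")
    case True
    then show ?thesis
      using abs_det_select_cols_bij[OF A, of "f ` {..<m}" f] *[of "f ` {..<m}"] f A
      by (fastforce simp: bij_betw_def card_image)
  next
    case False
    then obtain i j where ij: "i < m" "j < m" "i \<noteq> j" "f i = f j" by (auto simp: inj_on_def)
    have "det (select_cols A f) = 0"
      by (rule det_identical_columns[of _ m i j]) (use ij A in \<open>auto simp: select_cols_def col_def\<close>)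
    moreover have "{..<m} \<in> ?T" using A mn by auto
    from *[OF this] have "0 \<le> max_minor A" by linarith
    ultimately show ?thesis by simp
  qed
qed

text \<open>Cramer's rule. It turns every table entry into a determinant, which bounds the entry and
  shows that a pivot is the determinant of the next matrix.\<close>

lemma adj_mat_mult_index:
  fixes M :: "int mat"
  assumes M: "M \<in> carrier_mat m m" and A: "A \<in> carrier_mat m n" and i: "i < m" and j: "j < n"
  shows "(adj_mat M * A) $$ (i, j) = det (replace_col M (col A j) i)"
proof -
  have R: "replace_col M (col A j) i \<in> carrier_mat m m" using M by (simp add: replace_col_def)
  have "det (replace_col M (col A j) i) =
      (\<Sum>k<m. replace_col M (col A j) i $$ (k, i) * cofactor (replace_col M (col A j) i) k i)"
    by (rule laplace_expansion_column[OF R i])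
  also have "\<dots> = (\<Sum>k<m. cofactor M k i * A $$ (k, j))"
  proof (rule sum.cong[OF refl])
    fix k assume "k \<in> {..<m}"
    then have k: "k < m" by simp
    have "mat_delete (replace_col M (col A j) i) k i = mat_delete M k i"
      using M by (intro eq_matI) (auto simp: mat_delete_def replace_col_def)
    then show "replace_col M (col A j) i $$ (k, i) * cofactor (replace_col M (col A j) i) k i =
        cofactor M k i * A $$ (k, j)"
      using k M A i j by (simp add: cofactor_def replace_col_def)
  qed
  also have "\<dots> = (adj_mat M * A) $$ (i, j)"
    using M A i j by (auto simp: adj_mat_def scalar_prod_def atLeast0LessThan)
  finally show ?thesis by simp
qed

text \<open>The division is exact because the result is again the product with an adjugate matrix.\<close>

lemma fraction_free_pivot:
  fixes M A :: "int mat"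
  assumes M: "M \<in> carrier_mat m m" and A: "A \<in> carrier_mat m n" and l: "l < n" and r: "r < m"
    and d: "det M \<noteq> 0" and p: "(adj_mat M * A) $$ (r, l) \<noteq> 0" and i: "i < m" and j: "j < n"
  shows "(adj_mat (replace_col M (col A l) r) * A) $$ (i, j) =
    (if i = r then (adj_mat M * A) $$ (r, j)
     else ((adj_mat M * A) $$ (r, l) * (adj_mat M * A) $$ (i, j) -
           (adj_mat M * A) $$ (i, l) * (adj_mat M * A) $$ (r, j)) div det M)"
proof -
  define Y where "Y = adj_mat M * A"
  define M' where "M' = replace_col M (col A l) r"
  define Y' where "Y' = adj_mat M' * A"
  \<comment> \<open>Z is the numerator of the update formula, that is, \<open>det M\<close> times
    the expected new table. Both it and \<open>det M\<close> times the true new table are mapped by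
    \<open>M'\<close> to \<open>det M * det M'\<close> times A.\<close>
  define Z where "Z = mat m n (\<lambda>(i, j). if i = r then det M * Y $$ (r, j)
    else Y $$ (r, l) * Y $$ (i, j) - Y $$ (i, l) * Y $$ (r, j))"
  have M': "M' \<in> carrier_mat m m" using M by (simp add: M'_def replace_col_def)
  have aM: "adj_mat M \<in> carrier_mat m m" and aM': "adj_mat M' \<in> carrier_mat m m"
    using adj_mat[OF M] adj_mat[OF M'] by auto
  have Y: "Y \<in> carrier_mat m n" and Y': "Y' \<in> carrier_mat m n" and Z: "Z \<in> carrier_mat m n"
    using aM aM' A by (auto simp: Y_def Y'_def Z_def)
  have dM': "det M' = Y $$ (r, l)"
    using adj_mat_mult_index[OF M A r l] by (simp add: Y_def M'_def)
  have MY: "M * Y = det M \<cdot>\<^sub>m A"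
    using assoc_mult_mat[OF M aM A] adj_mat(2)[OF M] A by (simp add: Y_def left_mult_one_mat[OF A] mult_smult_assoc_mat[OF one_carrier_mat A])
  have MY_ij: "(\<Sum>k<m. M $$ (a, k) * Y $$ (k, b)) = det M * A $$ (a, b)" if "a < m" "b < n" for a b
    using arg_cong[OF MY, of "\<lambda>X. X $$ (a, b)"] that M Y A
    by (simp add: scalar_prod_def atLeast0LessThan)
  have MY': "M' * Y' = det M' \<cdot>\<^sub>m A"
    using assoc_mult_mat[OF M' aM' A] adj_mat(2)[OF M'] A by (simp add: Y'_def left_mult_one_mat[OF A] mult_smult_assoc_mat[OF one_carrier_mat A])
  have "M' * Z = (det M * det M') \<cdot>\<^sub>m A"
  proof (rule eq_matI)
    fix a b assume "a < dim_row ((det M * det M') \<cdot>\<^sub>m A)" "b < dim_col ((det M * det M') \<cdot>\<^sub>m A)"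
    then have ab: "a < m" "b < n" using A by auto
    have "(M' * Z) $$ (a, b) = (\<Sum>k<m. M' $$ (a, k) * Z $$ (k, b))"
      using ab M' Z by (simp add: scalar_prod_def atLeast0LessThan)
    also have "\<dots> = (\<Sum>k<m. M $$ (a, k) * (Y $$ (r, l) * Y $$ (k, b) - Y $$ (k, l) * Y $$ (r, b))
        + (if k = r then A $$ (a, l) * (det M * Y $$ (r, b)) else 0))"
      by (rule sum.cong) (use ab M A l in \<open>auto simp: M'_def Z_def replace_col_def\<close>)
    also have "\<dots> = (\<Sum>k<m. M $$ (a, k) * (Y $$ (r, l) * Y $$ (k, b) - Y $$ (k, l) * Y $$ (r, b)))
        + A $$ (a, l) * (det M * Y $$ (r, b))"
      using r by (simp add: sum.distrib)
    also have "(\<Sum>k<m. M $$ (a, k) * (Y $$ (r, l) * Y $$ (k, b) - Y $$ (k, l) * Y $$ (r, b)))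
        = Y $$ (r, l) * (\<Sum>k<m. M $$ (a, k) * Y $$ (k, b)) - Y $$ (r, b) * (\<Sum>k<m. M $$ (a, k) * Y $$ (k, l))"
      by (simp add: algebra_simps sum_subtractf sum_distrib_left)
    finally show "(M' * Z) $$ (a, b) = ((det M * det M') \<cdot>\<^sub>m A) $$ (a, b)"
      using MY_ij[of a b] MY_ij[of a l] ab l A by (simp add: dM' algebra_simps)
  qed (use M' Z A in auto)
  moreover have "det M \<cdot>\<^sub>m (det M' \<cdot>\<^sub>m A) = (det M * det M') \<cdot>\<^sub>m A" by (rule eq_matI) auto
  ultimately have "M' * Z = M' * (det M \<cdot>\<^sub>m Y')"
    unfolding mult_smult_distrib[OF M' Y'] MY' by (rule trans[OF _ sym])
  \<comment> \<open>The adjugate cancels \<open>M'\<close> up to the factor \<open>det M'\<close>,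
    which is the pivot and hence nonzero.\<close>
  then have "adj_mat M' * (M' * Z) = adj_mat M' * (M' * (det M \<cdot>\<^sub>m Y'))" by simp
  then have "det M' \<cdot>\<^sub>m Z = det M' \<cdot>\<^sub>m (det M \<cdot>\<^sub>m Y')"
    using assoc_mult_mat[OF aM' M' Z] assoc_mult_mat[OF aM' M', of "det M \<cdot>\<^sub>m Y'" n] Y' adj_mat(3)[OF M']
      left_mult_one_mat[OF Z] left_mult_one_mat[of "det M \<cdot>\<^sub>m Y'" m n]
      mult_smult_assoc_mat[OF one_carrier_mat Z] mult_smult_assoc_mat[OF one_carrier_mat, of "det M \<cdot>\<^sub>m Y'" m n] by simp
  then have "(det M' \<cdot>\<^sub>m Z) $$ (i, j) = (det M' \<cdot>\<^sub>m (det M \<cdot>\<^sub>m Y')) $$ (i, j)" by simp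
  then have "det M' * Z $$ (i, j) = det M' * (det M * Y' $$ (i, j))" using i j Z Y' by simp
  moreover have "det M' \<noteq> 0" using p by (simp add: dM' Y_def)
  ultimately have Zij: "Z $$ (i, j) = det M * Y' $$ (i, j)" by simp
  show ?thesis
  proof (cases "i = r")
    case True
    then have "det M * Y $$ (r, j) = det M * Y' $$ (i, j)" using Zij i j by (simp add: Z_def)
    then show ?thesis using d True by (simp add: Y_def Y'_def M'_def)
  next
    case False
    then have "Y $$ (r, l) * Y $$ (i, j) - Y $$ (i, l) * Y $$ (r, j) = det M * Y' $$ (i, j)"
      using Zij i j by (simp add: Z_def)
    then show ?thesis using d False unfolding Y_def[symmetric] M'_def[symmetric] Y'_def[symmetric] by simp
  qed
qed

text \<open>Otherwise column \<open>jl k\<close> of the identity \<open>M * Y = det M * A\<close>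
  would express a nonzero multiple of that column of A through columns brought in earlier, against
  the independence of the selected columns.\<close>

lemma exists_pivot:
  fixes M A :: "int mat"
  assumes M: "M \<in> carrier_mat m m" and A: "A \<in> carrier_mat m n" and d: "det M \<noteq> 0"
    and jl: "\<And>i. i < m \<Longrightarrow> jl i < n" and B: "det (select_cols A jl) \<noteq> 0" and k: "k < m"
    and used: "\<And>r. r < m \<Longrightarrow> used r \<Longrightarrow> idx r < k \<and> col M r = col A (jl (idx r))"
  shows "\<exists>r<m. \<not> used r \<and> (adj_mat M * A) $$ (r, jl k) \<noteq> 0"
proof (rule ccontr)
  assume "\<not> ?thesis"
  define Y where "Y = adj_mat M * A"
  from \<open>\<not> ?thesis\<close> have z: "r < m \<Longrightarrow> \<not> used r \<Longrightarrow> Y $$ (r, jl k) = 0" for r by (auto simp: Y_def)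
  have aM: "adj_mat M \<in> carrier_mat m m" using adj_mat[OF M] by auto
  have Y: "Y \<in> carrier_mat m n" using aM A by (auto simp: Y_def)
  have MY: "M * Y = det M \<cdot>\<^sub>m A"
    using assoc_mult_mat[OF M aM A] adj_mat(2)[OF M] A by (simp add: Y_def left_mult_one_mat[OF A] mult_smult_assoc_mat[OF one_carrier_mat A])
  have MY_ij: "(\<Sum>k<m. M $$ (a, k) * Y $$ (k, b)) = det M * A $$ (a, b)" if "a < m" "b < n" for a b
    using arg_cong[OF MY, of "\<lambda>X. X $$ (a, b)"] that M Y A
    by (simp add: scalar_prod_def atLeast0LessThan)
  define U where "U = {r. r < m \<and> used r}"
  \<comment> \<open>The coefficients of the dependency: \<open>det M\<close> at index k, and minus
    the table entries at the indices used earlier, collected per index.\<close>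
  define c where "c = vec m (\<lambda>i. (if i = k then det M else 0) - (\<Sum>r | r \<in> U \<and> idx r = i. Y $$ (r, jl k)))"
  have "select_cols A jl *\<^sub>v c = 0\<^sub>v m"
  proof (rule eq_vecI)
    fix a assume "a < dim_vec (0\<^sub>v m :: int vec)"
    then have a: "a < m" by simp
    have "(select_cols A jl *\<^sub>v c) $ a = (\<Sum>i<m. A $$ (a, jl i) * c $ i)"
      using a A by (simp add: select_cols_def c_def scalar_prod_def atLeast0LessThan)
    also have "\<dots> = (\<Sum>i<m. (if i = k then A $$ (a, jl i) * det M else 0) -
        (\<Sum>r | r \<in> U \<and> idx r = i. A $$ (a, jl i) * Y $$ (r, jl k)))"
      by (rule sum.cong) (auto simp: c_def algebra_simps sum_distrib_left)
    also have "\<dots> = det M * A $$ (a, jl k) - (\<Sum>i<m. \<Sum>r | r \<in> U \<and> idx r = i. A $$ (a, jl i) * Y $$ (r, jl k))"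
      using k by (simp add: sum_subtractf)
    also have "(\<Sum>i<m. \<Sum>r | r \<in> U \<and> idx r = i. A $$ (a, jl i) * Y $$ (r, jl k)) =
        (\<Sum>i<m. \<Sum>r | r \<in> U \<and> idx r = i. A $$ (a, jl (idx r)) * Y $$ (r, jl k))"
      by (intro sum.cong) auto
    also have "\<dots> = (\<Sum>r\<in>U. A $$ (a, jl (idx r)) * Y $$ (r, jl k))"
      by (rule sum.group) (use used k in \<open>force simp: U_def\<close>)+
    also have "\<dots> = (\<Sum>r\<in>U. M $$ (a, r) * Y $$ (r, jl k))"
    proof (rule sum.cong[OF refl])
      fix r assume "r \<in> U"
      then have r: "r < m" "idx r < k" "col M r = col A (jl (idx r))" using used by (auto simp: U_def)
      have "A $$ (a, jl (idx r)) = col A (jl (idx r)) $ a" using a A jl[of "idx r"] r k by simp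
      also have "\<dots> = M $$ (a, r)" using a M r by (simp flip: r(3))
      finally show "A $$ (a, jl (idx r)) * Y $$ (r, jl k) = M $$ (a, r) * Y $$ (r, jl k)" by simp
    qed
    also have "\<dots> = (\<Sum>r<m. M $$ (a, r) * Y $$ (r, jl k))"
      by (rule sum.mono_neutral_left) (use z in \<open>auto simp: U_def\<close>)
    also have "\<dots> = det M * A $$ (a, jl k)" using MY_ij[OF a jl[OF k]] .
    finally show "(select_cols A jl *\<^sub>v c) $ a = 0\<^sub>v m $ a" using a by simp
  qed (use A in \<open>simp add: select_cols_def\<close>)
  moreover have "(\<Sum>r | r \<in> U \<and> idx r = k. Y $$ (r, jl k)) = 0"
    by (rule sum.neutral) (use used in \<open>auto simp: U_def\<close>)
  then have "c $ k = det M" unfolding c_def using k by simp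
  then have "c \<noteq> 0\<^sub>v m" using d k by auto
  moreover have "c \<in> carrier_vec m" by (simp add: c_def)
  ultimately have "det (select_cols A jl) = 0"
    using A by (subst det_0_iff_vec_prod_zero[of _ m]) (auto simp: select_cols_def)
  with B show False by simp
qed

text \<open>Two indices found at the same position would mean two equal columns in a nonsingular
  matrix, so the positions form a permutation of all m columns of M.\<close>

lemma cols_bij:
  fixes M A :: "int mat"
  assumes M: "M \<in> carrier_mat m m" and A: "A \<in> carrier_mat m n"
    and jl: "bij_betw jl {..<m} J" and J: "J \<subseteq> {..<n}" and B: "det (select_cols A jl) \<noteq> 0"
    and cols: "\<And>i. i < m \<Longrightarrow> \<exists>r<m. col M r = col A (jl i)"
  obtains f where "bij_betw f {..<m} J" "M = select_cols A f"
proof -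
  from cols obtain \<rho> where \<rho>: "\<And>i. i < m \<Longrightarrow> \<rho> i < m \<and> col M (\<rho> i) = col A (jl i)" by metis
  have jn: "jl i < n" if "i < m" for i using jl J that by (auto simp: bij_betw_def)
  have inj: "inj_on \<rho> {..<m}"
  proof (rule inj_onI, rule ccontr)
    fix i j assume ij: "i \<in> {..<m}" "j \<in> {..<m}" "\<rho> i = \<rho> j" "i \<noteq> j"
    then have e: "col A (jl i) = col A (jl j)" using \<rho>[of i] \<rho>[of j] by simp
    have "det (select_cols A jl) = 0"
    proof (rule det_identical_columns[of _ m i j])
      have "A $$ (a, jl i) = A $$ (a, jl j)" if "a < m" for a
        using arg_cong[OF e, of "\<lambda>v. v $ a"] that A ij jn by simp
      then show "col (select_cols A jl) i = col (select_cols A jl) j"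
        using A ij by (auto simp: select_cols_def)
    qed (use ij A in \<open>auto simp: select_cols_def\<close>)
    with B show False by simp
  qed
  have bij: "bij_betw \<rho> {..<m} {..<m}"
    using inj endo_inj_surj[of "{..<m}" \<rho>] \<rho> by (force simp: bij_betw_def)
  define f where "f = jl \<circ> inv_into {..<m} \<rho>"
  have "bij_betw f {..<m} J" unfolding f_def
    by (rule bij_betw_trans[OF bij_betw_inv_into[OF bij] jl])
  moreover have "M = select_cols A f"
  proof (rule eq_matI)
    fix i j assume "i < dim_row (select_cols A f)" "j < dim_col (select_cols A f)"
    then have ij: "i < m" "j < m" using A by (auto simp: select_cols_def)
    define a where "a = inv_into {..<m} \<rho> j"
    have a: "a < m" "\<rho> a = j" using bij ij unfolding a_def
      by (auto simp: bij_betw_def f_inv_into_f intro: inv_into_into[of j \<rho> "{..<m}", simplified])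
    have "M $$ (i, j) = col M (\<rho> a) $ i" using ij M a by simp
    also have "\<dots> = A $$ (i, jl a)" using \<rho>[OF a(1)] ij A jn[OF a(1)] by simp
    finally show "M $$ (i, j) = select_cols A f $$ (i, j)"
      using ij A by (simp add: select_cols_def f_def a_def)
  qed (use M A in \<open>auto simp: select_cols_def\<close>)
  ultimately show thesis by (rule that)
qed

section \<open>Lattice points in a box\<close>

text \<open>The Euclidean algorithm on the first row, carried out by column operations. Each step
  lowers the sum of the absolute values in that row until one nonzero entry is left, which is
  swapped to the front.\<close>

lemma exists_unimodular_first_row:
  fixes M :: "int mat"
  assumes "M \<in> carrier_mat n n" "0 < n"
  shows "\<exists>E\<in>carrier_mat n n. \<bar>det E\<bar> = 1 \<and> (\<forall>j<n. j \<noteq> 0 \<longrightarrow> (M * E) $$ (0, j) = 0)"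
  using assms
proof (induction "\<Sum>j<n. nat \<bar>M $$ (0, j)\<bar>" arbitrary: M rule: less_induct)
  case less
  have M: "M \<in> carrier_mat n n" by fact
  show ?case
  proof (cases "\<exists>i<n. \<exists>j<n. i \<noteq> j \<and> M $$ (0, i) \<noteq> 0 \<and> M $$ (0, j) \<noteq> 0")
    case True
    then obtain i j where ij: "i < n" "j < n" "i \<noteq> j" "M $$ (0, i) \<noteq> 0" "M $$ (0, j) \<noteq> 0"
      "\<bar>M $$ (0, i)\<bar> \<le> \<bar>M $$ (0, j)\<bar>" by (metis linear)
    \<comment> \<open>The sign for which adding the smaller entry to the larger one reduces the
      absolute value of the latter.\<close>
    define a where "a = - (sgn (M $$ (0, i)) * sgn (M $$ (0, j)))"
    define E1 where "E1 = addrow_mat n a i j"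
    have E1: "E1 \<in> carrier_mat n n" by (simp add: E1_def)
    have dE1: "det E1 = 1" unfolding E1_def by (rule det_addrow_mat[OF ij(3)])
    have ME1: "M * E1 = addcol a j i M" unfolding E1_def using addcol_mat[OF M ij(1)] by simp
    have lt: "\<bar>a * M $$ (0, i) + M $$ (0, j)\<bar> < \<bar>M $$ (0, j)\<bar>"
      using ij(4-6) by (auto simp: a_def sgn_if abs_if split: if_splits)
    have ent: "(M * E1) $$ (0, k) = (if k = j then a * M $$ (0, i) + M $$ (0, j) else M $$ (0, k))" if "k < n" for k
      using that M less.prems(2) ij unfolding ME1 by auto
    have "(\<Sum>k<n. nat \<bar>(M * E1) $$ (0, k)\<bar>) < (\<Sum>k<n. nat \<bar>M $$ (0, k)\<bar>)"
      by (rule sum_strict_mono_ex1) (use lt ij ent in auto)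
    from less.hyps[OF this _ less.prems(2)] M E1 obtain E2 where
      E2: "E2 \<in> carrier_mat n n" "\<bar>det E2\<bar> = 1" "\<forall>j<n. j \<noteq> 0 \<longrightarrow> (M * E1 * E2) $$ (0, j) = 0" by auto
    then show ?thesis
      using assoc_mult_mat[OF M E1 E2(1)] det_mult[OF E1 E2(1)] dE1 E1
      by (intro bexI[of _ "E1 * E2"]) auto
  next
    case False
    show ?thesis
    proof (cases "\<exists>k<n. k \<noteq> 0 \<and> M $$ (0, k) \<noteq> 0")
      case True
      then obtain k where k: "k < n" "k \<noteq> 0" "M $$ (0, k) \<noteq> 0" by blast
      have "M * swaprows_mat n 0 k = swapcols 0 k M"
        using swapcols_mat[OF M, of 0 k] k by simp
      moreover have "\<bar>det (swaprows_mat n 0 k :: int mat)\<bar> = 1"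
        using det_swaprows_mat[of 0 n k, where 'a = int] k by simp
      ultimately show ?thesis using False k M less.prems(2)
        by (intro bexI[of _ "swaprows_mat n 0 k"]) (auto)
    next
      case F2: False
      then show ?thesis using M less.prems(2)
        by (intro bexI[of _ "1\<^sub>m n"]) auto
    qed
  qed
qed

lemma card_mod_image: "a \<noteq> (0::int) \<Longrightarrow> finite ((\<lambda>x. f x mod a) ` X) \<and> card ((\<lambda>x. f x mod a) ` X) \<le> nat \<bar>a\<bar>"
proof -
  assume a: "a \<noteq> 0"
  \<comment> \<open>The result of \<open>mod\<close> takes the sign of the divisor, so the residues
    of a negative a are nonpositive.\<close>
  define R where "R = (if a > 0 then {0..<a} else {a<..0})"
  have "(\<lambda>x. f x mod a) ` X \<subseteq> R" using a by (auto simp: R_def)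
  moreover have "finite R" "card R = nat \<bar>a\<bar>" by (auto simp: R_def)
  ultimately show ?thesis by (metis card_mono finite_subset)
qed

text \<open>Column operations clear the first row, and then the first coordinate splits off.\<close>

lemma card_incongruent_le:
  fixes M :: "int mat"
  assumes "M \<in> carrier_mat m m" "det M \<noteq> 0" "finite Y" "Y \<subseteq> carrier_vec m"
    and "\<And>y y'. y \<in> Y \<Longrightarrow> y' \<in> Y \<Longrightarrow> y \<noteq> y' \<Longrightarrow> \<not> (\<exists>z\<in>carrier_vec m. y - y' = M *\<^sub>v z)"
  shows "card Y \<le> nat \<bar>det M\<bar>"
  using assms
proof (induction m arbitrary: M Y)
  case 0
  have "Y \<subseteq> {0\<^sub>v 0}"
  proof
    fix y assume "y \<in> Y"
    with 0 have "y \<in> carrier_vec 0" by auto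
    then show "y \<in> {0\<^sub>v 0}" by (auto intro!: eq_vecI)
  qed
  then have "card Y \<le> 1" using card_mono[of "{0\<^sub>v 0}" Y] by simp
  moreover have "det M = 1" using 0 by (auto simp: det_def)
  ultimately show ?case by simp
next
  case (Suc m)
  have M: "M \<in> carrier_mat (Suc m) (Suc m)" by fact
  from exists_unimodular_first_row[OF M] obtain E where
    E: "E \<in> carrier_mat (Suc m) (Suc m)" "\<bar>det E\<bar> = 1" "\<And>j. j < Suc m \<Longrightarrow> j \<noteq> 0 \<Longrightarrow> (M * E) $$ (0, j) = 0" by auto
  define H where "H = M * E"
  have H: "H \<in> carrier_mat (Suc m) (Suc m)" using M E by (simp add: H_def)
  have dH: "\<bar>det H\<bar> = \<bar>det M\<bar>" using det_mult[OF M E(1)] E(2) by (simp add: H_def abs_mult)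
  define a where "a = H $$ (0, 0)"
  define H' where "H' = mat_delete H 0 0"
  have H': "H' \<in> carrier_mat m m" using H by (simp add: H'_def mat_delete_def)
  \<comment> \<open>Only one entry of the first row survives, so the determinant factors as
    \<open>a * det H'\<close>; the bound on the number of points factors in the same way.\<close>
  have "det H = (\<Sum>j<Suc m. H $$ (0, j) * cofactor H 0 j)" by (rule laplace_expansion_row[OF H]) simp
  also have "\<dots> = a * cofactor H 0 0"
    using E(3) by (subst sum.lessThan_Suc_shift) (simp add: H_def[symmetric] a_def)
  finally have dHa: "det H = a * det H'" by (simp add: cofactor_def H'_def)
  have a0: "a \<noteq> 0" and dH'0: "det H' \<noteq> 0" using dHa dH Suc.prems(2) by auto
  have inc: "y = y'" if "y \<in> Y" "y' \<in> Y" "z \<in> carrier_vec (Suc m)" "y - y' = H *\<^sub>v z" for y y' z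
  proof (rule ccontr)
    assume "y \<noteq> y'"
    moreover have "y - y' = M *\<^sub>v (E *\<^sub>v z)" using that M E by (simp add: H_def)
    moreover have "E *\<^sub>v z \<in> carrier_vec (Suc m)" using E that by simp
    ultimately show False using Suc.prems(5)[OF that(1,2)] by blast
  qed
  have H0: "H $$ (0, j) = 0" if "j < Suc m" "j \<noteq> 0" for j using E(3) that by (simp add: H_def)
  have Hz: "(H *\<^sub>v z) $ i = H $$ (i, 0) * z $ 0 + (\<Sum>j<m. H $$ (i, Suc j) * z $ Suc j)"
    if "z \<in> carrier_vec (Suc m)" "i < Suc m" for z i
    using that H by (simp add: scalar_prod_def atLeast0LessThan sum.lessThan_Suc_shift del: sum.lessThan_Suc)
  \<comment> \<open>Among points with the same first coordinate modulo a, subtracting the quotient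
    times the first column removes the first coordinate, and congruence modulo H becomes congruence
    modulo \<open>H'\<close> one dimension lower.\<close>
  define t where "t y = vec m (\<lambda>i. y $ Suc i - (y $ 0 div a) * H $$ (Suc i, 0))" for y :: "int vec"
  have key: "y = y'" if y: "y \<in> Y" "y' \<in> Y" and r: "y $ 0 mod a = y' $ 0 mod a"
    and z: "z \<in> carrier_vec m" "t y - t y' = H' *\<^sub>v z" for y y' z
  proof (rule inc[OF y])
    let ?z = "vec (Suc m) (\<lambda>i. if i = 0 then y $ 0 div a - y' $ 0 div a else z $ (i - 1))"
    have yc: "y \<in> carrier_vec (Suc m)" "y' \<in> carrier_vec (Suc m)" using y Suc.prems(4) by auto
    show "?z \<in> carrier_vec (Suc m)" by simp
    show "y - y' = H *\<^sub>v ?z"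
    proof (rule eq_vecI)
      fix i assume "i < dim_vec (H *\<^sub>v ?z)"
      then have i: "i < Suc m" using H by simp
      show "(y - y') $ i = (H *\<^sub>v ?z) $ i"
      proof (cases i)
        case 0
        have "y $ 0 - y' $ 0 = a * (y $ 0 div a - y' $ 0 div a)"
          using r by (metis (no_types, lifting) add_diff_cancel_right div_mult_mod_eq mult.commute right_diff_distrib')
        then show ?thesis using 0 yc H0 by (subst Hz) (auto simp: a_def)
      next
        case (Suc i')
        have "(t y - t y') $ i' = (H' *\<^sub>v z) $ i'" using z by simp
        moreover have "(H' *\<^sub>v z) $ i' = (\<Sum>j<m. H $$ (Suc i', Suc j) * z $ j)"
          using Suc i z(1) H H' by (simp add: scalar_prod_def atLeast0LessThan H'_def mat_delete_def)
        ultimately show ?thesis using Suc i yc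
          by (subst Hz) (auto simp: t_def algebra_simps)
      qed
    qed (use yc H in auto)
  qed
  define R where "R = (\<lambda>y. y $ 0 mod a) ` Y"
  have R: "finite R" "card R \<le> nat \<bar>a\<bar>" using card_mod_image[OF a0, of "\<lambda>y. y $ 0" Y] by (auto simp: R_def)
  have cls: "card {y \<in> Y. y $ 0 mod a = \<rho>} \<le> nat \<bar>det H'\<bar>" for \<rho>
  proof -
    let ?Y = "{y \<in> Y. y $ 0 mod a = \<rho>}"
    have inj: "inj_on t ?Y"
    proof (rule inj_onI)
      fix y y' assume *: "y \<in> ?Y" "y' \<in> ?Y" "t y = t y'"
      have "t y - t y' = H' *\<^sub>v 0\<^sub>v m" using * H' by (auto simp: t_def)
      then show "y = y'" using key[of y y' "0\<^sub>v m"] * by auto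
    qed
    have "card (t ` ?Y) \<le> nat \<bar>det H'\<bar>"
    proof (rule Suc.IH[OF H' dH'0])
      fix u u' assume u: "u \<in> t ` ?Y" "u' \<in> t ` ?Y" "u \<noteq> u'"
      then obtain y y' where yy: "y \<in> ?Y" "y' \<in> ?Y" "u = t y" "u' = t y'" by blast
      show "\<not> (\<exists>z\<in>carrier_vec m. u - u' = H' *\<^sub>v z)"
      proof
        assume "\<exists>z\<in>carrier_vec m. u - u' = H' *\<^sub>v z"
        then obtain z where "z \<in> carrier_vec m" "t y - t y' = H' *\<^sub>v z" using yy by blast
        from key[OF _ _ _ this] yy u(3) show False by auto
      qed
    qed (use Suc.prems(3) in \<open>auto simp: t_def\<close>)
    then show ?thesis by (simp add: card_image[OF inj])
  qed
  have "card Y = card (\<Union>\<rho>\<in>R. {y \<in> Y. y $ 0 mod a = \<rho>})"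
    by (rule arg_cong[of _ _ card]) (auto simp: R_def)
  also have "\<dots> \<le> (\<Sum>\<rho>\<in>R. card {y \<in> Y. y $ 0 mod a = \<rho>})" by (rule card_UN_le[OF R(1)])
  also have "\<dots> \<le> card R * nat \<bar>det H'\<bar>" using sum_bounded_above[of R, OF cls] by simp
  also have "\<dots> \<le> nat \<bar>a\<bar> * nat \<bar>det H'\<bar>" using R(2) by (rule mult_right_mono) simp
  also have "\<dots> = nat \<bar>det M\<bar>" using dH dHa by (simp add: abs_mult flip: nat_mult_distrib)
  finally show ?case .
qed

text \<open>Since \<open>adj_mat M * M\<close> is \<open>det M\<close> times the identity, the
  residue of \<open>adj_mat M *\<^sub>v y\<close> depends only on the class of y modulo the lattice
  generated by the columns of M, and there are at most \<bar>det M\<bar> classes.\<close>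

lemma card_adj_image_mod_le:
  fixes M :: "int mat"
  assumes M: "M \<in> carrier_mat m m" and d: "det M \<noteq> 0"
  shows "finite ((\<lambda>y. \<lambda>i\<in>{..<m}. (adj_mat M *\<^sub>v y) $ i mod det M) ` carrier_vec m) \<and>
    card ((\<lambda>y. \<lambda>i\<in>{..<m}. (adj_mat M *\<^sub>v y) $ i mod det M) ` carrier_vec m) \<le> nat \<bar>det M\<bar>"
proof -
  define f where "f = (\<lambda>y. \<lambda>i\<in>{..<m}. (adj_mat M *\<^sub>v y) $ i mod det M)"
  let ?I = "f ` carrier_vec m"
  have aM: "adj_mat M \<in> carrier_mat m m" using adj_mat[OF M] by auto
  have fin: "finite ?I"
  proof (rule finite_subset)
    show "?I \<subseteq> (\<Pi>\<^sub>E i\<in>{..<m}. (\<lambda>x. x mod det M) ` UNIV)" by (auto simp: f_def split: if_splits)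
    show "finite (\<Pi>\<^sub>E i\<in>{..<m}. (\<lambda>x. x mod det M) ` UNIV)"
      using card_mod_image[OF d, of "\<lambda>x. x" UNIV] by (intro finite_PiE) auto
  qed
  \<comment> \<open>One preimage for each residue vector. Two congruent preimages would have equal
    images, so the preimages are pairwise incongruent.\<close>
  obtain Y where Y: "Y \<subseteq> carrier_vec m" "inj_on f Y" "f ` Y = ?I"
    using subset_image_inj[of ?I f "carrier_vec m"] by auto
  have finY: "finite Y" using Y(3) fin by (intro finite_imageD[OF _ Y(2)]) simp
  have "card Y \<le> nat \<bar>det M\<bar>"
  proof (rule card_incongruent_le[OF M d finY Y(1)])
    fix y y' assume y: "y \<in> Y" "y' \<in> Y" "y \<noteq> y'"
    show "\<not> (\<exists>z\<in>carrier_vec m. y - y' = M *\<^sub>v z)"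
    proof
      assume "\<exists>z\<in>carrier_vec m. y - y' = M *\<^sub>v z"
      then obtain z where z: "z \<in> carrier_vec m" "y - y' = M *\<^sub>v z" by blast
      have yc: "y \<in> carrier_vec m" "y' \<in> carrier_vec m" using y Y(1) by blast+
      have "adj_mat M *\<^sub>v y - adj_mat M *\<^sub>v y' = adj_mat M *\<^sub>v (y - y')"
        by (rule mult_minus_distrib_mat_vec[OF aM yc, symmetric])
      also have "\<dots> = det M \<cdot>\<^sub>v z"
        unfolding z(2) assoc_mult_mat_vec[OF aM M z(1), symmetric] adj_mat(3)[OF M]
        using z(1) by (intro eq_vecI) (auto simp: scalar_prod_def mult.assoc if_distrib[of "\<lambda>x. x * _"] simp flip: sum_distrib_left cong: if_cong)
      finally have e: "adj_mat M *\<^sub>v y - adj_mat M *\<^sub>v y' = det M \<cdot>\<^sub>v z" .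
      have "(adj_mat M *\<^sub>v y) $ i mod det M = (adj_mat M *\<^sub>v y') $ i mod det M" if "i < m" for i
      proof -
        have "(adj_mat M *\<^sub>v y) $ i - (adj_mat M *\<^sub>v y') $ i = det M * z $ i"
          using arg_cong[OF e, of "\<lambda>v. v $ i"] that z aM yc by simp
        then show ?thesis by (metis dvd_triv_left mod_eq_dvd_iff)
      qed
      then have "f y = f y'" by (auto simp: f_def)
      with Y(2) y show False by (auto dest: inj_onD)
    qed
  qed
  then show ?thesis using fin Y(3) card_image[OF Y(2)] by (simp add: f_def)
qed

text \<open>The points lie in \<open>\<bar>det M\<bar>\<close> classes modulo \<open>det M\<close>, and each class meets
  the box in a grid of spacing \<open>\<bar>det M\<bar>\<close>.\<close>

lemma card_lattice_points_in_box:
  fixes M :: "int mat" and p h :: int and c :: "nat \<Rightarrow> int"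
  assumes M: "M \<in> carrier_mat m m" and d: "det M \<noteq> 0" and p: "p > 0"
  defines "X \<equiv> {\<lambda>i\<in>{..<m}. (adj_mat M *\<^sub>v y) $ i | y. y \<in> carrier_vec m \<and>
     (\<forall>i<m. \<bar>p * (adj_mat M *\<^sub>v y) $ i - c i\<bar> \<le> p * h)}"
  shows "finite X \<and> card X \<le> nat \<bar>det M\<bar> * (nat (2 * h div \<bar>det M\<bar>) + 1) ^ m"
proof -
  let ?d = "\<bar>det M\<bar>"
  \<comment> \<open>The least integer v with \<open>c i - p * h \<le> p * v\<close>: a ceiling,
    written with a division rounding down.\<close>
  define lo where "lo i = - ((p * h - c i) div p)" for i
  define C where "C = (\<lambda>y. \<lambda>i\<in>{..<m}. (adj_mat M *\<^sub>v y) $ i mod det M) ` carrier_vec m"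
  define D where "D = (\<Pi>\<^sub>E i\<in>{..<m}. {0..2 * h div ?d})"
  define F where "F v = ((\<lambda>i\<in>{..<m}. v i mod det M), (\<lambda>i\<in>{..<m}. (v i - lo i) div ?d))" for v :: "nat \<Rightarrow> int"
  have rng: "0 \<le> v - lo i \<and> v - lo i \<le> 2 * h" if v: "\<bar>p * v - c i\<bar> \<le> p * h" for v i
  proof -
    have "p * (- v) \<le> p * h - c i" using v by (simp add: algebra_simps abs_le_iff)
    then have 1: "- v \<le> (p * h - c i) div p" using p by (simp add: zdiv_mono1 pos_imp_zdiv_pos_iff)
        (metis nonzero_mult_div_cancel_left order_less_irrefl zdiv_mono1 mult_minus_right)
    have "p * ((p * h - c i) div p) \<le> p * h - c i" 
      using minus_mod_eq_mult_div[of "p * h - c i" p] pos_mod_sign[OF p, of "p * h - c i"] by linarith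
    moreover have "p * v \<le> p * h + c i" using v by (simp add: algebra_simps abs_le_iff)
    ultimately have "p * (v - lo i) \<le> p * (2 * h)" by (simp add: lo_def algebra_simps)
    then have "v - lo i \<le> 2 * h" using p by simp
    with 1 show ?thesis by (simp add: lo_def)
  qed
  have dpos: "?d > 0" using d by simp
  have X: "v \<in> X \<Longrightarrow> F v \<in> C \<times> D" for v
  proof -
    assume "v \<in> X"
    then obtain y where y: "y \<in> carrier_vec m" "v = (\<lambda>i\<in>{..<m}. (adj_mat M *\<^sub>v y) $ i)"
      "\<And>i. i < m \<Longrightarrow> \<bar>p * (adj_mat M *\<^sub>v y) $ i - c i\<bar> \<le> p * h" by (auto simp: X_def)
    have "(\<lambda>i\<in>{..<m}. v i mod det M) \<in> C" unfolding C_def using y(1,2) by (intro image_eqI[OF _ y(1)]) auto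
    moreover have "(v i - lo i) div ?d \<in> {0..2 * h div ?d}" if "i < m" for i
      using rng[OF y(3)[OF that]] that dpos y(2) by (auto simp: pos_imp_zdiv_nonneg_iff zdiv_mono1)
    ultimately show ?thesis by (auto simp: F_def D_def)
  qed
  have inj: "inj_on F X"
  proof (rule inj_onI)
    fix v v' assume v: "v \<in> X" "v' \<in> X" "F v = F v'"
    have "v i = v' i" if i: "i < m" for i
    proof -
      have "v i mod det M = v' i mod det M" "(v i - lo i) div ?d = (v' i - lo i) div ?d"
        using v(3) i by (auto simp: F_def dest!: fun_cong[of _ _ i])
      moreover from this(1) have "(v i - lo i) mod ?d = (v' i - lo i) mod ?d"
        by (simp add: mod_eq_dvd_iff)
      ultimately have "v i - lo i = v' i - lo i" by (metis div_mult_mod_eq)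
      then show ?thesis by simp
    qed
    moreover have "v \<in> extensional {..<m}" "v' \<in> extensional {..<m}" using v by (auto simp: X_def)
    ultimately show "v = v'" by (auto intro: extensionalityI)
  qed
  have C: "finite C" "card C \<le> nat ?d" using card_adj_image_mod_le[OF M d] by (auto simp: C_def)
  have D: "finite D" "card D = nat (2 * h div ?d + 1) ^ m"
    by (auto simp: D_def card_PiE intro!: finite_PiE)
  have "finite X" using inj_on_finite[OF inj, of "C \<times> D"] X C D by blast
  moreover have "card X \<le> card (C \<times> D)" using card_inj_on_le[OF inj, of "C \<times> D"] X C D by blast
  moreover have "card (C \<times> D) \<le> nat ?d * (nat (2 * h div ?d) + 1) ^ m"
    unfolding card_cartesian_product D(2) using C(2) by (intro mult_mono power_mono) auto
  ultimately show ?thesis by simp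
qed

section \<open>Splitting a multiset of vectors\<close>

lemma half_vecs_finite: "finite (half_vecs k)" and half_vecs_nonempty: "half_vecs k \<noteq> {}"
proof -
  have "half_vecs k \<subseteq> vec k ` (\<Pi>\<^sub>E i\<in>{..<k}. {-1/2, 1/2})"
  proof
    fix z :: "real vec" assume z: "z \<in> half_vecs k"
    then have "z = vec k (\<lambda>i\<in>{..<k}. z $ i)" by (intro eq_vecI) (auto simp: half_vecs_def)
    moreover have "(\<lambda>i\<in>{..<k}. z $ i) \<in> (\<Pi>\<^sub>E i\<in>{..<k}. {-1/2, 1/2})"
      using z by (auto simp: half_vecs_def)
    ultimately show "z \<in> vec k ` (\<Pi>\<^sub>E i\<in>{..<k}. {-1/2, 1/2})" by blast
  qed
  then show "finite (half_vecs k)" by (rule finite_subset) (auto intro!: finite_PiE)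
  have "vec k (\<lambda>_. 1/2) \<in> half_vecs k" by (auto simp: half_vecs_def)
  then show "half_vecs k \<noteq> {}" by blast
qed

lemma finite_elements_mat: "finite (elements_mat M)"
proof -
  have "elements_mat M = (\<lambda>(i, j). M $$ (i, j)) ` ({0..<dim_row M} \<times> {0..<dim_col M})"
    by (auto simp: elements_mat_def)
  then show ?thesis by simp
qed

lemma disc_attained:
  obtains z where "z \<in> half_vecs (dim_col M)" "linf_norm_vec (M *\<^sub>v z) = disc M"
proof -
  have "disc M \<in> (\<lambda>z. linf_norm_vec (M *\<^sub>v z)) ` half_vecs (dim_col M)"
    unfolding disc_def by (rule Min_in) (use half_vecs_finite half_vecs_nonempty in auto)
  then show thesis using that by auto
qed

lemma abs_index_le_linf_norm_vec: "i < dim_vec v \<Longrightarrow> \<bar>v $ i\<bar> \<le> linf_norm_vec v"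
  unfolding linf_norm_vec_def by (rule Max_ge) auto

lemma max_norm_mat_le:
  assumes "0 \<le> y" "\<And>i j. i < dim_row M \<Longrightarrow> j < dim_col M \<Longrightarrow> \<bar>M $$ (i, j)\<bar> \<le> y"
  shows "max_norm_mat M \<le> y"
  unfolding max_norm_mat_def using assms finite_elements_mat[of M]
  by (subst Max_le_iff) (auto simp: elements_mat_def)

text \<open>A single column of ones has discrepancy 1/2 and largest entry 1.\<close>

lemma discrepancy_bound_ge_1:
  assumes "discrepancy_bound m h" "0 < m"
  shows "1 \<le> h"
proof -
  define M :: "real mat" where "M = mat m 1 (\<lambda>_. 1)"
  obtain z where z: "z \<in> half_vecs (dim_col M)" "linf_norm_vec (M *\<^sub>v z) = disc M" by (rule disc_attained)
  have "\<bar>(M *\<^sub>v z) $ 0\<bar> \<le> disc M" using z(2) assms(2) abs_index_le_linf_norm_vec[of 0 "M *\<^sub>v z"] by (simp add: M_def)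
  moreover have "\<bar>(M *\<^sub>v z) $ 0\<bar> = 1/2" using z(1) assms(2)
    by (auto simp: M_def scalar_prod_def half_vecs_def)
  moreover have "max_norm_mat M = 1"
  proof -
    have "elements_mat M = {1}" using assms(2) by (auto simp: M_def elements_mat_def)
    then show ?thesis by (simp add: max_norm_mat_def)
  qed
  moreover have "2 * disc M \<le> h * max_norm_mat M"
    using assms(1) by (simp add: discrepancy_bound_def M_def)
  ultimately show ?thesis by simp
qed

text \<open>The matrix has one column per element, repetitions included, and Y collects the columns
  with coefficient 1/2. Twice the sum over Y then differs from the total by
  \<open>2 * (M *\<^sub>v z)\<close>. The ceiling of h appears because it is the only form in which
  h is available to the program.\<close>

lemma halve_multiset:
  fixes v :: "nat \<Rightarrow> nat \<Rightarrow> int"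
  assumes h: "discrepancy_bound m h" "1 \<le> h" and y: "0 \<le> y"
    and v: "\<And>j i. j \<in># X \<Longrightarrow> i < m \<Longrightarrow> \<bar>v j i\<bar> \<le> y"
  shows "\<exists>Y. Y \<subseteq># X \<and> (\<forall>i<m. \<bar>2 * (\<Sum>j\<in>#Y. v j i) - (\<Sum>j\<in>#X. v j i)\<bar> \<le> \<lceil>h\<rceil> * y)"
proof -
  obtain xs where xs: "mset xs = X" using ex_mset by blast
  define K where "K = length xs"
  define M :: "real mat" where "M = mat m K (\<lambda>(i, k). real_of_int (v (xs ! k) i))"
  obtain z where z: "z \<in> half_vecs (dim_col M)" "linf_norm_vec (M *\<^sub>v z) = disc M" by (rule disc_attained)
  have zk: "z \<in> carrier_vec K" "\<And>k. k < K \<Longrightarrow> z $ k = -1/2 \<or> z $ k = 1/2"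
    using z(1) by (auto simp: half_vecs_def M_def)
  have "max_norm_mat M \<le> real_of_int y"
  proof (rule max_norm_mat_le)
    fix i k assume "i < dim_row M" "k < dim_col M"
    then have "i < m" "k < K" by (auto simp: M_def)
    moreover then have "xs ! k \<in># X" by (simp add: K_def flip: xs)
    ultimately show "\<bar>M $$ (i, k)\<bar> \<le> real_of_int y" using v[of "xs ! k" i] by (simp add: M_def)
  qed (use y in simp)
  then have "h * max_norm_mat M \<le> real_of_int \<lceil>h\<rceil> * real_of_int y"
    by (rule order_trans[OF mult_left_mono[of _ "real_of_int y"] mult_right_mono]) (use h(2) y in auto)
  moreover have "2 * disc M \<le> h * max_norm_mat M"
    using h(1) by (simp add: discrepancy_bound_def M_def)
  ultimately have disc: "2 * disc M \<le> real_of_int (\<lceil>h\<rceil> * y)" by simp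
  define P where "P = {k. k < K \<and> z $ k = 1/2}"
  define Y where "Y = image_mset ((!) xs) (mset_set P)"
  have X: "X = image_mset ((!) xs) (mset_set {..<K})"
  proof -
    have "mset xs = mset (map ((!) xs) [0..<K])" by (simp add: K_def map_nth)
    then show ?thesis by (simp add: xs atLeast0LessThan)
  qed
  have "Y \<subseteq># X" unfolding X Y_def
    by (intro image_mset_subseteq_mono) (auto simp: P_def intro!: subset_imp_msubset_mset_set)
  moreover have "\<bar>2 * (\<Sum>j\<in>#Y. v j i) - (\<Sum>j\<in>#X. v j i)\<bar> \<le> \<lceil>h\<rceil> * y" if i: "i < m" for i
  proof -
    have sY: "(\<Sum>j\<in>#Y. v j i) = (\<Sum>k\<in>P. v (xs ! k) i)"
      by (simp add: Y_def sum_unfold_sum_mset multiset.map_comp comp_def)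
    have sX: "(\<Sum>j\<in>#X. v j i) = (\<Sum>k<K. v (xs ! k) i)"
      by (simp add: X sum_unfold_sum_mset multiset.map_comp comp_def)
    have "(\<Sum>k\<in>P. v (xs ! k) i) = (\<Sum>k<K. if k \<in> P then v (xs ! k) i else 0)"
      by (subst sum.inter_restrict[symmetric]) (auto simp: P_def intro!: sum.cong)
    then have "real_of_int (2 * (\<Sum>j\<in>#Y. v j i) - (\<Sum>j\<in>#X. v j i)) =
        (\<Sum>k<K. 2 * real_of_int (if k \<in> P then v (xs ! k) i else 0) - real_of_int (v (xs ! k) i))"
      by (simp add: sY sX sum_subtractf sum_distrib_left)
    also have "\<dots> = (\<Sum>k<K. 2 * (real_of_int (v (xs ! k) i) * z $ k))"
    proof (rule sum.cong[OF refl])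
      fix k assume "k \<in> {..<K}"
      then show "2 * real_of_int (if k \<in> P then v (xs ! k) i else 0) - real_of_int (v (xs ! k) i) =
          2 * (real_of_int (v (xs ! k) i) * z $ k)"
        using zk(2)[of k] by (auto simp: P_def)
    qed
    also have "\<dots> = 2 * (M *\<^sub>v z) $ i"
      using i zk(1) by (simp add: M_def scalar_prod_def sum_distrib_left atLeast0LessThan)
    finally have "\<bar>real_of_int (2 * (\<Sum>j\<in>#Y. v j i) - (\<Sum>j\<in>#X. v j i))\<bar> = 2 * \<bar>(M *\<^sub>v z) $ i\<bar>" by simp
    also have "\<dots> \<le> 2 * disc M"
      using abs_index_le_linf_norm_vec[of i "M *\<^sub>v z"] i z(2) by (simp add: M_def)
    also have "\<dots> \<le> real_of_int (\<lceil>h\<rceil> * y)" by (rule disc)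
    finally show ?thesis by linarith
  qed
  ultimately show ?thesis by blast
qed

text \<open>Halving two halves separately, once rounding up and once rounding down, balances
  the sizes of the two parts.\<close>

lemma split_multiset:
  fixes v :: "nat \<Rightarrow> nat \<Rightarrow> int"
  assumes h: "discrepancy_bound m h" "1 \<le> h" and y: "0 \<le> y"
    and v: "\<And>j i. j \<in># X \<Longrightarrow> i < m \<Longrightarrow> \<bar>v j i\<bar> \<le> y"
    and X: "real (size X) \<le> (6 / 5) ^ Suc k"
  shows "\<exists>Y1 Y2. X = Y1 + Y2 \<and> real (size Y1) \<le> (6 / 5) ^ k \<and> real (size Y2) \<le> (6 / 5) ^ k \<and>
    (\<forall>i<m. \<bar>2 * (\<Sum>j\<in>#Y1. v j i) - (\<Sum>j\<in>#X. v j i)\<bar> \<le> 2 * \<lceil>h\<rceil> * y \<and>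
           \<bar>2 * (\<Sum>j\<in>#Y2. v j i) - (\<Sum>j\<in>#X. v j i)\<bar> \<le> 2 * \<lceil>h\<rceil> * y)"
proof (cases "size X \<le> 1")
  case True
  \<comment> \<open>A singleton cannot be made smaller, but it may stay whole: every power of 6/5 is
    at least 1, and the deviation is a single vector, bounded by y.\<close>
  have "real (size X) \<le> (6 / 5) ^ k" using True one_le_power[of "6/5 :: real" k] by linarith
  moreover have le: "\<bar>\<Sum>j\<in>#X. v j i\<bar> \<le> 2 * \<lceil>h\<rceil> * y" if "i < m" for i
  proof -
    have "1 \<le> 2 * \<lceil>h\<rceil>" using h(2) by linarith
    then have "1 * y \<le> 2 * \<lceil>h\<rceil> * y" using y by (rule mult_right_mono)
    moreover have "\<bar>\<Sum>j\<in>#X. v j i\<bar> \<le> y"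
    proof (cases "X = {#}")
      case False
      then have "size X = 1" using True by (simp add: le_Suc_eq)
      then obtain j where "X = {#j#}" using size_1_singleton_mset by blast
      then show ?thesis using v that by simp
    qed (use y in simp)
    ultimately show ?thesis by linarith
  qed
  moreover have dbl: "\<bar>2 * a - a\<bar> \<le> b" if "\<bar>a\<bar> \<le> b" for a b :: int using that by simp
  ultimately have "X = X + {#} \<and> real (size X) \<le> (6 / 5) ^ k \<and> real (size {#}) \<le> (6 / 5) ^ k \<and>
    (\<forall>i<m. \<bar>2 * (\<Sum>j\<in>#X. v j i) - (\<Sum>j\<in>#X. v j i)\<bar> \<le> 2 * \<lceil>h\<rceil> * y \<and>
           \<bar>2 * (\<Sum>j\<in>#{#}. v j i) - (\<Sum>j\<in>#X. v j i)\<bar> \<le> 2 * \<lceil>h\<rceil> * y)"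
    using dbl[OF le] le by (intro conjI allI impI) simp_all
  then show ?thesis by blast
next
  case False
  define \<sigma> where "\<sigma> Y i = (\<Sum>j\<in>#Y. v j i)" for Y i
  have \<sigma>_add: "\<sigma> (Y + Z) i = \<sigma> Y i + \<sigma> Z i" for Y Z i by (simp add: \<sigma>_def)
  obtain xs where xs: "mset xs = X" using ex_mset by blast
  define X1 where "X1 = mset (take (size X div 2) xs)"
  define X2 where "X2 = mset (drop (size X div 2) xs)"
  have X12: "X = X1 + X2" by (simp add: X1_def X2_def flip: xs mset_append)
  have sX1: "size X1 = size X div 2" by (simp add: X1_def flip: xs)
  have halve: "\<exists>Y Z. X' = Y + Z \<and> size Z \<le> size Y \<and>
      (\<forall>i<m. \<bar>\<sigma> Y i - \<sigma> Z i\<bar> \<le> \<lceil>h\<rceil> * y)" if "X' \<subseteq># X" for X'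
  proof -
    from halve_multiset[OF h y, of X' v, folded \<sigma>_def] v that obtain Y where
      Y: "Y \<subseteq># X'" "\<forall>i<m. \<bar>2 * \<sigma> Y i - \<sigma> (X') i\<bar> \<le> \<lceil>h\<rceil> * y"
      by (meson mset_subset_eqD)
    have e: "X' = Y + (X' - Y)" using Y(1) by simp
    have "\<bar>\<sigma> Y i - \<sigma> (X' - Y) i\<bar> \<le> \<lceil>h\<rceil> * y" if "i < m" for i
    proof -
      have "\<sigma> (X') i = \<sigma> Y i + \<sigma> (X' - Y) i" by (subst e) (rule \<sigma>_add)
      then show ?thesis using Y(2) that by force
    qed
    then show ?thesis
      using e by (cases "size (X' - Y) \<le> size Y")
        (blast, metis abs_minus_commute add.commute linear)
  qed
  obtain Y1 Z1 where 1: "X1 = Y1 + Z1" "size Z1 \<le> size Y1"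
    "\<forall>i<m. \<bar>\<sigma> Y1 i - \<sigma> Z1 i\<bar> \<le> \<lceil>h\<rceil> * y"
    using halve[of X1] X12 by auto
  obtain Y2 Z2 where 2: "X2 = Y2 + Z2" "size Z2 \<le> size Y2"
    "\<forall>i<m. \<bar>\<sigma> Y2 i - \<sigma> Z2 i\<bar> \<le> \<lceil>h\<rceil> * y"
    using halve[of X2] X12 by auto
  define q where "q = size X div 2"
  have q: "size X \<le> 2 * q + 1" "2 * q \<le> size X" "1 \<le> q" using False by (auto simp: q_def)
  have sizes: "size X = size Y1 + size Z1 + size Y2 + size Z2" "size Y1 + size Z1 = q"
    using X12 1(1) 2(1) sX1 by (auto simp: q_def)
  \<comment> \<open>A larger part of one half is paired with a smaller part of the other. This gives
    three quarters up to rounding; the worst case is 4 out of 5 elements, still below 5/6.\<close>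
  have ineq: "6 * (a + d) \<le> 5 * (a + b + c + d) \<and> 6 * (b + c) \<le> 5 * (a + b + c + d)"
    if "a + b = q" "b \<le> a" "d \<le> c" "a + b + c + d \<le> 2 * q + 1" "2 * q \<le> a + b + c + d" "1 \<le> q"
    for a b c d q :: nat
    using that by simp
  have "6 * (size Y1 + size Z2) \<le> 5 * size X" "6 * (size Z1 + size Y2) \<le> 5 * size X"
    using ineq[OF sizes(2) 1(2) 2(2) q[unfolded sizes(1)]] by (auto simp: sizes(1))
  then have "real (size (Y1 + Z2)) \<le> 5 / 6 * real (size X)" "real (size (Z1 + Y2)) \<le> 5 / 6 * real (size X)"
    by auto
  moreover have "5 / 6 * real (size X) \<le> (6 / 5) ^ k" using X by simp
  ultimately have "real (size (Y1 + Z2)) \<le> (6 / 5) ^ k" "real (size (Z1 + Y2)) \<le> (6 / 5) ^ k" by linarith+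
  moreover have "\<bar>2 * \<sigma> (Y1 + Z2) i - \<sigma> X i\<bar> \<le> 2 * \<lceil>h\<rceil> * y"
    "\<bar>2 * \<sigma> (Z1 + Y2) i - \<sigma> X i\<bar> \<le> 2 * \<lceil>h\<rceil> * y" if "i < m" for i
    using 1(3)[rule_format, OF that] 2(3)[rule_format, OF that]
    by (auto simp: X12 1(1) 2(1) \<sigma>_add abs_le_iff)
  ultimately show ?thesis unfolding \<sigma>_def[symmetric]
    by (intro exI[of _ "Y1 + Z2"] exI[of _ "Z1 + Y2"]) (auto simp: X12 1(1) 2(1))
qed

section \<open>The elimination program\<close>

definition ix :: "nat \<Rightarrow> nat \<Rightarrow> nat \<Rightarrow> int" where "ix n i j = int i * int n + int j"

lemma ix_eq_iff: "j < n \<Longrightarrow> j' < n \<Longrightarrow> ix n i j = ix n i' j' \<longleftrightarrow> i = i' \<and> j = j'"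
proof -
  assume j: "j < n" "j' < n"
  have *: "ix n i j = int (i * n + j)" for i j by (simp add: ix_def)
  have "(i * n + j) div n = i" "(i * n + j) mod n = j" "(i' * n + j') div n = i'" "(i' * n + j') mod n = j'"
    using j by auto
  then show ?thesis unfolding * of_nat_eq_iff by metis
qed

lemma ix_bounds: "i < m \<Longrightarrow> j < n \<Longrightarrow> 0 \<le> ix n i j \<and> ix n i j < int (m * n)"
proof -
  assume "i < m" "j < n"
  then have "i * n + j < Suc i * n" by simp
  also have "\<dots> \<le> m * n" using \<open>i < m\<close> by (intro mult_right_mono) auto
  finally have "int (i * n + j) < int (m * n)" by (simp only: of_nat_less_iff)
  then show ?thesis unfolding ix_def by simp
qed

abbreviation "At i j \<equiv> Load ''A'' (Add (Mul (Var i) (Var ''n'')) (Var j))"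

definition find_pivot :: com where
  "find_pivot = ''r'' ::= Const 0 ;;
     WhilePos (Sub (Const 1) (Mul (Sub (Const 1) (Load ''u'' (Var ''r''))) (Mul (At ''r'' ''l'') (At ''r'' ''l''))))
       (''r'' ::= Add (Var ''r'') (Const 1))"

text \<open>The multiplier is saved in f first because the loop overwrites the entry of row i in
  column l.\<close>

definition row_update :: com where
  "row_update = ''f'' ::= At ''i'' ''l'' ;; ''j'' ::= Const 0 ;;
     For ''j'' (Var ''n'') (Store ''A'' (Add (Mul (Var ''i'') (Var ''n'')) (Var ''j''))
       (Div (Sub (Mul (Var ''p'') (At ''i'' ''j'')) (Mul (Var ''f'') (At ''r'' ''j''))) (Var ''d''))) ;;
     Store ''b'' (Var ''i'')
       (Div (Sub (Mul (Var ''p'') (Load ''b'' (Var ''i''))) (Mul (Var ''f'') (Load ''b'' (Var ''r'')))) (Var ''d''))"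

text \<open>The guard is the square of \<open>i - r\<close>, positive exactly off the pivot row. Row
  r keeps its entries, since by Cramer's rule they do not depend on the column of M at position r.
  The pivot becomes the next divisor because it is the new determinant.\<close>

definition pivot_step :: com where
  "pivot_step = ''l'' ::= Load ''B'' (Var ''k'') ;; find_pivot ;; ''p'' ::= At ''r'' ''l'' ;; ''i'' ::= Const 0 ;;
     For ''i'' (Var ''m'') (IfPos (Mul (Sub (Var ''i'') (Var ''r'')) (Sub (Var ''i'') (Var ''r''))) row_update Skip) ;;
     ''d'' ::= Var ''p'' ;; Store ''u'' (Var ''r'') (Const 1)"

definition eliminate :: com where
  "eliminate = ''d'' ::= Const 1 ;; ''k'' ::= Const 0 ;; For ''k'' (Var ''m'') pivot_step"

lemma wp_find_pivot:
  assumes s: "s ''n'' 0 = int n" "s ''l'' 0 = int l" and l: "l < n"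
    and u: "\<And>r. r < m \<Longrightarrow> s ''u'' (int r) = 0 \<or> s ''u'' (int r) = 1"
    and ex: "\<exists>r<m. s ''u'' (int r) \<noteq> 1 \<and> s ''A'' (ix n r l) \<noteq> 0" and W: "int m \<le> W"
  shows "wp W find_pivot (\<lambda>t s'. t \<le> 40 * m + 40 \<and> unchanged {''r''} s s' \<and>
    (\<exists>r<m. s' ''r'' 0 = int r \<and> s ''u'' (int r) = 0 \<and> s ''A'' (ix n r l) \<noteq> 0)) s"
proof -
  define P where "P r \<longleftrightarrow> r < m \<and> s ''u'' (int r) \<noteq> 1 \<and> s ''A'' (ix n r l) \<noteq> 0" for r
  define N where "N = (LEAST r. P r)"
  have "\<exists>r. P r" using ex by (auto simp: P_def)
  then have PN: "P N" unfolding N_def by (rule LeastI_ex)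
  have least: "\<not> P k" if "k < N" for k using that unfolding N_def by (rule not_less_Least)
  have Nm: "N < m" using PN by (simp add: P_def)
  show ?thesis unfolding find_pivot_def
    apply (simp add: wp_simps)
    apply (rule conjI)
    subgoal using W by simp
    apply (rule wp_WhilePos[where N = N and c = "\<lambda>_. 6" and
      I = "\<lambda>k s'. unchanged {''r''} s s' \<and> s' ''r'' 0 = int k"])
    subgoal by (simp add: unchanged_def)
    subgoal premises prems for k s'
    proof -
      have eq: "s' ''n'' = s ''n''" "s' ''u'' = s ''u''" "s' ''A'' = s ''A''" "s' ''l'' = s ''l''"
        using prems by (auto simp: unchanged_def)
      have km: "k < m" using prems(1) Nm by simp
      have "(1 - s ''u'' (int k)) * (s ''A'' (int k * int n + int l) * s ''A'' (int k * int n + int l)) = 0"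
        using least[OF prems(1)] km u[OF km] by (auto simp: P_def ix_def)
      then show ?thesis using prems W km
        by (auto simp: wp_simps eq s ix_def unchanged_def)
    qed
    subgoal premises prems for s'
    proof -
      have eq: "s' ''n'' = s ''n''" "s' ''u'' = s ''u''" "s' ''A'' = s ''A''" "s' ''l'' = s ''l''"
        using prems by (auto simp: unchanged_def)
      have "s ''u'' (int N) = 0" "s ''A'' (ix n N l) \<noteq> 0" using PN u[OF Nm] by (auto simp: P_def)
      moreover from this(2) have "s ''A'' (ix n N l) * s ''A'' (ix n N l) > 0"
        by (auto simp: zero_less_mult_iff linorder_neq_iff)
      ultimately show ?thesis using prems by (simp add: eq s ix_def)
    qed
    subgoal for t s' using PN u[OF Nm] Nm by (auto simp: P_def)
    done
qed

lemma wp_row_update: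
  assumes s: "s ''n'' 0 = int n" "s ''l'' 0 = int l" "s ''i'' 0 = int i" "s ''r'' 0 = int r"
    and il: "i < m" "r < m" "l < n" "i \<noteq> r" and W: "int (m * n) \<le> W" "int m \<le> W" "int n \<le> W"
    and f: "\<bar>s ''A'' (ix n i l)\<bar> \<le> W"
  defines "nA \<equiv> \<lambda>j. (s ''p'' 0 * s ''A'' (ix n i j) - s ''A'' (ix n i l) * s ''A'' (ix n r j)) div s ''d'' 0"
    and "nb \<equiv> (s ''p'' 0 * s ''b'' (int i) - s ''A'' (ix n i l) * s ''b'' (int r)) div s ''d'' 0"
  assumes WA: "\<And>j. j < n \<Longrightarrow> \<bar>nA j\<bar> \<le> W" and Wb: "\<bar>nb\<bar> \<le> W"
  shows "wp W row_update (\<lambda>t s'. t \<le> 70 * n + 60 \<and> unchanged {''f'', ''j'', ''A'', ''b''} s s' \<and>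
    (\<forall>i'<m. \<forall>j<n. s' ''A'' (ix n i' j) = (if i' = i then nA j else s ''A'' (ix n i' j))) \<and>
    s' ''b'' = (s ''b'')(int i := nb)) s"
proof -
  define I where "I k s' \<longleftrightarrow> unchanged {''f'', ''j'', ''A''} s s' \<and> s' ''f'' 0 = s ''A'' (ix n i l) \<and>
      (\<forall>i'<m. \<forall>j<n. s' ''A'' (ix n i' j) = (if i' = i \<and> j < k then nA j else s ''A'' (ix n i' j)))" for k s'
  have W0: "0 \<le> W" using W(2) by linarith
  show ?thesis
    unfolding row_update_def
    apply (simp add: wp_simps s W0 f flip: ix_def)
    apply (rule wp_For[where l = 0 and N = n and c = 50 and I = I])
    subgoal by simp
    subgoal by simp
    subgoal by (simp add: I_def unchanged_def)
    subgoal premises prems for k s'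
    proof -
      have eq: "s' ''n'' = s ''n''" "s' ''i'' = s ''i''" "s' ''r'' = s ''r''" "s' ''p'' = s ''p''" "s' ''d'' = s ''d''"
        using prems(3) by (auto simp: I_def unchanged_def)
      have "ix n i k < int (m * n)" "0 \<le> ix n i k" using ix_bounds[OF il(1) prems(2)] by auto
      moreover have "s' ''A'' (ix n i k) = s ''A'' (ix n i k)" "s' ''A'' (ix n r k) = s ''A'' (ix n r k)"
        "s' ''f'' 0 = s ''A'' (ix n i l)"
        using prems il by (auto simp: I_def)
      moreover have "I (Suc k) (s'(''A'' := (s' ''A'')(ix n i k := nA k)))"
        using prems(2,3) il by (auto simp: I_def unchanged_def ix_eq_iff less_Suc_eq)
      moreover have "(s ''p'' 0 * s ''A'' (ix n i k) - s ''A'' (ix n i l) * s ''A'' (ix n r k)) div s ''d'' 0 = nA k"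
        by (simp add: nA_def)
      ultimately show ?thesis using prems(4) WA[OF prems(2)] W
        by (simp add: wp_simps eq s flip: ix_def)
    qed
    subgoal for k s' using s by (simp add: I_def unchanged_def)
    subgoal for k s' v by (auto simp: I_def unchanged_def)
    subgoal using W by simp
    subgoal premises prems for t s'
    proof -
      have eq: "s' ''n'' = s ''n''" "s' ''i'' = s ''i''" "s' ''r'' = s ''r''" "s' ''p'' = s ''p''" "s' ''d'' = s ''d''" "s' ''b'' = s ''b''"
        using prems(1) by (auto simp: I_def unchanged_def)
      have f': "s' ''f'' 0 = s ''A'' (ix n i l)" using prems by (simp add: I_def)
      have "unchanged {''f'', ''j'', ''A'', ''b''} s (s'(''b'' := (s ''b'')(int i := nb)))"
        using prems(1) by (simp add: I_def unchanged_def)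
      moreover have "\<forall>i'<m. \<forall>j<n. s' ''A'' (ix n i' j) = (if i' = i then nA j else s ''A'' (ix n i' j))"
        using prems(1) by (simp add: I_def)
      ultimately show ?thesis using prems(3) Wb W il
        by (simp add: wp_simps eq s f' flip: nb_def)
    qed
    done
qed

lemma wp_update_rows:
  assumes s: "s ''m'' 0 = int m" "s ''n'' 0 = int n" "s ''l'' 0 = int l" "s ''i'' 0 = 0" "s ''r'' 0 = int r"
    and il: "r < m" "l < n" and W: "int (m * n) \<le> W" "int m \<le> W" "int n \<le> W"
    and WA: "\<And>i j. i < m \<Longrightarrow> j < n \<Longrightarrow> \<bar>s ''A'' (ix n i j)\<bar> \<le> W"
  defines "nA \<equiv> \<lambda>i j. (s ''p'' 0 * s ''A'' (ix n i j) - s ''A'' (ix n i l) * s ''A'' (ix n r j)) div s ''d'' 0"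
    and "nb \<equiv> \<lambda>i. (s ''p'' 0 * s ''b'' (int i) - s ''A'' (ix n i l) * s ''b'' (int r)) div s ''d'' 0"
  assumes WnA: "\<And>i j. i < m \<Longrightarrow> i \<noteq> r \<Longrightarrow> j < n \<Longrightarrow> \<bar>nA i j\<bar> \<le> W"
    and Wnb: "\<And>i. i < m \<Longrightarrow> i \<noteq> r \<Longrightarrow> \<bar>nb i\<bar> \<le> W"
  shows "wp W (For ''i'' (Var ''m'') (IfPos (Mul (Sub (Var ''i'') (Var ''r'')) (Sub (Var ''i'') (Var ''r''))) row_update Skip))
    (\<lambda>t s'. t \<le> m * (70 * n + 120) + 10 \<and> unchanged {''f'', ''j'', ''A'', ''b'', ''i''} s s' \<and>
    (\<forall>i<m. \<forall>j<n. s' ''A'' (ix n i j) = (if i \<noteq> r then nA i j else s ''A'' (ix n i j))) \<and>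
    (\<forall>i<m. s' ''b'' (int i) = (if i \<noteq> r then nb i else s ''b'' (int i)))) s"
proof -
  define I where "I k s' \<longleftrightarrow> unchanged {''f'', ''j'', ''A'', ''b'', ''i''} s s' \<and>
      (\<forall>i<m. \<forall>j<n. s' ''A'' (ix n i j) = (if i < k \<and> i \<noteq> r then nA i j else s ''A'' (ix n i j))) \<and>
      (\<forall>i<m. s' ''b'' (int i) = (if i < k \<and> i \<noteq> r then nb i else s ''b'' (int i)))" for k s'
  show ?thesis
  proof (rule wp_For[where l = 0 and N = m and c = "70 * n + 90" and I = I])
    show "I 0 s" by (simp add: I_def unchanged_def)
    fix k s' assume k: "k < m" and I: "I k s'" and i: "s' ''i'' 0 = int k"
    have eq: "s' ''n'' = s ''n''" "s' ''l'' = s ''l''" "s' ''r'' = s ''r''" "s' ''p'' = s ''p''" "s' ''d'' = s ''d''"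
      using I by (auto simp: I_def unchanged_def)
    have A: "s' ''A'' (ix n k j) = s ''A'' (ix n k j)" "s' ''A'' (ix n r j) = s ''A'' (ix n r j)" if "j < n" for j
      using I k il that by (auto simp: I_def)
    have b: "s' ''b'' (int k) = s ''b'' (int k)" "s' ''b'' (int r) = s ''b'' (int r)"
      using I k il by (auto simp: I_def)
    show "wp W (IfPos (Mul (Sub (Var ''i'') (Var ''r'')) (Sub (Var ''i'') (Var ''r''))) row_update Skip)
        (\<lambda>t s'. t \<le> 70 * n + 90 \<and> s' ''i'' 0 = int k \<and> I (Suc k) s') s'"
    proof (cases "k = r")
      case True
      have "I (Suc k) s'" using I True by (auto simp: I_def less_Suc_eq)
      then show ?thesis using True i by (simp add: wp_simps eq s)
    next
      case False
      have pos: "(int k - int r) * (int k - int r) > 0" using False by (auto simp: zero_less_mult_iff)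
      have row: "wp W row_update (\<lambda>t s''. t \<le> 70 * n + 60 \<and> unchanged {''f'', ''j'', ''A'', ''b''} s' s'' \<and>
        (\<forall>i'<m. \<forall>j<n. s'' ''A'' (ix n i' j) = (if i' = k then
          (s' ''p'' 0 * s' ''A'' (ix n k j) - s' ''A'' (ix n k l) * s' ''A'' (ix n r j)) div s' ''d'' 0
          else s' ''A'' (ix n i' j))) \<and>
        s'' ''b'' = (s' ''b'')(int k := (s' ''p'' 0 * s' ''b'' (int k) - s' ''A'' (ix n k l) * s' ''b'' (int r)) div s' ''d'' 0)) s'"
        by (rule wp_row_update) (use s i k False il W WA WnA Wnb A b in \<open>auto simp: eq nA_def nb_def\<close>)
      show ?thesis
      proof (rule wp_IfPosI)
        show "wp W row_update (\<lambda>t s''. 1 + acost (Mul (Sub (Var ''i'') (Var ''r'')) (Sub (Var ''i'') (Var ''r''))) + t \<le> 70 * n + 90 \<and>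
            s'' ''i'' 0 = int k \<and> I (Suc k) s'') s'"
        proof (rule wp_conseq[OF row], elim conjE, intro conjI)
          fix t s'' assume t: "t \<le> 70 * n + 60" and u: "unchanged {''f'', ''j'', ''A'', ''b''} s' s''"
            and A'': "\<forall>i'<m. \<forall>j<n. s'' ''A'' (ix n i' j) = (if i' = k then
              (s' ''p'' 0 * s' ''A'' (ix n k j) - s' ''A'' (ix n k l) * s' ''A'' (ix n r j)) div s' ''d'' 0
              else s' ''A'' (ix n i' j))"
            and b'': "s'' ''b'' = (s' ''b'')(int k := (s' ''p'' 0 * s' ''b'' (int k) - s' ''A'' (ix n k l) * s' ''b'' (int r)) div s' ''d'' 0)"
          show "1 + acost (Mul (Sub (Var ''i'') (Var ''r'')) (Sub (Var ''i'') (Var ''r''))) + t \<le> 70 * n + 90" using t by simp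
          show "s'' ''i'' 0 = int k" using u i by (simp add: unchanged_def)
          have "unchanged {''f'', ''j'', ''A'', ''b'', ''i''} s s''"
            using I u by (auto simp: I_def intro: unchanged_trans)
          moreover have "s'' ''A'' (ix n i j) = (if i < Suc k \<and> i \<noteq> r then nA i j else s ''A'' (ix n i j))"
            if "i < m" "j < n" for i j
            using A'' that I False A il by (auto simp: I_def nA_def eq less_Suc_eq)
          moreover have "s'' ''b'' (int i) = (if i < Suc k \<and> i \<noteq> r then nb i else s ''b'' (int i))" if "i < m" for i
            using b'' that I False b A il by (auto simp: I_def nb_def eq less_Suc_eq)
          ultimately show "I (Suc k) s''" by (simp add: I_def)
        qed
      qed (use pos s i in \<open>simp add: eq\<close>)
    qed
  next
    fix k s' assume "I k s'"
    then show "aval (Var ''m'') s' = int m" using s by (simp add: I_def unchanged_def)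
  next
    fix k s' v assume "I k s'"
    then show "I k (s'(''i'' := (s' ''i'')(0 := v)))" by (simp add: I_def unchanged_def)
  next
    fix t s' assume "I m s'" "t \<le> (m - 0) * (70 * n + 90 + acost (Var ''m'') + 10) + acost (Var ''m'') + 4"
    moreover from this(2) have "t \<le> m * (70 * n + 120) + 10"
      by (rule order_trans) (simp add: algebra_simps)
    ultimately show "t \<le> m * (70 * n + 120) + 10 \<and> unchanged {''f'', ''j'', ''A'', ''b'', ''i''} s s' \<and>
      (\<forall>i<m. \<forall>j<n. s' ''A'' (ix n i j) = (if i \<noteq> r then nA i j else s ''A'' (ix n i j))) \<and>
      (\<forall>i<m. s' ''b'' (int i) = (if i \<noteq> r then nb i else s ''b'' (int i)))"
      by (simp add: I_def)
  qed (use s W in auto)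
qed

text \<open>M exists only in the proof: it starts as the identity, and each step replaces one unit
  vector by a selected column of A. The arrays hold \<open>adj_mat M * A\<close>, where column n of
  A is the right-hand side; \<open>idx\<close> records which index occupies a used position.\<close>

definition elim_inv :: "nat \<Rightarrow> nat \<Rightarrow> int mat \<Rightarrow> (nat \<Rightarrow> nat) \<Rightarrow> nat \<Rightarrow> store \<Rightarrow> int mat \<Rightarrow> (nat \<Rightarrow> nat) \<Rightarrow> bool" where
  "elim_inv m n A jl k s M idx \<longleftrightarrow> M \<in> carrier_mat m m \<and> det M = s ''d'' 0 \<and> det M \<noteq> 0 \<and>
    (\<forall>i<m. \<forall>j<n. s ''A'' (ix n i j) = (adj_mat M * A) $$ (i, j)) \<and>
    (\<forall>i<m. s ''b'' (int i) = (adj_mat M * A) $$ (i, n)) \<and>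
    (\<forall>r<m. (s ''u'' (int r) = 0 \<and> col M r = unit_vec m r) \<or>
           (s ''u'' (int r) = 1 \<and> idx r < k \<and> col M r = col A (jl (idx r)))) \<and>
    (\<forall>i<k. \<exists>r<m. s ''u'' (int r) = 1 \<and> col M r = col A (jl i))"

text \<open>By Cramer's rule a table entry is the determinant of a matrix of unit vectors and
  columns of A, so the numbers do not grow from step to step. This is the purpose of eliminating
  without fractions.\<close>

lemma elim_inv_table_bound:
  assumes I: "elim_inv m n A jl k s M idx" and A: "A \<in> carrier_mat m (Suc n)"
    and \<beta>: "\<And>i j. i < m \<Longrightarrow> j < Suc n \<Longrightarrow> \<bar>A $$ (i, j)\<bar> \<le> \<beta>" "1 \<le> \<beta>"
    and jl: "\<And>i. i < m \<Longrightarrow> jl i < n" and k: "k \<le> m" and ij: "i < m" "j < Suc n"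
  shows "\<bar>(adj_mat M * A) $$ (i, j)\<bar> \<le> fact m * \<beta> ^ m"
proof -
  have M: "M \<in> carrier_mat m m" using I by (simp add: elim_inv_def)
  have "\<bar>M $$ (a, r)\<bar> \<le> \<beta>" if "a < m" "r < m" for a r
  proof -
    have "M $$ (a, r) = col M r $ a" using that M by simp
    moreover have "\<bar>unit_vec m r $ a\<bar> \<le> \<beta>" using that \<beta>(2) by simp
    moreover have "\<bar>col A (jl (idx r)) $ a\<bar> \<le> \<beta>" if "idx r < k"
      using that A \<open>a < m\<close> k jl[of "idx r"] \<beta>(1)[of a "jl (idx r)"] by simp
    ultimately show ?thesis using I that(2) unfolding elim_inv_def by metis
  qed
  then show ?thesis unfolding adj_mat_mult_index[OF M A ij]
    by (intro abs_det_le) (use M A ij \<beta> in \<open>auto simp: replace_col_def\<close>)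
qed

locale elimination =
  fixes W :: int and m n :: nat and A :: "int mat" and jl :: "nat \<Rightarrow> nat" and \<beta> :: int and s0 :: store
  assumes A: "A \<in> carrier_mat m (Suc n)"
    and jl: "\<And>i. i < m \<Longrightarrow> jl i < n" and B: "det (select_cols A jl) \<noteq> 0"
    and \<beta>: "\<And>i j. i < m \<Longrightarrow> j < Suc n \<Longrightarrow> \<bar>A $$ (i, j)\<bar> \<le> \<beta>" "1 \<le> \<beta>"
    and W: "int (m * n) \<le> W" "int m \<le> W" "int n \<le> W" "fact m * \<beta> ^ m \<le> W" "1 \<le> W"
    and s0: "s0 ''m'' 0 = int m" "s0 ''n'' 0 = int n" "\<And>i. i < m \<Longrightarrow> s0 ''B'' (int i) = int (jl i)"
begin

abbreviation "touched \<equiv> {''d'', ''k'', ''l'', ''r'', ''p'', ''i'', ''f'', ''j'', ''A'', ''b'', ''u''}"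

lemma wp_pivot_step:
  assumes I: "elim_inv m n A jl k s M idx" and k: "k < m" "s ''k'' 0 = int k" and u: "unchanged touched s0 s"
  shows "wp W pivot_step (\<lambda>t s'. t \<le> m * (70 * n + 160) + 100 \<and> s' ''k'' 0 = int k \<and>
    unchanged touched s0 s' \<and> (\<exists>M idx. elim_inv m n A jl (Suc k) s' M idx)) s"
proof -
  define l where "l = jl k"
  have l: "l < n" using jl k by (simp add: l_def)
  have M: "M \<in> carrier_mat m m" and d0: "det M \<noteq> 0" using I by (auto simp: elim_inv_def)
  have c: "s ''m'' 0 = int m" "s ''n'' 0 = int n" "s ''B'' (int k) = int l"
    using u s0 k by (auto simp: unchanged_def l_def)
  have tab: "s ''A'' (ix n i j) = (adj_mat M * A) $$ (i, j)" if "i < m" "j < n" for i j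
    using I that by (simp add: elim_inv_def)
  have tabb: "s ''b'' (int i) = (adj_mat M * A) $$ (i, n)" if "i < m" for i
    using I that by (simp add: elim_inv_def)
  have bnd: "\<bar>s ''A'' (ix n i j)\<bar> \<le> W" if "i < m" "j < n" for i j
    using elim_inv_table_bound[OF I A \<beta> jl less_imp_le[OF k(1)] that(1), of j] W(4) that by (simp add: tab)
  have used: "s ''u'' (int r) = 0 \<or> s ''u'' (int r) = 1" if "r < m" for r
    using I that by (auto simp: elim_inv_def)
  have ex: "\<exists>r<m. s ''u'' (int r) \<noteq> 1 \<and> s ''A'' (ix n r l) \<noteq> 0"
  proof -
    have "\<exists>r<m. \<not> s ''u'' (int r) = 1 \<and> (adj_mat M * A) $$ (r, jl k) \<noteq> 0"
      by (rule exists_pivot[OF M A d0 _ B k(1), where idx = idx]) (use jl I in \<open>auto simp: elim_inv_def less_SucI\<close>)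
    then show ?thesis using tab l by (auto simp: l_def)
  qed
  let ?s1 = "s(''l'' := (s ''l'')(0 := int l))"
  have find: "wp W find_pivot (\<lambda>t s'. t \<le> 40 * m + 40 \<and> unchanged {''r''} ?s1 s' \<and>
    (\<exists>r<m. s' ''r'' 0 = int r \<and> ?s1 ''u'' (int r) = 0 \<and> ?s1 ''A'' (ix n r l) \<noteq> 0)) ?s1"
    by (rule wp_find_pivot) (use c l used ex W in auto)
  have rest: "wp W (''p'' ::= At ''r'' ''l'' ;; ''i'' ::= Const 0 ;;
     For ''i'' (Var ''m'') (IfPos (Mul (Sub (Var ''i'') (Var ''r'')) (Sub (Var ''i'') (Var ''r''))) row_update Skip) ;;
     ''d'' ::= Var ''p'' ;; Store ''u'' (Var ''r'') (Const 1))
     (\<lambda>t s''. t \<le> m * (70 * n + 120) + 50 \<and> s'' ''k'' 0 = int k \<and>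
      unchanged touched s0 s'' \<and> (\<exists>M idx. elim_inv m n A jl (Suc k) s'' M idx)) s'"
    if u': "unchanged {''r''} ?s1 s'" and r: "r < m" "s' ''r'' 0 = int r" "s ''u'' (int r) = 0" "s ''A'' (ix n r l) \<noteq> 0" for s' r
  proof -
    have c': "s' ''m'' 0 = int m" "s' ''n'' 0 = int n" "s' ''l'' 0 = int l" "s' ''A'' = s ''A''" "s' ''b'' = s ''b''"
      "s' ''d'' = s ''d''" "s' ''u'' = s ''u''" "s' ''k'' 0 = int k"
      using u' c k by (auto simp: unchanged_def)
    define p where "p = s ''A'' (ix n r l)"
    define M' where "M' = replace_col M (col A l) r"
    define idx' where "idx' = idx(r := k)"
    have M': "M' \<in> carrier_mat m m" using M by (simp add: M'_def replace_col_def)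
    have det': "det M' = p" unfolding M'_def p_def using adj_mat_mult_index[OF M A r(1), of l] l tab[OF r(1) l] by simp
    have p0: "(adj_mat M * A) $$ (r, l) \<noteq> 0" using r tab l by simp
    have lS: "l < Suc n" using l by simp
    have new: "(adj_mat M' * A) $$ (i, j) = (if i = r then (adj_mat M * A) $$ (r, j)
       else (p * (adj_mat M * A) $$ (i, j) - (adj_mat M * A) $$ (i, l) * (adj_mat M * A) $$ (r, j)) div s ''d'' 0)"
      if "i < m" "j < Suc n" for i j
      using fraction_free_pivot[OF M A lS r(1) d0 p0 that] I tab[OF r(1) l]
      by (simp add: M'_def p_def elim_inv_def)
    have colM': "col M' r' = (if r' = r then col A l else col M r')" if "r' < m" for r'
      using that M A r by (auto simp: M'_def replace_col_def)
    have inv: "elim_inv m n A jl (Suc k) s'' M' idx'"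
      if "s'' ''d'' 0 = p" "s'' ''u'' = (s ''u'')(int r := 1)"
        and "\<And>i j. i < m \<Longrightarrow> j < n \<Longrightarrow> s'' ''A'' (ix n i j) = (adj_mat M' * A) $$ (i, j)"
        and "\<And>i. i < m \<Longrightarrow> s'' ''b'' (int i) = (adj_mat M' * A) $$ (i, n)" for s''
    proof -
      have "(s'' ''u'' (int r') = 0 \<and> col M' r' = unit_vec m r') \<or>
           (s'' ''u'' (int r') = 1 \<and> idx' r' < Suc k \<and> col M' r' = col A (jl (idx' r')))" if r': "r' < m" for r'
      proof (cases "r' = r")
        case True
        then show ?thesis using colM'[OF r'] that by (simp add: \<open>s'' ''u'' = _\<close> idx'_def l_def)
      next
        case False
        then show ?thesis using colM'[OF r'] I r' unfolding elim_inv_def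
          by (auto simp: \<open>s'' ''u'' = _\<close> idx'_def less_SucI)
      qed
      moreover have "\<exists>r'<m. s'' ''u'' (int r') = 1 \<and> col M' r' = col A (jl i)" if "i < Suc k" for i
      proof (cases "i = k")
        case True
        then show ?thesis using colM'[OF r(1)] r by (intro exI[of _ r]) (simp add: \<open>s'' ''u'' = _\<close> l_def)
      next
        case False
        then have "i < k" using that by simp
        then obtain r' where "r' < m" "s ''u'' (int r') = 1" "col M r' = col A (jl i)"
          using I unfolding elim_inv_def by blast
        moreover then have "r' \<noteq> r" using r by auto
        ultimately show ?thesis using colM'[of r'] by (intro exI[of _ r']) (simp add: \<open>s'' ''u'' = _\<close>)
      qed
      ultimately show ?thesis
        using that M' det' p0 r(4) unfolding elim_inv_def by (simp add: p_def)
    qed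
    have bnd': "\<bar>(adj_mat M' * A) $$ (i, j)\<bar> \<le> W" if ij: "i < m" "j < Suc n" for i j
    proof -
      \<comment> \<open>An artificial store that already contains the next table. It makes the bound
        available before the program writes the entries, when it is needed to justify the
        writes.\<close>
      let ?s'' = "(\<lambda>_ _. 0)(''d'' := (\<lambda>_. p), ''u'' := (s ''u'')(int r := 1),
        ''A'' := (\<lambda>x. (adj_mat M' * A) $$ (nat x div n, nat x mod n)), ''b'' := (\<lambda>x. (adj_mat M' * A) $$ (nat x, n))) :: store"
      have "nat (ix n i j) div n = i" "nat (ix n i j) mod n = j" if "j < n" for i j
      proof -
        have "nat (ix n i j) = i * n + j" by (simp add: ix_def nat_add_distrib nat_mult_distrib)
        then show "nat (ix n i j) div n = i" "nat (ix n i j) mod n = j" using that by auto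
      qed
      then have "elim_inv m n A jl (Suc k) ?s'' M' idx'" by (intro inv) auto
      from elim_inv_table_bound[OF this A \<beta> jl _ ij] W(4) k show ?thesis by simp
    qed
    let ?s2 = "s'(''p'' := (s' ''p'')(0 := p), ''i'' := (s' ''i'')(0 := 0))"
    have rows: "wp W (For ''i'' (Var ''m'') (IfPos (Mul (Sub (Var ''i'') (Var ''r'')) (Sub (Var ''i'') (Var ''r''))) row_update Skip))
      (\<lambda>t s''. t \<le> m * (70 * n + 120) + 10 \<and> unchanged {''f'', ''j'', ''A'', ''b'', ''i''} ?s2 s'' \<and>
      (\<forall>i<m. \<forall>j<n. s'' ''A'' (ix n i j) = (if i \<noteq> r then (?s2 ''p'' 0 * ?s2 ''A'' (ix n i j) - ?s2 ''A'' (ix n i l) * ?s2 ''A'' (ix n r j)) div ?s2 ''d'' 0 else ?s2 ''A'' (ix n i j))) \<and>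
      (\<forall>i<m. s'' ''b'' (int i) = (if i \<noteq> r then (?s2 ''p'' 0 * ?s2 ''b'' (int i) - ?s2 ''A'' (ix n i l) * ?s2 ''b'' (int r)) div ?s2 ''d'' 0 else ?s2 ''b'' (int i)))) ?s2"
    proof (rule wp_update_rows)
      fix i j assume ij: "i < m" "i \<noteq> r"
      show "\<bar>(?s2 ''p'' 0 * ?s2 ''A'' (ix n i j) - ?s2 ''A'' (ix n i l) * ?s2 ''A'' (ix n r j)) div ?s2 ''d'' 0\<bar> \<le> W" if "j < n"
        using bnd'[OF ij(1), of j] new[OF ij(1), of j] tab r l ij that by (simp add: c')
      show "\<bar>(?s2 ''p'' 0 * ?s2 ''b'' (int i) - ?s2 ''A'' (ix n i l) * ?s2 ''b'' (int r)) div ?s2 ''d'' 0\<bar> \<le> W"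
        using bnd'[OF ij(1), of n] new[OF ij(1), of n] tab tabb r l ij by (simp add: c')
    qed (use c' r l W bnd in auto)
    show ?thesis
      apply (simp add: wp_simps c' r flip: ix_def p_def)
      apply (intro conjI)
      subgoal using W(5) by simp
      subgoal using bnd[OF r(1) l] by (simp add: p_def)
      subgoal using W(5) by simp
      apply (rule wp_conseq[OF rows])
      subgoal premises prems for t s''
      proof -
        from prems have t: "t \<le> m * (70 * n + 120) + 10" and u'': "unchanged {''f'', ''j'', ''A'', ''b'', ''i''} ?s2 s''"
          and A'': "\<And>i j. i < m \<Longrightarrow> j < n \<Longrightarrow> s'' ''A'' (ix n i j) = (if i \<noteq> r then (p * s ''A'' (ix n i j) - s ''A'' (ix n i l) * s ''A'' (ix n r j)) div s ''d'' 0 else s ''A'' (ix n i j))"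
          and b'': "\<And>i. i < m \<Longrightarrow> s'' ''b'' (int i) = (if i \<noteq> r then (p * s ''b'' (int i) - s ''A'' (ix n i l) * s ''b'' (int r)) div s ''d'' 0 else s ''b'' (int i))"
          by (simp_all add: c')
        have c'': "s'' ''p'' 0 = p" "s'' ''r'' 0 = int r" "s'' ''u'' = s ''u''" "s'' ''k'' 0 = int k"
          using u'' c' r by (auto simp: unchanged_def)
        have un: "unchanged touched s0 s''"
          using u u' u'' by (simp add: unchanged_def)
        let ?s3 = "s''(''d'' := (s'' ''d'')(0 := p), ''u'' := (s ''u'')(int r := 1))"
        have "elim_inv m n A jl (Suc k) ?s3 M' idx'"
          by (rule inv) (use A'' b'' new tab tabb l r in auto)
        moreover have "unchanged touched s0 ?s3" using un by (simp add: unchanged_def)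
        moreover have "\<bar>p\<bar> \<le> W" using bnd[OF r(1) l] by (simp add: p_def)
        ultimately show ?thesis using t W r(1) by (auto simp: c'' algebra_simps)
      qed
      done
  qed
  show ?thesis unfolding pivot_step_def
  proof (rule wp_SeqI[where P = "\<lambda>t s'. t \<le> 6 \<and> s' = ?s1"])
    show "wp W (''l'' ::= Load ''B'' (Var ''k'')) (\<lambda>t s'. t \<le> 6 \<and> s' = ?s1) s"
      using c k l W by (simp add: wp_simps)
    fix t :: nat and s' assume "t \<le> 6 \<and> s' = ?s1"
    then show "wp W (find_pivot ;; ''p'' ::= At ''r'' ''l'' ;; ''i'' ::= Const 0 ;;
      For ''i'' (Var ''m'') (IfPos (Mul (Sub (Var ''i'') (Var ''r'')) (Sub (Var ''i'') (Var ''r''))) row_update Skip) ;;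
      ''d'' ::= Var ''p'' ;; Store ''u'' (Var ''r'') (Const 1))
      (\<lambda>u s''. t + u \<le> m * (70 * n + 160) + 100 \<and> s'' ''k'' 0 = int k \<and>
       unchanged touched s0 s'' \<and> (\<exists>M idx. elim_inv m n A jl (Suc k) s'' M idx)) s'"
      apply (elim conjE, hypsubst)
      apply (rule wp_SeqI[OF find])
      apply (elim conjE exE)
      subgoal premises prems for t' s'' r
      proof -
        have "unchanged {''r''} ?s1 s''" "r < m" "s'' ''r'' 0 = int r" "s ''u'' (int r) = 0" "s ''A'' (ix n r l) \<noteq> 0"
          using prems by simp_all
        from rest[OF this] show ?thesis
          by (rule wp_conseq) (use prems in \<open>auto simp: algebra_simps\<close>)
      qed
      done
  qed
qed

lemma wp_eliminate:
  assumes tab: "\<And>i j. i < m \<Longrightarrow> j < n \<Longrightarrow> s0 ''A'' (ix n i j) = A $$ (i, j)" "\<And>i. i < m \<Longrightarrow> s0 ''b'' (int i) = A $$ (i, n)"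
    and u: "\<And>r. r < m \<Longrightarrow> s0 ''u'' (int r) = 0"
  shows "wp W eliminate (\<lambda>t s. t \<le> m * (m * (70 * n + 160) + 112) + 20 \<and> unchanged touched s0 s \<and>
    (\<exists>M idx. elim_inv m n A jl m s M idx)) s0"
proof -
  let ?s = "s0(''d'' := (s0 ''d'')(0 := 1), ''k'' := (s0 ''k'')(0 := 0))"
  have adj1: "adj_mat (1\<^sub>m m) = (1\<^sub>m m :: int mat)"
  proof -
    have "1 \<cdot>\<^sub>m 1\<^sub>m m = (1\<^sub>m m :: int mat)" by (rule eq_matI) auto
    then show ?thesis using adj_mat(1,2)[of "1\<^sub>m m :: int mat" m] by simp
  qed
  have init: "elim_inv m n A jl 0 ?s (1\<^sub>m m) id"
    using tab u A by (simp add: elim_inv_def adj1)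
  show ?thesis unfolding eliminate_def
    apply (simp add: wp_simps)
    apply (intro conjI)
    subgoal using W by simp
    subgoal using W by simp
    subgoal using W by simp
    apply (rule wp_For[where l = 0 and N = m and c = "m * (70 * n + 160) + 100" and
      I = "\<lambda>k s. unchanged touched s0 s \<and> (\<exists>M idx. elim_inv m n A jl k s M idx)"])
    subgoal by simp
    subgoal by simp
    subgoal using init by (auto simp: unchanged_def)
    subgoal for k s
      apply (elim conjE exE)
      subgoal for M idx by (rule wp_pivot_step)
      done
    subgoal for k s using s0 by (simp add: unchanged_def)
    subgoal for k s v by (auto simp: unchanged_def elim_inv_def)
    subgoal using W by simp
    subgoal for t s by (auto simp: algebra_simps)
    done
qed

end

section \<open>Dynamic programming by doubling\<close>

text \<open>Coordinates without reduction have modulus 0, and \<open>x div 0 = 0\<close> then leaves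
  the sum as it is. The sum is written to the free row \<open>C\<close> in any case and becomes a
  state only if \<open>accept\<close> advances \<open>C\<close>. The box test compares squares in
  place of absolute values.\<close>

definition digits :: com where
  "digits = ''o'' ::= Const 0 ;; ''y'' ::= Const 1 ;; ''i'' ::= Const 0 ;;
    For ''i'' (Var ''w'') (
      ''v'' ::= Add (Load ''V'' (Add (Mul (Var ''a'') (Var ''w'')) (Var ''i'')))
                    (Load ''V'' (Add (Mul (Var ''e'') (Var ''w'')) (Var ''i''))) ;;
      ''v'' ::= Sub (Var ''v'') (Mul (Load ''M'' (Var ''i'')) (Div (Var ''v'') (Load ''M'' (Var ''i'')))) ;;
      Store ''V'' (Add (Mul (Var ''C'') (Var ''w'')) (Var ''i'')) (Var ''v'') ;;
      ''o'' ::= Add (Mul (Var ''o'') (Var ''R'')) (Var ''v'') ;;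
      IfPos (Sub (Mul (Sub (Mul (Var ''p'') (Var ''v'')) (Load ''t'' (Var ''i'')))
                      (Sub (Mul (Var ''p'') (Var ''v'')) (Load ''t'' (Var ''i''))))
                 (Mul (Mul (Var ''p'') (Load ''D'' (Var ''i''))) (Mul (Var ''p'') (Load ''D'' (Var ''i'')))))
        (''y'' ::= Const 0) Skip)"

text \<open>A new state first receives one more than its value, so that the comparison below, shared
  with the case of a known state, is certain to replace it by the value itself.\<close>

definition accept :: com where
  "accept = IfPos (Var ''y'') (
     IfPos (Sub (Var ''U'') (Load ''T'' (Var ''o'')))
       (Store ''T'' (Var ''o'') (Var ''C'') ;;
        Store ''E'' (Var ''C'') (Add (Add (Load ''E'' (Var ''a'')) (Load ''E'' (Var ''e''))) (Const 1)) ;;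
        ''C'' ::= Add (Var ''C'') (Const 1)) Skip ;;
     ''s'' ::= Load ''T'' (Var ''o'') ;;
     IfPos (Sub (Load ''E'' (Var ''s'')) (Add (Load ''E'' (Var ''a'')) (Load ''E'' (Var ''e''))))
       (Store ''E'' (Var ''s'') (Add (Load ''E'' (Var ''a'')) (Load ''E'' (Var ''e'')))) Skip) Skip"

definition all_pairs :: com where
  "all_pairs = ''a'' ::= Var ''L'' ;;
     For ''a'' (Var ''U'') (''e'' ::= Var ''L'' ;; For ''e'' (Var ''N'') (digits ;; accept))"

text \<open>The results of a round become the segment that the next round reads, and from then on
  both summands range over all of it. At \<open>p = 1\<close> the division yields 0, which ends
  \<open>rounds\<close>.\<close>

definition one_round :: com where
  "one_round = all_pairs ;; ''L'' ::= Var ''U'' ;; ''U'' ::= Var ''C'' ;; ''N'' ::= Var ''C'' ;;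
     ''p'' ::= Div (Var ''p'') (Const 2)"

definition rounds :: com where
  "rounds = WhilePos (Var ''p'') one_round"

section \<open>Horner codes of integer vectors\<close>

fun horner :: "int \<Rightarrow> (nat \<Rightarrow> int) \<Rightarrow> nat \<Rightarrow> int" where
  "horner R f 0 = 0"
| "horner R f (Suc k) = horner R f k * R + f k"

lemma all_less_Suc_eq: "(\<forall>i<Suc k. P i) \<longleftrightarrow> (\<forall>i<k. P i) \<and> P k"
  by (auto simp: less_Suc_eq)

lemma horner_cong: "(\<And>i. i < k \<Longrightarrow> f i = g i) \<Longrightarrow> horner R f k = horner R g k"
  by (induction k) auto

text \<open>Digits may be negative. Two last digits differ by a multiple of R of absolute value at
  most \<open>2 * r < R\<close>, hence they agree, and the prefixes then have equal codes.\<close>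

lemma horner_inj:
  assumes "horner R f k = horner R g k" "\<And>i. i < k \<Longrightarrow> \<bar>f i\<bar> \<le> r" "\<And>i. i < k \<Longrightarrow> \<bar>g i\<bar> \<le> r" "2 * r < R"
  shows "\<forall>i<k. f i = g i"
  using assms(1-3)
proof (induction k)
  case (Suc k)
  have e: "(horner R f k - horner R g k) * R = g k - f k" using Suc.prems(1) by (simp add: algebra_simps)
  have "\<bar>g k - f k\<bar> < R" using Suc.prems(2,3)[of k] assms(4) by simp
  have "horner R f k = horner R g k"
  proof (rule ccontr)
    assume "horner R f k \<noteq> horner R g k"
    then have "1 * \<bar>R\<bar> \<le> \<bar>horner R f k - horner R g k\<bar> * \<bar>R\<bar>" by (intro mult_right_mono) auto
    also have "\<dots> = \<bar>g k - f k\<bar>" by (simp add: e flip: abs_mult)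
    finally show False using \<open>\<bar>g k - f k\<bar> < R\<close> by linarith
  qed
  with Suc e show ?case by (auto simp: less_Suc_eq)
qed simp

lemma horner_bound:
  assumes "\<And>i. i < k \<Longrightarrow> \<bar>f i\<bar> \<le> R" "0 \<le> R"
  shows "\<bar>horner R f k\<bar> < (R + 1) ^ k"
  using assms(1)
proof (induction k)
  case (Suc k)
  have "\<bar>horner R f (Suc k)\<bar> \<le> \<bar>horner R f k\<bar> * R + R"
    using Suc.prems[of k] assms(2) abs_triangle_ineq[of "horner R f k * R" "f k"] by (simp add: abs_mult)
  also have "\<dots> = (\<bar>horner R f k\<bar> + 1) * R" by (simp add: algebra_simps)
  also have "\<dots> \<le> (R + 1) ^ k * R" using Suc assms(2) by (intro mult_right_mono) auto
  also have "\<dots> < (R + 1) ^ Suc k" using assms(2) by (simp add: algebra_simps)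
  finally show ?case .
qed simp

text \<open>\<open>md i = 0\<close> marks a coordinate that is not reduced. r bounds the coordinates
  of states in a box, while \<beta> also bounds the initial columns, which are not yet reduced
  modulo \<open>md\<close>.\<close>

locale dp =
  fixes W :: int and n w \<rho> Kmax :: nat and a :: "nat \<Rightarrow> nat \<Rightarrow> int" and wt md tau hh :: "nat \<Rightarrow> int"
    and R r \<beta> Emax :: int
  assumes md: "\<And>i. i < w \<Longrightarrow> 0 \<le> md i \<and> md i \<le> r"
    and rad: "\<And>i. i < w \<Longrightarrow> md i = 0 \<Longrightarrow> \<bar>tau i\<bar> + hh i \<le> r" "\<And>i. i < w \<Longrightarrow> 0 \<le> hh i"
    and col: "\<And>i j. i < w \<Longrightarrow> j < n \<Longrightarrow> \<bar>a j i\<bar> \<le> \<beta>" "\<And>i j. i < w \<Longrightarrow> j < n \<Longrightarrow> md i = 0 \<Longrightarrow> \<bar>a j i\<bar> \<le> r"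
    and R: "2 * r < R" "0 \<le> r" "r \<le> \<beta>"
    and wt: "\<And>j. j < n \<Longrightarrow> 0 \<le> wt j \<and> wt j \<le> Emax" "0 \<le> Emax"
    and K1: "1 \<le> Kmax"
    and W: "(R + 1) ^ w \<le> W" "2 * \<beta> \<le> W" "2 ^ (\<rho> + 2) * (Emax + 1) \<le> W"
      "int ((n + 4 + (\<rho> + 1) * Kmax) * (w + 1)) \<le> W"
begin

definition st :: "nat multiset \<Rightarrow> nat \<Rightarrow> int" where
  "st X i = (\<Sum>j\<in>#X. a j i) mod md i"

definition ev :: "nat multiset \<Rightarrow> int" where
  "ev X = (\<Sum>j\<in>#X. wt j)"

text \<open>f lies within \<open>hh\<close> of the rational target \<open>tau / p\<close>;
  multiplying by p keeps the condition integral.\<close>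

definition box :: "int \<Rightarrow> (nat \<Rightarrow> int) \<Rightarrow> bool" where
  "box p f \<longleftrightarrow> (\<forall>i<w. \<bar>p * f i - tau i\<bar> \<le> p * hh i)"

lemma st_add: "st (X + Y) i = (st X i + st Y i) mod md i"
  by (simp add: st_def mod_add_eq)

lemma ev_add: "ev (X + Y) = ev X + ev Y"
  by (simp add: ev_def)

lemma ev_bound:
  assumes "set_mset X \<subseteq> {..<n}" shows "0 \<le> ev X" "ev X \<le> int (size X) * Emax"
  using assms by (induction X) (auto simp: ev_def algebra_simps dest!: wt(1))

lemma box_cong: "(\<And>i. i < w \<Longrightarrow> f i = g i) \<Longrightarrow> box p f = box p g"
  by (simp add: box_def)

text \<open>The target \<open>tau / p\<close> never exceeds tau in absolute value, so the bound is
  the same at all scales, and one radix R serves all rounds.\<close>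

lemma reduced_bound:
  assumes "box p f" "p > 0" "i < w" "f i mod md i = f i"
  shows "\<bar>f i\<bar> \<le> r"
proof (cases "md i = 0")
  case True
  have "\<bar>p * f i - tau i\<bar> \<le> p * hh i" using assms by (simp add: box_def)
  then have "\<bar>p * f i\<bar> \<le> p * hh i + \<bar>tau i\<bar>" by linarith
  also have "\<dots> \<le> p * (hh i + \<bar>tau i\<bar>)" using assms(2) mult_right_mono[of 1 p "\<bar>tau i\<bar>"] by (simp add: algebra_simps)
  finally have "p * \<bar>f i\<bar> \<le> p * (hh i + \<bar>tau i\<bar>)" using assms(2) by (simp add: abs_mult)
  then have "\<bar>f i\<bar> \<le> hh i + \<bar>tau i\<bar>" using assms(2) by simp
  then show ?thesis using rad(1)[OF assms(3) True] by simp
next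
  case False
  then have "0 < md i" using md[OF assms(3)] by simp
  then have "0 \<le> f i mod md i" "f i mod md i < md i" by simp_all
  then show ?thesis using assms(4) md[OF assms(3)] by simp
qed

definition params :: "store \<Rightarrow> bool" where
  "params s \<longleftrightarrow> s ''w'' 0 = int w \<and> s ''R'' 0 = R \<and>
    (\<forall>i<w. s ''M'' (int i) = md i \<and> s ''t'' (int i) = tau i \<and> s ''D'' (int i) = hh i)"

lemma abs_le_iff_squares: "0 \<le> y \<Longrightarrow> 0 < x * x - y * y \<longleftrightarrow> \<not> \<bar>x\<bar> \<le> y" for x y :: int
  using abs_le_square_iff[of x y] by (auto simp: power2_eq_square)

lemma wp_digits:
  assumes s: "params s" "s ''a'' 0 = int k1" "s ''e'' 0 = int k2" "s ''C'' 0 = int cur" "s ''p'' 0 = p"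
    and k: "k1 < cur" "k2 < cur" "cur \<le> n + 2 + (\<rho> + 1) * Kmax" and p: "0 \<le> p"
    and V: "\<And>i. i < w \<Longrightarrow> \<bar>s ''V'' (ix w k1 i)\<bar> \<le> \<beta> \<and> \<bar>s ''V'' (ix w k2 i)\<bar> \<le> \<beta>"
      "\<And>i. i < w \<Longrightarrow> md i = 0 \<Longrightarrow> \<bar>s ''V'' (ix w k1 i)\<bar> \<le> r \<and> \<bar>s ''V'' (ix w k2 i)\<bar> \<le> r"
  defines "val \<equiv> \<lambda>i. (s ''V'' (ix w k1 i) + s ''V'' (ix w k2 i)) mod md i"
  shows "wp W digits (\<lambda>t s'. t \<le> 120 * w + 30 \<and> unchanged {''o'', ''y'', ''i'', ''v'', ''V''} s s' \<and>
    (\<forall>k<cur. \<forall>i<w. s' ''V'' (ix w k i) = s ''V'' (ix w k i)) \<and> (\<forall>i<w. s' ''V'' (ix w cur i) = val i) \<and>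
    s' ''o'' 0 = horner R val w \<and> s' ''y'' 0 = (if box p val then 1 else 0)) s"
proof -
  define I where "I k s' \<longleftrightarrow> unchanged {''o'', ''y'', ''i'', ''v'', ''V''} s s' \<and>
    (\<forall>k<cur. \<forall>i<w. s' ''V'' (ix w k i) = s ''V'' (ix w k i)) \<and> (\<forall>i<k. s' ''V'' (ix w cur i) = val i) \<and>
    s' ''o'' 0 = horner R val k \<and> s' ''y'' 0 = (if \<forall>i<k. \<bar>p * val i - tau i\<bar> \<le> p * hh i then 1 else 0)" for k s'
  have W1: "1 \<le> W" and Ww: "int w \<le> W"
  proof -
    have "1 * (w + 1) \<le> (n + 4 + (\<rho> + 1) * Kmax) * (w + 1)" by (intro mult_right_mono) auto
    then have "int (w + 1) \<le> W" using W(4) by (metis mult_1 of_nat_mono order_trans)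
    then show "1 \<le> W" "int w \<le> W" by auto
  qed
  \<comment> \<open>Before the box test an unreduced sum of two states is only known to be at most
    \<open>2 * r\<close>, which is why R and not r appears here.\<close>
  have val: "\<bar>val i\<bar> \<le> R" if "i < w" for i
  proof (cases "md i = 0")
    case True
    then have "\<bar>val i\<bar> = \<bar>s ''V'' (ix w k1 i) + s ''V'' (ix w k2 i)\<bar>" by (simp add: val_def)
    then show ?thesis using V(2)[OF that True] R(1) by linarith
  next
    case False
    then have "0 < md i" using md[OF that] by simp
    then have "0 \<le> val i" "val i < md i" by (simp_all add: val_def)
    then show ?thesis using md[OF that] R by linarith
  qed
  have R0: "0 \<le> R" using R by linarith
  have addr: "\<bar>ix w cur i\<bar> \<le> W" if "i < w" for i
  proof -
    have "ix w cur i \<le> int (cur * w + w)" using that by (simp add: ix_def)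
    also have "cur * w + w \<le> (n + 4 + (\<rho> + 1) * Kmax) * (w + 1)"
      using k(3) mult_right_mono[of "cur + 1" "n + 4 + (\<rho> + 1) * Kmax" w] by simp
    finally show ?thesis using W(4) by (simp add: ix_def)
  qed
  have hb: "\<bar>horner R val k\<bar> \<le> W" if "k \<le> w" for k
  proof -
    have "\<bar>horner R val k\<bar> < (R + 1) ^ k" by (rule horner_bound) (use val that R0 in auto)
    also have "\<dots> \<le> (R + 1) ^ w" using R0 that by (intro power_increasing) auto
    finally show ?thesis using W(1) by linarith
  qed
  have valW: "\<bar>val i\<bar> \<le> W" if "i < w" for i
  proof -
    have "R + 1 \<le> (R + 1) ^ w" using that R0 by (intro self_le_power) auto
    then show ?thesis using val[OF that] W(1) by linarith
  qed
  show ?thesis unfolding digits_def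
    apply (simp add: wp_simps W1 order_trans[OF zero_le_one W1] split del: if_split)
    apply (rule wp_For[where l = 0 and N = w and c = 100 and I = I])
    subgoal by simp
    subgoal by simp
    subgoal by (simp add: I_def unchanged_def)
    subgoal premises prems for i s'
    proof -
      have eq: "s' ''w'' = s ''w''" "s' ''R'' = s ''R''" "s' ''M'' = s ''M''" "s' ''t'' = s ''t''" "s' ''D'' = s ''D''"
        "s' ''a'' = s ''a''" "s' ''e'' = s ''e''" "s' ''C'' = s ''C''" "s' ''p'' = s ''p''"
        using prems(3) by (auto simp: I_def unchanged_def)
      have c: "s ''w'' 0 = int w" "s ''R'' 0 = R" "s ''M'' (int i) = md i" "s ''t'' (int i) = tau i" "s ''D'' (int i) = hh i"
        using s(1) prems(2) by (auto simp: params_def)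
      have v: "s' ''V'' (ix w k1 i) = s ''V'' (ix w k1 i)" "s' ''V'' (ix w k2 i) = s ''V'' (ix w k2 i)"
        and o: "s' ''o'' 0 = horner R val i"
        using prems(2,3) k by (auto simp: I_def)
      have sumW: "\<bar>s ''V'' (ix w k1 i) + s ''V'' (ix w k2 i)\<bar> \<le> W" using V(1)[OF prems(2)] W(2) by linarith
      have modeq: "s ''V'' (ix w k1 i) + s ''V'' (ix w k2 i) - md i * ((s ''V'' (ix w k1 i) + s ''V'' (ix w k2 i)) div md i) = val i"
        by (simp add: val_def minus_mult_div_eq_mod)
      have phh: "0 \<le> p * hh i" using p rad(2)[OF prems(2)] by simp
      have Vnew: "\<forall>k<cur. \<forall>j<w. ((s' ''V'')(ix w cur i := val i)) (ix w k j) = s ''V'' (ix w k j)"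
        "\<forall>j<Suc i. ((s' ''V'')(ix w cur i := val i)) (ix w cur j) = val j"
        using prems(2,3) by (auto simp: I_def ix_eq_iff less_Suc_eq)
      have un: "unchanged {''o'', ''y'', ''i'', ''v'', ''V''} s s'" using prems(3) by (simp add: I_def)
      have y: "s' ''y'' 0 = (if \<forall>i'<i. \<bar>p * val i' - tau i'\<bar> \<le> p * hh i' then 1 else 0)" using prems(3) by (simp add: I_def)
      let ?s2 = "s'(''v'' := (s' ''v'')(0 := val i), ''V'' := (s' ''V'')(ix w cur i := val i),
        ''o'' := (s' ''o'')(0 := horner R val i * R + val i))"
      have I1: "I (Suc i) ?s2" if "\<bar>p * val i - tau i\<bar> \<le> p * hh i"
        unfolding I_def using that un y Vnew by (simp add: unchanged_def all_less_Suc_eq)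
      have I2: "I (Suc i) (?s2(''y'' := (s' ''y'')(0 := 0)))" if "\<not> \<bar>p * val i - tau i\<bar> \<le> p * hh i"
        unfolding I_def using that un Vnew by (simp add: unchanged_def all_less_Suc_eq)
      have test: "0 < (p * val i - tau i) * (p * val i - tau i) - p * hh i * (p * hh i) \<longleftrightarrow> \<not> \<bar>p * val i - tau i\<bar> \<le> p * hh i"
        by (rule abs_le_iff_squares[OF phh])
      have bounds: "\<bar>val i\<bar> \<le> W" "\<bar>ix w cur i\<bar> \<le> W" "\<bar>horner R val i * R + val i\<bar> \<le> W" "0 \<le> W" "1 \<le> W"
        using valW[OF prems(2)] addr[OF prems(2)] hb[of "Suc i"] prems(2) W1 by auto
      show ?thesis
      proof (cases "\<bar>p * val i - tau i\<bar> \<le> p * hh i")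
        case True
        then show ?thesis using I1[OF True] test
          by (simp add: wp_simps eq s c prems(4) v o modeq bounds sumW flip: ix_def)
      next
        case False
        then show ?thesis using I2[OF False] test
          by (simp add: wp_simps eq s c prems(4) v o modeq bounds sumW flip: ix_def)
      qed
    qed
    subgoal for i s' using s by (simp add: I_def unchanged_def params_def)
    subgoal for i s' v by (auto simp: I_def unchanged_def)
    subgoal using Ww .
    subgoal for t s' by (auto simp: I_def box_def)
    done
qed

section \<open>Invariants of a round\<close>

definition generated :: "store \<Rightarrow> int \<Rightarrow> nat \<Rightarrow> nat \<Rightarrow> nat \<Rightarrow> bool" where
  "generated s p lo hi sz \<longleftrightarrow> (\<forall>k. lo \<le> k \<longrightarrow> k < hi \<longrightarrow> (\<exists>X. set_mset X \<subseteq> {..<n} \<and> size X \<le> sz \<and>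
    (\<forall>i<w. s ''V'' (ix w k i) = st X i) \<and> box p (st X) \<and> s ''E'' (int k) = ev X \<and>
    s ''T'' (horner R (st X) w) = int k))"

text \<open>A cell pointing below \<open>lo\<close> counts as empty. This covers untouched cells,
  which hold 0, as well as leftovers of earlier rounds, so no time is spent on clearing.\<close>

definition table :: "store \<Rightarrow> nat \<Rightarrow> nat \<Rightarrow> bool" where
  "table s lo hi \<longleftrightarrow> (\<forall>c. s ''T'' c < int lo \<or>
    (\<exists>k. lo \<le> k \<and> k < hi \<and> s ''T'' c = int k \<and> c = horner R (\<lambda>i. s ''V'' (ix w k i)) w))"

text \<open>Weaker than \<open>generated\<close>, because the columns that feed the first round are
  neither reduced nor confined to a box.\<close>

definition source :: "store \<Rightarrow> nat \<Rightarrow> nat \<Rightarrow> nat \<Rightarrow> bool" where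
  "source s lo hi sz \<longleftrightarrow> (\<forall>k. lo \<le> k \<longrightarrow> k < hi \<longrightarrow> (\<exists>X. set_mset X \<subseteq> {..<n} \<and> size X \<le> sz \<and>
    (\<forall>i<w. s ''V'' (ix w k i) mod md i = st X i \<and> \<bar>s ''V'' (ix w k i)\<bar> \<le> \<beta> \<and> (md i = 0 \<longrightarrow> \<bar>s ''V'' (ix w k i)\<bar> \<le> r)) \<and>
    s ''E'' (int k) = ev X))"

definition val :: "store \<Rightarrow> nat \<Rightarrow> nat \<Rightarrow> nat \<Rightarrow> int" where
  "val s k1 k2 i = (s ''V'' (ix w k1 i) + s ''V'' (ix w k2 i)) mod md i"

definition covered :: "store \<Rightarrow> store \<Rightarrow> int \<Rightarrow> nat \<Rightarrow> nat \<Rightarrow> (nat \<times> nat) set \<Rightarrow> bool" where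
  "covered s0 s p lo hi dn \<longleftrightarrow> (\<forall>(k1, k2)\<in>dn. box p (val s0 k1 k2) \<longrightarrow> (\<exists>k. lo \<le> k \<and> k < hi \<and>
    (\<forall>i<w. s ''V'' (ix w k i) = val s0 k1 k2 i) \<and> s ''E'' (int k) \<le> s0 ''E'' (int k1) + s0 ''E'' (int k2)))"

abbreviation "touched \<equiv> {''o'', ''y'', ''i'', ''v'', ''V'', ''T'', ''E'', ''C'', ''s'', ''a'', ''e''}"

definition round_inv :: "store \<Rightarrow> int \<Rightarrow> nat \<Rightarrow> nat \<Rightarrow> (nat \<times> nat) set \<Rightarrow> store \<Rightarrow> bool" where
  "round_inv s0 p hi sz dn s \<longleftrightarrow> unchanged touched s0 s \<and> (\<exists>cur. s ''C'' 0 = int cur \<and> hi \<le> cur \<and>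
    (\<forall>k<hi. (\<forall>i<w. s ''V'' (ix w k i) = s0 ''V'' (ix w k i)) \<and> s ''E'' (int k) = s0 ''E'' (int k)) \<and>
    generated s p hi cur sz \<and> table s hi cur \<and> covered s0 s p hi cur dn)"

text \<open>The table makes the codes, hence the states, of a segment pairwise distinct.\<close>

lemma generated_card:
  assumes g: "generated s p hi cur sz" and p: "0 < p"
    and count: "finite {\<lambda>i\<in>{..<w}. st X i | X. set_mset X \<subseteq> {..<n} \<and> box p (st X)}"
      "card {\<lambda>i\<in>{..<w}. st X i | X. set_mset X \<subseteq> {..<n} \<and> box p (st X)} \<le> Kmax"
  shows "cur - hi \<le> Kmax"
proof -
  define f where "f k = (\<lambda>i\<in>{..<w}. s ''V'' (ix w k i))" for k
  have f: "f k \<in> {\<lambda>i\<in>{..<w}. st X i | X. set_mset X \<subseteq> {..<n} \<and> box p (st X)}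
      \<and> s ''T'' (horner R (f k) w) = int k" if k: "hi \<le> k" "k < cur" for k
  proof -
    from g k obtain X where X: "set_mset X \<subseteq> {..<n}" "\<forall>i<w. s ''V'' (ix w k i) = st X i" "box p (st X)"
      "s ''T'' (horner R (st X) w) = int k" unfolding generated_def by blast
    have "f k = (\<lambda>i\<in>{..<w}. st X i)" using X(2) by (auto simp: f_def)
    moreover have "horner R (f k) w = horner R (st X) w" by (rule horner_cong) (use X(2) in \<open>simp add: f_def\<close>)
    ultimately show ?thesis using X by auto
  qed
  have "inj_on f {hi..<cur}"
    by (rule inj_onI) (metis f atLeastLessThan_iff of_nat_eq_iff)
  then have "card {hi..<cur} \<le> card {\<lambda>i\<in>{..<w}. st X i | X. set_mset X \<subseteq> {..<n} \<and> box p (st X)}"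
    by (rule card_inj_on_le) (use f count in auto)
  then show ?thesis using count by simp
qed

text \<open>If the code is already present, injectivity of codes on the box shows that the stored
  state has the coordinates of X. Lowering its value to that of X therefore keeps a genuine multiset
  behind the entry.\<close>

lemma wp_accept:
  assumes g: "generated s p hi cur sz" and t: "table s hi cur"
    and c: "s ''C'' 0 = int cur" "s ''U'' 0 = int hi" "s ''a'' 0 = int k1" "s ''e'' 0 = int k2" "hi \<le> cur" "k1 < hi" "k2 < hi"
    and y: "s ''y'' 0 = (if box p (st X) then 1 else 0)" and o: "s ''o'' 0 = horner R (st X) w"
    and V: "\<And>i. i < w \<Longrightarrow> s ''V'' (ix w cur i) = st X i"
    and X: "set_mset X \<subseteq> {..<n}" "size X \<le> sz" "ev X = s ''E'' (int k1) + s ''E'' (int k2)" "sz \<le> 2 ^ (\<rho> + 1)"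
    and p: "0 < p" and cW: "\<bar>horner R (st X) w\<bar> \<le> W" "int cur + 1 \<le> W"
  shows "wp W accept (\<lambda>t s'. t \<le> 70 \<and> unchanged {''T'', ''E'', ''C'', ''s''} s s' \<and> (\<exists>cur'\<ge>cur.
     s' ''C'' 0 = int cur' \<and> (\<forall>k<hi. s' ''E'' (int k) = s ''E'' (int k)) \<and>
     (\<forall>k. hi \<le> k \<longrightarrow> k < cur \<longrightarrow> s' ''E'' (int k) \<le> s ''E'' (int k)) \<and>
     generated s' p hi cur' sz \<and> table s' hi cur' \<and>
     (box p (st X) \<longrightarrow> (\<exists>k. hi \<le> k \<and> k < cur' \<and> (\<forall>i<w. s ''V'' (ix w k i) = st X i) \<and> s' ''E'' (int k) \<le> ev X)))) s"
proof -
  define post where "post s' \<longleftrightarrow> (\<exists>cur'\<ge>cur.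
     s' ''C'' 0 = int cur' \<and> (\<forall>k<hi. s' ''E'' (int k) = s ''E'' (int k)) \<and>
     (\<forall>k. hi \<le> k \<longrightarrow> k < cur \<longrightarrow> s' ''E'' (int k) \<le> s ''E'' (int k)) \<and>
     generated s' p hi cur' sz \<and> table s' hi cur' \<and>
     (box p (st X) \<longrightarrow> (\<exists>k. hi \<le> k \<and> k < cur' \<and> (\<forall>i<w. s ''V'' (ix w k i) = st X i) \<and> s' ''E'' (int k) \<le> ev X)))" for s'
  have postI: "post s'" if "cur \<le> cur'" "s' ''C'' 0 = int cur'" "\<forall>k<hi. s' ''E'' (int k) = s ''E'' (int k)"
     "\<forall>k. hi \<le> k \<longrightarrow> k < cur \<longrightarrow> s' ''E'' (int k) \<le> s ''E'' (int k)"
     "generated s' p hi cur' sz" "table s' hi cur'"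
     "\<exists>k. hi \<le> k \<and> k < cur' \<and> (\<forall>i<w. s ''V'' (ix w k i) = st X i) \<and> s' ''E'' (int k) \<le> ev X" for s' cur'
    unfolding post_def using that by blast
  have "wp W accept (\<lambda>t s'. t \<le> 70 \<and> unchanged {''T'', ''E'', ''C'', ''s''} s s' \<and> post s') s"
proof (cases "box p (st X)")
  case False
  then have "post s" using g t c by (auto simp: post_def)
  then show ?thesis using y False unfolding accept_def
    by (auto simp: wp_simps unchanged_refl)
next
  case True
  let ?o = "horner R (st X) w"
  \<comment> \<open>The spare 1 is for the provisional value written for a new state.\<close>
  have evW: "\<bar>ev X\<bar> + 1 \<le> W"
  proof -
    have "ev X \<le> int (size X) * Emax" "0 \<le> ev X" using ev_bound[OF X(1)] by auto
    moreover have "int (size X) * Emax \<le> 2 ^ (\<rho> + 1) * Emax"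
    proof (rule mult_right_mono[OF _ wt(2)])
      have "int (size X) \<le> int (2 ^ (\<rho> + 1))" using X(2,4) by (simp only: of_nat_le_iff)
      then show "int (size X) \<le> 2 ^ (\<rho> + 1)" by simp
    qed
    moreover have "(2::int) ^ (\<rho> + 1) * Emax + 1 \<le> 2 ^ (\<rho> + 2) * (Emax + 1)"
    proof -
      have e: "(2::int) ^ (\<rho> + 1) * Emax = 2 * (2 ^ \<rho> * Emax)" "2 ^ (\<rho> + 2) * (Emax + 1) = 4 * (2 ^ \<rho> * Emax) + 4 * 2 ^ \<rho>"
        by (simp_all add: algebra_simps)
      have "0 \<le> 2 ^ \<rho> * Emax" using wt(2) by (intro mult_nonneg_nonneg) auto
      moreover have "(1 :: int) \<le> 2 ^ \<rho>" by simp
      ultimately show ?thesis unfolding e by linarith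
    qed
    ultimately show ?thesis using W(3) by linarith
  qed
  have W1: "1 \<le> W" "0 \<le> W" using cW by linarith+
  show ?thesis
  proof (cases "s ''T'' ?o < int hi")
    case new: True
    let ?s = "s(''T'' := (s ''T'')(?o := int cur), ''C'' := (s ''C'')(0 := int cur + 1), ''s'' := (s ''s'')(0 := int cur), ''E'' := (s ''E'')(int cur := ev X))"
    have g': "generated ?s p hi (Suc cur) sz" unfolding generated_def
    proof (intro allI impI)
      fix k assume k: "hi \<le> k" "k < Suc cur"
      show "\<exists>X. set_mset X \<subseteq> {..<n} \<and> size X \<le> sz \<and> (\<forall>i<w. ?s ''V'' (ix w k i) = st X i) \<and>
          box p (st X) \<and> ?s ''E'' (int k) = ev X \<and> ?s ''T'' (horner R (st X) w) = int k"
      proof (cases "k = cur")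
        case True
        then show ?thesis using X(1,2) V \<open>box p (st X)\<close> by (intro exI[of _ X]) auto
      next
        case False
        then obtain X' where X': "set_mset X' \<subseteq> {..<n}" "size X' \<le> sz" "\<forall>i<w. s ''V'' (ix w k i) = st X' i" "box p (st X')"
          "s ''E'' (int k) = ev X'" "s ''T'' (horner R (st X') w) = int k"
          using g k unfolding generated_def by (metis less_SucE)
        \<comment> \<open>The cell of the new code was empty, whereas the cell of every state in the
          segment points into the segment; overwriting thus disturbs no other state.\<close>
        moreover then have "horner R (st X') w \<noteq> ?o" using new k by auto
        ultimately show ?thesis using False by (intro exI[of _ X']) auto
      qed
    qed
    have t': "table ?s hi (Suc cur)" unfolding table_def
    proof
      fix c' show "?s ''T'' c' < int hi \<or> (\<exists>k. hi \<le> k \<and> k < Suc cur \<and> ?s ''T'' c' = int k \<and> c' = horner R (\<lambda>i. ?s ''V'' (ix w k i)) w)"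
      proof (cases "c' = ?o")
        case True
        moreover have "?o = horner R (\<lambda>i. s ''V'' (ix w cur i)) w" by (rule horner_cong) (use V in simp)
        ultimately show ?thesis using c(5) by (intro disjI2 exI[of _ cur]) simp
      next
        case False
        then show ?thesis using t[unfolded table_def, rule_format, of c'] by (auto simp: less_SucI)
      qed
    qed
    have E': "\<forall>k<hi. ?s ''E'' (int k) = s ''E'' (int k)" "\<forall>k. hi \<le> k \<longrightarrow> k < cur \<longrightarrow> ?s ''E'' (int k) \<le> s ''E'' (int k)"
      using c(5) by auto
    have ex: "\<exists>k. hi \<le> k \<and> k < Suc cur \<and> (\<forall>i<w. s ''V'' (ix w k i) = st X i) \<and> ?s ''E'' (int k) \<le> ev X"
      using c(5) V by (intro exI[of _ cur]) simp
    have "?s ''C'' 0 = int (Suc cur)" by simp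
    have "post ?s" by (rule postI[OF _ \<open>?s ''C'' 0 = int (Suc cur)\<close> E' g' t' ex]) simp
    moreover have "unchanged {''T'', ''E'', ''C'', ''s''} s ?s" by (simp add: unchanged_def)
    ultimately show ?thesis using new True y o evW cW c X(3)[symmetric] W1 unfolding accept_def
      by (simp add: wp_simps)
  next
    case old: False
    then obtain k where k: "hi \<le> k" "k < cur" "s ''T'' ?o = int k" "?o = horner R (\<lambda>i. s ''V'' (ix w k i)) w"
      using t unfolding table_def by (metis not_less)
    from g k obtain X' where X': "set_mset X' \<subseteq> {..<n}" "size X' \<le> sz" "\<forall>i<w. s ''V'' (ix w k i) = st X' i" "box p (st X')"
      "s ''E'' (int k) = ev X'" "s ''T'' (horner R (st X') w) = int k" unfolding generated_def by blast
    have eqst: "\<forall>i<w. st X i = st X' i"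
    proof (rule horner_inj[of R _ w _ r])
      have "horner R (\<lambda>i. s ''V'' (ix w k i)) w = horner R (st X') w" by (rule horner_cong) (use X'(3) in simp)
      then show "horner R (st X) w = horner R (st X') w" using k(4) by simp
      show "\<bar>st X i\<bar> \<le> r" if "i < w" for i using reduced_bound[OF True p that] by (simp add: st_def)
      show "\<bar>st X' i\<bar> \<le> r" if "i < w" for i using reduced_bound[OF X'(4) p that] by (simp add: st_def)
    qed (rule R(1))
    let ?b = "ev X < s ''E'' (int k)"
    let ?E = "if ?b then (s ''E'')(int k := ev X) else s ''E''"
    let ?s = "s(''s'' := (s ''s'')(0 := int k), ''E'' := ?E)"
    have g': "generated ?s p hi cur sz" unfolding generated_def
    proof (intro allI impI)
      fix k' assume k': "hi \<le> k'" "k' < cur"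
      show "\<exists>X. set_mset X \<subseteq> {..<n} \<and> size X \<le> sz \<and> (\<forall>i<w. ?s ''V'' (ix w k' i) = st X i) \<and>
          box p (st X) \<and> ?s ''E'' (int k') = ev X \<and> ?s ''T'' (horner R (st X) w) = int k'"
      proof (cases "k' = k \<and> ?b")
        case True
        then show ?thesis using X(1,2) X'(3) k(3) eqst \<open>box p (st X)\<close> by (intro exI[of _ X]) auto
      next
        case False
        then have "?s ''E'' (int k') = s ''E'' (int k')" by auto
        moreover have "?s ''V'' = s ''V''" "?s ''T'' = s ''T''" by simp_all
        ultimately show ?thesis using g k' unfolding generated_def by metis
      qed
    qed
    have t': "table ?s hi cur" using t unfolding table_def by simp
    have E': "\<forall>k<hi. ?s ''E'' (int k) = s ''E'' (int k)" "\<forall>k. hi \<le> k \<longrightarrow> k < cur \<longrightarrow> ?s ''E'' (int k) \<le> s ''E'' (int k)"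
      "?s ''E'' (int k) \<le> ev X" using k(1) by auto
    have ex: "\<exists>k'. hi \<le> k' \<and> k' < cur \<and> (\<forall>i<w. s ''V'' (ix w k' i) = st X i) \<and> ?s ''E'' (int k') \<le> ev X"
      using k(1,2) X'(3) eqst E'(3) by (intro exI[of _ k]) auto
    have "?s ''C'' 0 = int cur" using c by simp
    have post: "post ?s" by (rule postI[OF order_refl \<open>?s ''C'' 0 = int cur\<close> E'(1,2) g' t' ex])
    have un: "unchanged {''T'', ''E'', ''C'', ''s''} s ?s" by (simp add: unchanged_def)
    have kW: "\<bar>int k\<bar> \<le> W" using k cW by simp
    show ?thesis
    proof (cases ?b)
      case b: True
      then have s': "?s = s(''s'' := (s ''s'')(0 := int k), ''E'' := (s ''E'')(int k := ev X))" by simp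
      show ?thesis using True y o k(1,3) evW c X(3)[symmetric] W1 b kW unfolding accept_def
        using post un unfolding s' by (simp add: wp_simps)
    next
      case b: False
      then have s': "?s = s(''s'' := (s ''s'')(0 := int k))" by (auto simp: fun_eq_iff)
      show ?thesis using True y o k(1,3) evW c X(3)[symmetric] W1 b kW unfolding accept_def
        using post un unfolding s' by (simp add: wp_simps)
    qed
  qed
qed
  then show ?thesis unfolding post_def .
qed

end

section \<open>Rounds of the dynamic program\<close>

context dp begin

definition states :: "int \<Rightarrow> (nat \<Rightarrow> int) set" where
  "states p = {\<lambda>i\<in>{..<w}. st X i | X. set_mset X \<subseteq> {..<n} \<and> box p (st X)}"

lemma table_V_cong:
  assumes "table s lo hi" "s' ''T'' = s ''T''" "\<And>k i. k < hi \<Longrightarrow> i < w \<Longrightarrow> s' ''V'' (ix w k i) = s ''V'' (ix w k i)"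
  shows "table s' lo hi"
  unfolding table_def
proof
  fix c
  show "s' ''T'' c < int lo \<or> (\<exists>k\<ge>lo. k < hi \<and> s' ''T'' c = int k \<and> c = horner R (\<lambda>i. s' ''V'' (ix w k i)) w)"
  proof (cases "s ''T'' c < int lo")
    case False
    then obtain k where k: "lo \<le> k" "k < hi" "s ''T'' c = int k" "c = horner R (\<lambda>i. s ''V'' (ix w k i)) w"
      using assms(1) unfolding table_def by blast
    moreover have "horner R (\<lambda>i. s ''V'' (ix w k i)) w = horner R (\<lambda>i. s' ''V'' (ix w k i)) w"
      by (rule horner_cong) (use assms(3) k in simp)
    ultimately show ?thesis using assms(2) by auto
  qed (use assms(2) in simp)
qed

lemma generated_V_cong:
  assumes "generated s p lo hi sz" "s' ''T'' = s ''T''" "s' ''E'' = s ''E''"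
    "\<And>k i. k < hi \<Longrightarrow> i < w \<Longrightarrow> s' ''V'' (ix w k i) = s ''V'' (ix w k i)"
  shows "generated s' p lo hi sz"
  using assms unfolding generated_def by metis

lemma wp_combine:
  assumes inv: "round_inv s0 p hi (2 * sz) dn s" and src: "source s0 lo hi sz" and par: "params s0"
    and c: "s0 ''U'' 0 = int hi" "s0 ''p'' 0 = p" "s ''a'' 0 = int k1" "s ''e'' 0 = int k2"
    and k: "lo \<le> k1" "k1 < hi" "lo \<le> k2" "k2 < hi" and p: "0 < p"
    and count: "finite (states p)" "card (states p) \<le> Kmax" and hi: "hi \<le> n + 1 + \<rho> * Kmax"
    and sz: "2 * sz \<le> 2 ^ (\<rho> + 1)"
  shows "wp W (digits ;; accept) (\<lambda>t s'. t \<le> 120 * w + 110 \<and> s' ''a'' 0 = int k1 \<and> s' ''e'' 0 = int k2 \<and>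
     round_inv s0 p hi (2 * sz) (insert (k1, k2) dn) s') s"
proof -
  from inv obtain cur where un: "unchanged touched s0 s" and cur: "s ''C'' 0 = int cur" "hi \<le> cur"
    and old: "\<And>k i. k < hi \<Longrightarrow> i < w \<Longrightarrow> s ''V'' (ix w k i) = s0 ''V'' (ix w k i)" "\<And>k. k < hi \<Longrightarrow> s ''E'' (int k) = s0 ''E'' (int k)"
    and gen: "generated s p hi cur (2 * sz)" and tab: "table s hi cur" and cov: "covered s0 s p hi cur dn"
    unfolding round_inv_def by blast
  \<comment> \<open>The number of rows in use is controlled by counting states, since states of a
    segment are distinct. This in turn bounds all addresses.\<close>
  have cur_le: "cur \<le> n + 1 + (\<rho> + 1) * Kmax"
    using generated_card[OF gen p] count hi unfolding states_def by simp
  have curW: "int cur + 1 \<le> W"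
  proof -
    have "(cur + 1) * 1 \<le> (n + 4 + (\<rho> + 1) * Kmax) * (w + 1)" using cur_le by (intro mult_mono) auto
    then have "int (cur + 1) \<le> int ((n + 4 + (\<rho> + 1) * Kmax) * (w + 1))" by (simp only: of_nat_le_iff mult_1_right)
    then show ?thesis using W(4) by linarith
  qed
  obtain X1 where X1: "set_mset X1 \<subseteq> {..<n}" "size X1 \<le> sz"
    "\<And>i. i < w \<Longrightarrow> s0 ''V'' (ix w k1 i) mod md i = st X1 i \<and> \<bar>s0 ''V'' (ix w k1 i)\<bar> \<le> \<beta> \<and> (md i = 0 \<longrightarrow> \<bar>s0 ''V'' (ix w k1 i)\<bar> \<le> r)"
    "s0 ''E'' (int k1) = ev X1" using src k unfolding source_def by blast
  obtain X2 where X2: "set_mset X2 \<subseteq> {..<n}" "size X2 \<le> sz"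
    "\<And>i. i < w \<Longrightarrow> s0 ''V'' (ix w k2 i) mod md i = st X2 i \<and> \<bar>s0 ''V'' (ix w k2 i)\<bar> \<le> \<beta> \<and> (md i = 0 \<longrightarrow> \<bar>s0 ''V'' (ix w k2 i)\<bar> \<le> r)"
    "s0 ''E'' (int k2) = ev X2" using src k unfolding source_def by blast
  define X where "X = X1 + X2"
  have X: "set_mset X \<subseteq> {..<n}" "size X \<le> 2 * sz" using X1 X2 by (auto simp: X_def)
  have v: "(s ''V'' (ix w k1 i) + s ''V'' (ix w k2 i)) mod md i = st X i" "val s0 k1 k2 i = st X i" if "i < w" for i
    using X1(3)[OF that] X2(3)[OF that] old(1)[OF k(2) that] old(1)[OF k(4) that]
      mod_add_eq[of "s0 ''V'' (ix w k1 i)" "md i" "s0 ''V'' (ix w k2 i)"] by (simp_all add: X_def st_add val_def)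
  have hor: "horner R (\<lambda>i. (s ''V'' (ix w k1 i) + s ''V'' (ix w k2 i)) mod md i) w = horner R (st X) w"
    by (rule horner_cong) (rule v(1))
  have bx: "box p (\<lambda>i. (s ''V'' (ix w k1 i) + s ''V'' (ix w k2 i)) mod md i) = box p (st X)"
    by (rule box_cong) (rule v(1))
  have bx0: "box p (val s0 k1 k2) = box p (st X)" by (rule box_cong) (rule v(2))
  have par': "params s" using par un by (auto simp: params_def unchanged_def)
  have dig: "wp W digits (\<lambda>t s'. t \<le> 120 * w + 30 \<and> unchanged {''o'', ''y'', ''i'', ''v'', ''V''} s s' \<and>
    (\<forall>k<cur. \<forall>i<w. s' ''V'' (ix w k i) = s ''V'' (ix w k i)) \<and>
    (\<forall>i<w. s' ''V'' (ix w cur i) = (s ''V'' (ix w k1 i) + s ''V'' (ix w k2 i)) mod md i) \<and>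
    s' ''o'' 0 = horner R (\<lambda>i. (s ''V'' (ix w k1 i) + s ''V'' (ix w k2 i)) mod md i) w \<and>
    s' ''y'' 0 = (if box p (\<lambda>i. (s ''V'' (ix w k1 i) + s ''V'' (ix w k2 i)) mod md i) then 1 else 0)) s"
    by (rule wp_digits) (use par' c k cur cur_le p un old X1(3) X2(3) in \<open>auto simp: unchanged_def\<close>)
  have hW: "\<bar>horner R (st X) w\<bar> \<le> W" if "box p (st X)"
  proof -
    have "\<bar>horner R (st X) w\<bar> < (R + 1) ^ w"
      by (rule horner_bound) (use reduced_bound[OF that p] R in \<open>fastforce simp: st_def\<close>)+
    then show ?thesis using W(1) by linarith
  qed
  show ?thesis
  proof (rule wp_SeqI[OF dig], elim conjE)
    fix t :: nat and s1
    assume t: "t \<le> 120 * w + 30" and u1: "unchanged {''o'', ''y'', ''i'', ''v'', ''V''} s s1"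
      and V1: "\<forall>k<cur. \<forall>i<w. s1 ''V'' (ix w k i) = s ''V'' (ix w k i)"
      and Vc: "\<forall>i<w. s1 ''V'' (ix w cur i) = (s ''V'' (ix w k1 i) + s ''V'' (ix w k2 i)) mod md i"
      and o: "s1 ''o'' 0 = horner R (\<lambda>i. (s ''V'' (ix w k1 i) + s ''V'' (ix w k2 i)) mod md i) w"
      and y: "s1 ''y'' 0 = (if box p (\<lambda>i. (s ''V'' (ix w k1 i) + s ''V'' (ix w k2 i)) mod md i) then 1 else 0)"
    have eq: "s1 ''T'' = s ''T''" "s1 ''E'' = s ''E''" "s1 ''C'' = s ''C''" "s1 ''a'' = s ''a''" "s1 ''e'' = s ''e''"
      "s1 ''U'' = s0 ''U''" using u1 un by (auto simp: unchanged_def)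
    have gen1: "generated s1 p hi cur (2 * sz)" by (rule generated_V_cong[OF gen]) (use eq V1 in auto)
    have tab1: "table s1 hi cur" by (rule table_V_cong[OF tab]) (use eq V1 in auto)
    have un1: "unchanged touched s0 s1" by (rule unchanged_trans[OF un u1]) auto
    show "wp W accept (\<lambda>u s''. t + u \<le> 120 * w + 110 \<and> s'' ''a'' 0 = int k1 \<and> s'' ''e'' 0 = int k2 \<and>
      round_inv s0 p hi (2 * sz) (insert (k1, k2) dn) s'') s1"
    proof (cases "box p (st X)")
      case True
      have acc: "wp W accept (\<lambda>t s'. t \<le> 70 \<and> unchanged {''T'', ''E'', ''C'', ''s''} s1 s' \<and> (\<exists>cur'\<ge>cur.
        s' ''C'' 0 = int cur' \<and> (\<forall>k<hi. s' ''E'' (int k) = s1 ''E'' (int k)) \<and>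
        (\<forall>k. hi \<le> k \<longrightarrow> k < cur \<longrightarrow> s' ''E'' (int k) \<le> s1 ''E'' (int k)) \<and>
        generated s' p hi cur' (2 * sz) \<and> table s' hi cur' \<and>
        (box p (st X) \<longrightarrow> (\<exists>k. hi \<le> k \<and> k < cur' \<and> (\<forall>i<w. s1 ''V'' (ix w k i) = st X i) \<and> s' ''E'' (int k) \<le> ev X)))) s1"
        by (rule wp_accept[OF gen1 tab1 _ _ _ _ cur(2) k(2,4)])
          (use c cur eq y o bx hor Vc v X sz p hW[OF True] curW old k X1(4) X2(4) in \<open>auto simp: ev_add X_def\<close>)
      show ?thesis
      proof (rule wp_conseq[OF acc], elim conjE exE)
        fix t' :: nat and s2 cur'
        assume t': "t' \<le> 70" and u2: "unchanged {''T'', ''E'', ''C'', ''s''} s1 s2" and cur': "cur \<le> cur'" "s2 ''C'' 0 = int cur'"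
          and E2: "\<forall>k<hi. s2 ''E'' (int k) = s1 ''E'' (int k)" "\<forall>k. hi \<le> k \<longrightarrow> k < cur \<longrightarrow> s2 ''E'' (int k) \<le> s1 ''E'' (int k)"
          and g2: "generated s2 p hi cur' (2 * sz)" and t2: "table s2 hi cur'"
          and new: "box p (st X) \<longrightarrow> (\<exists>k\<ge>hi. k < cur' \<and> (\<forall>i<w. s1 ''V'' (ix w k i) = st X i) \<and> s2 ''E'' (int k) \<le> ev X)"
        have V2: "s2 ''V'' = s1 ''V''" and a2: "s2 ''a'' = s1 ''a''" "s2 ''e'' = s1 ''e''" using u2 by (auto simp: unchanged_def)
        have cov2: "covered s0 s2 p hi cur' (insert (k1, k2) dn)"
          unfolding covered_def
        proof (safe)
          assume "box p (val s0 k1 k2)"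
          then obtain k where "k\<ge>hi" "k < cur'" "\<forall>i<w. s1 ''V'' (ix w k i) = st X i" "s2 ''E'' (int k) \<le> ev X"
            using new bx0 by blast
          then show "\<exists>k\<ge>hi. k < cur' \<and> (\<forall>i<w. s2 ''V'' (ix w k i) = val s0 k1 k2 i) \<and>
            s2 ''E'' (int k) \<le> s0 ''E'' (int k1) + s0 ''E'' (int k2)"
            using v(2) V2 X1(4) X2(4) by (intro exI[of _ k]) (auto simp: X_def ev_add)
        next
          fix l1 l2 assume "(l1, l2) \<in> dn" "box p (val s0 l1 l2)"
          then obtain k where k: "k\<ge>hi" "k < cur" "\<forall>i<w. s ''V'' (ix w k i) = val s0 l1 l2 i"
            "s ''E'' (int k) \<le> s0 ''E'' (int l1) + s0 ''E'' (int l2)"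
            using cov unfolding covered_def by blast
          \<comment> \<open>Stored values only decrease, so pairs treated earlier remain
            covered.\<close>
          moreover have "s2 ''E'' (int k) \<le> s ''E'' (int k)" using E2(2) k eq by auto
          ultimately show "\<exists>k\<ge>hi. k < cur' \<and> (\<forall>i<w. s2 ''V'' (ix w k i) = val s0 l1 l2 i) \<and>
            s2 ''E'' (int k) \<le> s0 ''E'' (int l1) + s0 ''E'' (int l2)"
            using cur'(1) V1 V2 by (intro exI[of _ k]) auto
        qed
        have "unchanged touched s0 s2" by (rule unchanged_trans[OF un1 u2]) auto
        moreover have "s2 ''V'' (ix w k i) = s0 ''V'' (ix w k i)" if "k < hi" "i < w" for k i
          using old(1)[OF that] V1 V2 that cur(2) by simp
        moreover have "s2 ''E'' (int k) = s0 ''E'' (int k)" if "k < hi" for k using old(2)[OF that] E2(1) eq that by simp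
        ultimately have "round_inv s0 p hi (2 * sz) (insert (k1, k2) dn) s2"
          unfolding round_inv_def using cur' cur(2) g2 t2 cov2 by (intro conjI exI[of _ cur']) auto
        then show "t + t' \<le> 120 * w + 110 \<and> s2 ''a'' 0 = int k1 \<and> s2 ''e'' 0 = int k2 \<and>
          round_inv s0 p hi (2 * sz) (insert (k1, k2) dn) s2"
          using t t' a2 eq c by simp
      qed
    next
      case False
      have "covered s0 s1 p hi cur (insert (k1, k2) dn)"
        unfolding covered_def
      proof (safe)
        assume "box p (val s0 k1 k2)"
        with bx0 False show "\<exists>k\<ge>hi. k < cur \<and> (\<forall>i<w. s1 ''V'' (ix w k i) = val s0 k1 k2 i) \<and>
            s1 ''E'' (int k) \<le> s0 ''E'' (int k1) + s0 ''E'' (int k2)" by simp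
      next
        fix l1 l2 assume "(l1, l2) \<in> dn" "box p (val s0 l1 l2)"
        then obtain k where "k\<ge>hi" "k < cur" "\<forall>i<w. s ''V'' (ix w k i) = val s0 l1 l2 i"
          "s ''E'' (int k) \<le> s0 ''E'' (int l1) + s0 ''E'' (int l2)"
          using cov unfolding covered_def by blast
        then show "\<exists>k\<ge>hi. k < cur \<and> (\<forall>i<w. s1 ''V'' (ix w k i) = val s0 l1 l2 i) \<and>
          s1 ''E'' (int k) \<le> s0 ''E'' (int l1) + s0 ''E'' (int l2)"
          using V1 eq by (intro exI[of _ k]) auto
      qed
      then have "round_inv s0 p hi (2 * sz) (insert (k1, k2) dn) s1"
        unfolding round_inv_def using un1 cur gen1 tab1 V1 old eq by (intro conjI exI[of _ cur]) auto
      then show ?thesis using y bx False t c eq unfolding accept_def by (simp add: wp_simps)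
    qed
  qed
qed

lemma wp_all_pairs:
  assumes inv: "round_inv s0 p hi (2 * sz) {} s0" and src: "source s0 lo hi sz" and par: "params s0"
    and c: "s0 ''L'' 0 = int lo" "s0 ''U'' 0 = int hi" "s0 ''N'' 0 = int bh" "s0 ''p'' 0 = p"
    and k: "lo \<le> hi" "lo \<le> bh" "bh \<le> hi" and p: "0 < p"
    and count: "finite (states p)" "card (states p) \<le> Kmax" and hi: "hi \<le> n + 1 + \<rho> * Kmax"
    and sz: "2 * sz \<le> 2 ^ (\<rho> + 1)"
  shows "wp W all_pairs (\<lambda>t s. t \<le> (hi - lo) * ((bh - lo) * (120 * w + 130) + 50) + 50 \<and>
     round_inv s0 p hi (2 * sz) ({lo..<hi} \<times> {lo..<bh}) s) s0"
proof -
  have hW: "int hi \<le> W" "int bh \<le> W" "int lo \<le> W" "0 \<le> W"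
  proof -
    have "hi * 1 \<le> (n + 4 + (\<rho> + 1) * Kmax) * (w + 1)" using hi by (intro mult_mono) auto
    then have "int hi \<le> int ((n + 4 + (\<rho> + 1) * Kmax) * (w + 1))" by (simp only: of_nat_le_iff mult_1_right)
    then show "int hi \<le> W" "int bh \<le> W" "int lo \<le> W" "0 \<le> W" using W(4) k by linarith+
  qed
  have indep: "round_inv s0 p hi (2 * sz) dn (s(x := f))" if "round_inv s0 p hi (2 * sz) dn s" "x = ''a'' \<or> x = ''e''" for dn s x f
  proof -
    from that(1) obtain cur where *: "unchanged touched s0 s" "s ''C'' 0 = int cur" "hi \<le> cur"
      "\<forall>k<hi. (\<forall>i<w. s ''V'' (ix w k i) = s0 ''V'' (ix w k i)) \<and> s ''E'' (int k) = s0 ''E'' (int k)"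
      "generated s p hi cur (2 * sz)" "table s hi cur" "covered s0 s p hi cur dn"
      unfolding round_inv_def by blast
    have "unchanged touched s0 (s(x := f))" using *(1) that(2) by (auto simp: unchanged_def)
    moreover have "generated (s(x := f)) p hi cur (2 * sz)" using *(5) that(2) unfolding generated_def by auto
    moreover have "table (s(x := f)) hi cur" using *(6) that(2) unfolding table_def by auto
    moreover have "covered s0 (s(x := f)) p hi cur dn" using *(7) that(2) unfolding covered_def by auto
    ultimately show ?thesis unfolding round_inv_def using * that(2) by (intro conjI exI[of _ cur]) auto
  qed
  have stat: "s ''U'' 0 = int hi" "s ''N'' 0 = int bh" "s ''L'' 0 = int lo" if "round_inv s0 p hi (2 * sz) dn s" for dn s
    using that c by (auto simp: round_inv_def unchanged_def)
  have inner: "wp W (''e'' ::= Var ''L'' ;; For ''e'' (Var ''N'') (digits ;; accept))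
    (\<lambda>t s'. t \<le> (bh - lo) * (120 * w + 130) + 20 \<and> s' ''a'' 0 = int k1 \<and>
      round_inv s0 p hi (2 * sz) ({lo..<Suc k1} \<times> {lo..<bh}) s') s"
    if k1: "lo \<le> k1" "k1 < hi" and I: "round_inv s0 p hi (2 * sz) ({lo..<k1} \<times> {lo..<bh}) s" and a: "s ''a'' 0 = int k1" for s k1
    apply (simp add: wp_simps stat[OF I] hW)
    apply (rule wp_For[where l = lo and N = bh and c = "120 * w + 110" and
      I = "\<lambda>k2 s'. s' ''a'' 0 = int k1 \<and> round_inv s0 p hi (2 * sz) ({lo..<k1} \<times> {lo..<bh} \<union> {k1} \<times> {lo..<k2}) s'"])
    subgoal by simp
    subgoal using k by simp
    subgoal using indep[OF I, of "''e''"] a by simp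
    subgoal premises prems for k2 s'
    proof -
      have "insert (k1, k2) ({lo..<k1} \<times> {lo..<bh} \<union> {k1} \<times> {lo..<k2}) = {lo..<k1} \<times> {lo..<bh} \<union> {k1} \<times> {lo..<Suc k2}"
        using prems(1) by auto
      moreover have "wp W (digits ;; accept) (\<lambda>t s'. t \<le> 120 * w + 110 \<and> s' ''a'' 0 = int k1 \<and> s' ''e'' 0 = int k2 \<and>
         round_inv s0 p hi (2 * sz) (insert (k1, k2) ({lo..<k1} \<times> {lo..<bh} \<union> {k1} \<times> {lo..<k2})) s') s'"
        by (rule wp_combine[OF _ src par c(2,4)]) (use prems k1 k p count hi sz in auto)
      ultimately show ?thesis by (auto elim!: wp_conseq)
    qed
    subgoal for k2 s' using stat by auto
    subgoal for k2 s' v using indep by auto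
    subgoal using hW by simp
    subgoal premises prems for t s'
    proof -
      have "{lo..<k1} \<times> {lo..<bh} \<union> {k1} \<times> {lo..<bh} = {lo..<Suc k1} \<times> {lo..<bh}" using k1 by auto
      with prems show ?thesis by (auto simp: algebra_simps)
    qed
    done
  show ?thesis unfolding all_pairs_def
    apply (simp add: wp_simps c hW)
    apply (rule wp_For[where l = lo and N = hi and c = "(bh - lo) * (120 * w + 130) + 20" and
      I = "\<lambda>k1 s'. round_inv s0 p hi (2 * sz) ({lo..<k1} \<times> {lo..<bh}) s'"])
    subgoal by simp
    subgoal using k by simp
    subgoal using indep[OF inv, of "''a''"] by simp
    subgoal for k1 s' by (rule inner)
    subgoal for k2 s' using stat by auto
    subgoal for k2 s' v using indep by auto
    subgoal using hW by simp
    subgoal premises prems for t s'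
    proof -
      have *: "6 + (hi - lo) * ((bh - lo) * (120 * w + 130) + 32) \<le> 46 + (hi - lo) * ((bh - lo) * (120 * w + 130) + 50)"
        by (intro add_mono mult_left_mono) auto
      from prems have "t \<le> 6 + (hi - lo) * ((bh - lo) * (120 * w + 130) + 32)" by (simp add: add.commute)
      from order_trans[OF this *] prems(1) show ?thesis by simp
    qed
    done
qed

text \<open>Only multisets of size at most b are guaranteed to be matched, but the multiset behind
  the matching entry may be larger; \<open>generated\<close> limits its size separately, by a power
  of 2.\<close>

definition complete_upto :: "store \<Rightarrow> int \<Rightarrow> real \<Rightarrow> nat \<Rightarrow> nat \<Rightarrow> bool" where
  "complete_upto s p b lo hi \<longleftrightarrow> (\<forall>X. set_mset X \<subseteq> {..<n} \<longrightarrow> real (size X) \<le> b \<longrightarrow> box p (st X) \<longrightarrow>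
    (\<exists>k. lo \<le> k \<and> k < hi \<and> (\<forall>i<w. s ''V'' (ix w k i) = st X i) \<and> s ''E'' (int k) \<le> ev X))"

text \<open>Row 0 is the empty multiset and row \<open>Suc j\<close> the single column j.
  \<open>N\<close> is 1 so that in the first round the second summand is always the empty
  multiset.\<close>

definition start :: "store \<Rightarrow> bool" where
  "start s \<longleftrightarrow> s ''L'' 0 = 0 \<and> s ''U'' 0 = int (n + 1) \<and> s ''N'' 0 = 1 \<and>
    (\<forall>i<w. s ''V'' (ix w 0 i) = 0) \<and> (\<forall>j<n. \<forall>i<w. s ''V'' (ix w (Suc j) i) = a j i) \<and>
    s ''E'' 0 = 0 \<and> (\<forall>j<n. s ''E'' (int (Suc j)) = wt j)"

text \<open>k counts the finished rounds. The segment belongs to the scale of the last finished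
  round, which is twice the current \<open>p\<close> as long as a round remains.
  \<open>k = 0\<close> is separate because the initial columns need not lie in any box.\<close>

definition rounds_inv :: "store \<Rightarrow> nat \<Rightarrow> store \<Rightarrow> bool" where
  "rounds_inv sI k s \<longleftrightarrow> unchanged (touched \<union> {''L'', ''U'', ''N'', ''p''}) sI s \<and>
    s ''p'' 0 = (if k \<le> \<rho> then 2 ^ (\<rho> - k) else 0) \<and>
    (\<exists>lo hi. s ''L'' 0 = int lo \<and> s ''U'' 0 = int hi \<and> s ''C'' 0 = int hi \<and> lo \<le> hi \<and> hi \<le> n + 1 + k * Kmax \<and>
      (\<forall>c. s ''T'' c < int hi) \<and> source s lo hi (2 ^ k) \<and>
      (if k = 0 then start s
       else s ''N'' 0 = int hi \<and> hi - lo \<le> Kmax \<and> generated s (2 ^ (\<rho> + 1 - k)) lo hi (2 ^ k) \<and>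
         complete_upto s (2 ^ (\<rho> + 1 - k)) ((6 / 5) ^ (k - 1)) lo hi))"

lemma rounds_invI:
  assumes "unchanged (touched \<union> {''L'', ''U'', ''N'', ''p''}) sI s" "s ''p'' 0 = (if k \<le> \<rho> then 2 ^ (\<rho> - k) else 0)"
    "s ''L'' 0 = int lo" "s ''U'' 0 = int hi" "s ''C'' 0 = int hi" "lo \<le> hi" "hi \<le> n + 1 + k * Kmax"
    "\<forall>c. s ''T'' c < int hi" "source s lo hi (2 ^ k)"
    "if k = 0 then start s
     else s ''N'' 0 = int hi \<and> hi - lo \<le> Kmax \<and> generated s (2 ^ (\<rho> + 1 - k)) lo hi (2 ^ k) \<and>
       complete_upto s (2 ^ (\<rho> + 1 - k)) ((6 / 5) ^ (k - 1)) lo hi"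
  shows "rounds_inv sI k s"
  unfolding rounds_inv_def using assms by blast

text \<open>Beyond the first round, a multiset wanted at scale p splits into two at scale
  \<open>2 * p\<close>. Each has a representative in the previous segment with the same coordinates
  and no larger value, and the combination of the representatives is as good as the multiset
  itself.\<close>

lemma wp_one_round:
  assumes inv: "rounds_inv sI k s" and k: "k \<le> \<rho>" and par: "params sI"
    and count: "\<And>p. 0 < p \<Longrightarrow> finite (states p) \<and> card (states p) \<le> Kmax"
    and split: "\<And>X k p. set_mset X \<subseteq> {..<n} \<Longrightarrow> real (size X) \<le> (6 / 5) ^ Suc k \<Longrightarrow> 0 < p \<Longrightarrow> box p (st X) \<Longrightarrow>
      \<exists>Y1 Y2. X = Y1 + Y2 \<and> real (size Y1) \<le> (6 / 5) ^ k \<and> real (size Y2) \<le> (6 / 5) ^ k \<and> box (2 * p) (st Y1) \<and> box (2 * p) (st Y2)"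
  shows "wp W one_round (\<lambda>t s'. t \<le> (if k = 0 then (n + 1) * (120 * w + 180) + 80 else Kmax * Kmax * (120 * w + 260)) \<and>
    rounds_inv sI (Suc k) s') s"
proof -
  define p :: int where "p = 2 ^ (\<rho> - k)"
  have p: "0 < p" by (simp add: p_def)
  from inv obtain lo hi where un: "unchanged (touched \<union> {''L'', ''U'', ''N'', ''p''}) sI s" and sp: "s ''p'' 0 = p"
    and c: "s ''L'' 0 = int lo" "s ''U'' 0 = int hi" "s ''C'' 0 = int hi" "lo \<le> hi" "hi \<le> n + 1 + k * Kmax"
    and T: "\<And>c. s ''T'' c < int hi" and src: "source s lo hi (2 ^ k)"
    and cases: "if k = 0 then start s
       else s ''N'' 0 = int hi \<and> hi - lo \<le> Kmax \<and> generated s (2 ^ (\<rho> + 1 - k)) lo hi (2 ^ k) \<and>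
         complete_upto s (2 ^ (\<rho> + 1 - k)) ((6 / 5) ^ (k - 1)) lo hi"
    using k unfolding rounds_inv_def p_def by auto
  have par': "params s" using par un by (auto simp: params_def unchanged_def)
  \<comment> \<open>In the first round the only second summand is the empty multiset, so this round
    merely filters the columns by the box, in time linear in n.\<close>
  define bh where "bh = (if k = 0 then 1 else hi)"
  have lohi: "k = 0 \<Longrightarrow> lo = 0 \<and> hi = n + 1" using cases c by (auto simp: start_def)
  have bh: "s ''N'' 0 = int bh" "lo \<le> bh" "bh \<le> hi" using cases c lohi by (auto simp: bh_def start_def split: if_splits)
  have hi: "hi \<le> n + 1 + \<rho> * Kmax" using c(5) k mult_right_mono[of k \<rho> Kmax] by linarith
  have sz: "2 * 2 ^ k \<le> (2::nat) ^ (\<rho> + 1)" using k by simp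
  have inv0: "round_inv s p hi (2 * 2 ^ k) {} s"
    unfolding round_inv_def using c T by (intro conjI exI[of _ hi]) (auto simp: unchanged_refl generated_def table_def covered_def)
  have pairs: "wp W all_pairs (\<lambda>t s'. t \<le> (hi - lo) * ((bh - lo) * (120 * w + 130) + 50) + 50 \<and>
     round_inv s p hi (2 * 2 ^ k) ({lo..<hi} \<times> {lo..<bh}) s') s"
    by (rule wp_all_pairs[OF inv0 src par' c(1,2) bh(1) sp c(4) bh(2,3) p _ _ hi sz]) (use count[OF p] in auto)
  have time: "(hi - lo) * ((bh - lo) * (120 * w + 130) + 50) + 80 \<le>
      (if k = 0 then (n + 1) * (120 * w + 180) + 80 else Kmax * Kmax * (120 * w + 260))"
  proof (cases "k = 0")
    case False
    then have d: "hi - lo \<le> Kmax" "bh = hi" using cases by (auto simp: bh_def)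
    have "(hi - lo) * ((bh - lo) * (120 * w + 130) + 50) + 80 \<le> Kmax * (Kmax * (120 * w + 130) + 50) + 80"
      using d by (intro add_mono mult_mono) auto
    also have "\<dots> \<le> Kmax * (Kmax * (120 * w + 130) + Kmax * 50) + Kmax * Kmax * 80"
      using K1 mult_mono[of 1 Kmax 1 Kmax] by (intro add_mono mult_left_mono) auto
    also have "\<dots> = Kmax * Kmax * (120 * w + 260)" by (simp add: algebra_simps)
    finally show ?thesis using False by simp
  qed (use lohi in \<open>simp add: bh_def\<close>)
  show ?thesis unfolding one_round_def
  proof (rule wp_SeqI[OF pairs], elim conjE)
    fix t :: nat and s1 assume t: "t \<le> (hi - lo) * ((bh - lo) * (120 * w + 130) + 50) + 50"
      and I1: "round_inv s p hi (2 * 2 ^ k) ({lo..<hi} \<times> {lo..<bh}) s1"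
    from I1 obtain cur where u1: "unchanged touched s s1" and cur: "s1 ''C'' 0 = int cur" "hi \<le> cur"
      and gen: "generated s1 p hi cur (2 * 2 ^ k)" and tab: "table s1 hi cur"
      and cov: "covered s s1 p hi cur ({lo..<hi} \<times> {lo..<bh})" unfolding round_inv_def by blast
    have eq: "s1 ''L'' = s ''L''" "s1 ''U'' = s ''U''" "s1 ''N'' = s ''N''" "s1 ''p'' = s ''p''"
      using u1 by (auto simp: unchanged_def)
    have dK: "cur - hi \<le> Kmax" using generated_card[OF gen p] count[OF p] unfolding states_def by blast
    let ?s2 = "s1(''L'' := (s1 ''L'')(0 := int hi), ''U'' := (s1 ''U'')(0 := int cur), ''N'' := (s1 ''N'')(0 := int cur), ''p'' := (s1 ''p'')(0 := p div 2))"
    have pk: "p = 2 ^ (\<rho> + 1 - Suc k)" by (simp add: p_def)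
    have gen2: "generated ?s2 (2 ^ (\<rho> + 1 - Suc k)) hi cur (2 ^ Suc k)" using gen unfolding pk[symmetric] generated_def by simp
    have src2: "source ?s2 hi cur (2 ^ Suc k)" unfolding source_def
    proof (intro allI impI)
      fix l assume l: "hi \<le> l" "l < cur"
      then obtain X where X: "set_mset X \<subseteq> {..<n}" "size X \<le> 2 ^ Suc k" "\<forall>i<w. s1 ''V'' (ix w l i) = st X i" "box p (st X)"
        "s1 ''E'' (int l) = ev X" using gen unfolding generated_def by auto
      have "\<bar>st X i\<bar> \<le> r" "st X i mod md i = st X i" if "i < w" for i
        using reduced_bound[OF X(4) p that] by (simp_all add: st_def)
      then show "\<exists>X. set_mset X \<subseteq> {..<n} \<and> size X \<le> 2 ^ Suc k \<and>
         (\<forall>i<w. ?s2 ''V'' (ix w l i) mod md i = st X i \<and> \<bar>?s2 ''V'' (ix w l i)\<bar> \<le> \<beta> \<and> (md i = 0 \<longrightarrow> \<bar>?s2 ''V'' (ix w l i)\<bar> \<le> r)) \<and>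
         ?s2 ''E'' (int l) = ev X"
        using X R(3) by (intro exI[of _ X]) (auto intro: order_trans)
    qed
    have compl: "complete_upto ?s2 (2 ^ (\<rho> + 1 - Suc k)) ((6 / 5) ^ (Suc k - 1)) hi cur"
      unfolding complete_upto_def pk[symmetric]
    proof (intro allI impI)
      fix X assume X: "set_mset X \<subseteq> {..<n}" "real (size X) \<le> (6 / 5) ^ (Suc k - 1)" "box p (st X)"
      have "\<exists>k1 k2. k1 \<in> {lo..<hi} \<and> k2 \<in> {lo..<bh} \<and> (\<forall>i<w. val s k1 k2 i = st X i) \<and> s ''E'' (int k1) + s ''E'' (int k2) \<le> ev X"
      proof (cases "k = 0")
        case True
        then have st: "start s" using cases by simp
        \<comment> \<open>\<open>(6 / 5) ^ 0 = 1\<close>: only the empty multiset and single columns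
          are required, and both are among the initial rows.\<close>
        have "size X \<le> 1" using X(2) True by simp
        show ?thesis
        proof (cases "X = {#}")
          case True
          then show ?thesis using lohi \<open>k = 0\<close> st
            by (intro exI[of _ 0]) (auto simp: bh_def val_def start_def st_def ev_def)
        next
          case False
          then have "size X = 1" using \<open>size X \<le> 1\<close> by (simp add: le_Suc_eq)
          then obtain j where j: "X = {#j#}" using size_1_singleton_mset by blast
          then show ?thesis using X(1) lohi \<open>k = 0\<close> st
            by (intro exI[of _ "Suc j"] exI[of _ 0]) (auto simp: bh_def val_def start_def st_def ev_def)
        qed
      next
        case False
        then obtain k' where k': "k = Suc k'" using not0_implies_Suc by blast
        from split[OF X(1) _ p X(3), of k'] X(2) k' obtain Y1 Y2 where Y: "X = Y1 + Y2"
          "real (size Y1) \<le> (6 / 5) ^ (k - 1)" "real (size Y2) \<le> (6 / 5) ^ (k - 1)" "box (2 * p) (st Y1)" "box (2 * p) (st Y2)" by auto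
        have p2: "2 * p = 2 ^ (\<rho> + 1 - k)" using k by (simp add: p_def Suc_diff_le)
        have cu: "complete_upto s (2 * p) ((6 / 5) ^ (k - 1)) lo hi" using cases False p2 by simp
        obtain k1 where k1: "lo \<le> k1" "k1 < hi" "\<forall>i<w. s ''V'' (ix w k1 i) = st Y1 i" "s ''E'' (int k1) \<le> ev Y1"
          using cu X(1) Y(1,2,4) unfolding complete_upto_def by (metis set_mset_union le_sup_iff)
        obtain k2 where k2: "lo \<le> k2" "k2 < hi" "\<forall>i<w. s ''V'' (ix w k2 i) = st Y2 i" "s ''E'' (int k2) \<le> ev Y2"
          using cu X(1) Y(1,3,5) unfolding complete_upto_def by (metis set_mset_union le_sup_iff)
        show ?thesis using k1 k2 False Y(1)
          by (intro exI[of _ k1] exI[of _ k2]) (auto simp: bh_def val_def st_add ev_add)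
      qed
      then obtain k1 k2 where kk: "k1 \<in> {lo..<hi}" "k2 \<in> {lo..<bh}" "\<forall>i<w. val s k1 k2 i = st X i"
        "s ''E'' (int k1) + s ''E'' (int k2) \<le> ev X" by blast
      have "box p (val s k1 k2)" using X(3) kk(3) box_cong[of "val s k1 k2" "st X" p] by simp
      then obtain l where "hi \<le> l" "l < cur" "\<forall>i<w. s1 ''V'' (ix w l i) = val s k1 k2 i"
        "s1 ''E'' (int l) \<le> s ''E'' (int k1) + s ''E'' (int k2)"
        using cov kk(1,2) unfolding covered_def by blast
      then show "\<exists>k\<ge>hi. k < cur \<and> (\<forall>i<w. ?s2 ''V'' (ix w k i) = st X i) \<and> ?s2 ''E'' (int k) \<le> ev X"
        using kk(3,4) by (intro exI[of _ l]) auto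
    qed
    have T2: "?s2 ''T'' c < int cur" for c
      using tab[unfolded table_def, rule_format, of c] cur(2) by auto
    have p2: "p div 2 = (if Suc k \<le> \<rho> then 2 ^ (\<rho> - Suc k) else 0)"
    proof (cases "Suc k \<le> \<rho>")
      case True
      then have "\<rho> - k = Suc (\<rho> - Suc k)" by simp
      then show ?thesis using True by (simp add: p_def)
    next
      case False
      then have "p = 1" using k by (simp add: p_def)
      then show ?thesis using False by simp
    qed
    have "rounds_inv sI (Suc k) ?s2"
    proof (rule rounds_invI[of _ _ _ hi cur])
      show "unchanged (touched \<union> {''L'', ''U'', ''N'', ''p''}) sI ?s2" using un u1 by (simp add: unchanged_def)
      show "cur \<le> n + 1 + Suc k * Kmax" using dK c(5) cur(2) by simp
      show "if Suc k = 0 then start ?s2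
        else ?s2 ''N'' 0 = int cur \<and> cur - hi \<le> Kmax \<and> generated ?s2 (2 ^ (\<rho> + 1 - Suc k)) hi cur (2 ^ Suc k) \<and>
         complete_upto ?s2 (2 ^ (\<rho> + 1 - Suc k)) ((6 / 5) ^ (Suc k - 1)) hi cur"
        using gen2 compl dK by simp
    qed (use p2 cur src2 T2 in auto)
    moreover have "\<bar>int hi\<bar> \<le> W" "\<bar>int cur\<bar> \<le> W" "\<bar>p div 2\<bar> \<le> W" "0 \<le> W"
    proof -
      have "cur * 1 \<le> (n + 4 + (\<rho> + 1) * Kmax) * (w + 1)" using hi dK cur(2) by (intro mult_mono) auto
      then have "int cur \<le> int ((n + 4 + (\<rho> + 1) * Kmax) * (w + 1))" by (simp only: of_nat_le_iff mult_1_right)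
      then show "\<bar>int hi\<bar> \<le> W" "\<bar>int cur\<bar> \<le> W" "0 \<le> W" using W(4) cur by linarith+
      have "p \<le> 2 ^ (\<rho> + 2)" unfolding p_def by (intro power_increasing) auto
      also have "\<dots> * 1 \<le> 2 ^ (\<rho> + 2) * (Emax + 1)" using wt(2) by (intro mult_left_mono) auto
      finally have "p \<le> W" using W(3) by simp
      then show "\<bar>p div 2\<bar> \<le> W" using p by auto
    qed
    moreover have "t + 30 \<le> (if k = 0 then (n + 1) * (120 * w + 180) + 80 else Kmax * Kmax * (120 * w + 260))"
      using t time by linarith
    ultimately show "wp W (''L'' ::= Var ''U'' ;; ''U'' ::= Var ''C'' ;; ''N'' ::= Var ''C'' ;; ''p'' ::= Div (Var ''p'') (Const 2))
      (\<lambda>u s''. t + u \<le> (if k = 0 then (n + 1) * (120 * w + 180) + 80 else Kmax * Kmax * (120 * w + 260)) \<and> rounds_inv sI (Suc k) s'') s1"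
      by (simp add: wp_simps eq c cur sp split del: if_split)
  qed
qed

lemma wp_rounds:
  assumes sI: "start sI" "params sI" "sI ''C'' 0 = int (n + 1)" "sI ''p'' 0 = 2 ^ \<rho>" "\<And>c. sI ''T'' c = 0"
    and count: "\<And>p. 0 < p \<Longrightarrow> finite (states p) \<and> card (states p) \<le> Kmax"
    and split: "\<And>X k p. set_mset X \<subseteq> {..<n} \<Longrightarrow> real (size X) \<le> (6 / 5) ^ Suc k \<Longrightarrow> 0 < p \<Longrightarrow> box p (st X) \<Longrightarrow>
      \<exists>Y1 Y2. X = Y1 + Y2 \<and> real (size Y1) \<le> (6 / 5) ^ k \<and> real (size Y2) \<le> (6 / 5) ^ k \<and> box (2 * p) (st Y1) \<and> box (2 * p) (st Y2)"
  shows "wp W rounds (\<lambda>t s. t \<le> (n + 1) * (120 * w + 270) + \<rho> * (Kmax * Kmax * (120 * w + 270)) \<and>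
    unchanged (touched \<union> {''L'', ''U'', ''N'', ''p''}) sI s \<and>
    (\<exists>lo hi. generated s 1 lo hi (2 ^ (\<rho> + 1)) \<and> complete_upto s 1 ((6 / 5) ^ \<rho>) lo hi)) sI"
proof -
  let ?c = "\<lambda>k. if k = 0 then (n + 1) * (120 * w + 180) + 80 else Kmax * Kmax * (120 * w + 260)"
  have src: "source sI 0 (n + 1) (2 ^ 0)" unfolding source_def
  proof (intro allI impI)
    fix k assume "k < n + 1"
    show "\<exists>X. set_mset X \<subseteq> {..<n} \<and> size X \<le> 2 ^ 0 \<and>
         (\<forall>i<w. sI ''V'' (ix w k i) mod md i = st X i \<and> \<bar>sI ''V'' (ix w k i)\<bar> \<le> \<beta> \<and> (md i = 0 \<longrightarrow> \<bar>sI ''V'' (ix w k i)\<bar> \<le> r)) \<and>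
         sI ''E'' (int k) = ev X"
    proof (cases k)
      case 0
      then show ?thesis using sI(1) R by (intro exI[of _ "{#}"]) (auto simp: start_def st_def ev_def)
    next
      case (Suc j)
      then have "j < n" using \<open>k < n + 1\<close> by simp
      then show ?thesis using sI(1) col Suc
        by (intro exI[of _ "{#j#}"]) (auto simp: start_def st_def ev_def simp del: of_nat_Suc)
    qed
  qed
  have init: "rounds_inv sI 0 sI"
  proof (rule rounds_invI[of _ _ _ 0 "n + 1"])
    show "source sI 0 (n + 1) (2 ^ 0)" by (rule src)
  qed (use sI in \<open>auto simp: unchanged_refl start_def\<close>)
  show ?thesis unfolding rounds_def
  proof (rule wp_WhilePos[where N = "Suc \<rho>" and c = ?c and I = "rounds_inv sI"])
    show "rounds_inv sI 0 sI" by (rule init)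
  next
    fix k s assume k: "k < Suc \<rho>" "rounds_inv sI k s"
    show "0 < aval (Var ''p'') s \<and> wp W one_round (\<lambda>t s'. t \<le> ?c k \<and> rounds_inv sI (Suc k) s') s"
    proof
      show "0 < aval (Var ''p'') s" using k by (simp add: rounds_inv_def)
      show "wp W one_round (\<lambda>t s'. t \<le> ?c k \<and> rounds_inv sI (Suc k) s') s"
        by (rule wp_one_round[OF k(2) _ sI(2) count split]) (use k in auto)
    qed
  next
    fix s assume "rounds_inv sI (Suc \<rho>) s"
    then show "\<not> 0 < aval (Var ''p'') s" by (simp add: rounds_inv_def)
  next
    fix t s assume I: "rounds_inv sI (Suc \<rho>) s" and t: "t \<le> (\<Sum>k<Suc \<rho>. 1 + acost (Var ''p'') + ?c k) + (1 + acost (Var ''p''))"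
    \<comment> \<open>The 86 consists of the 80 of the first round and 3 each for its guard and for
      the guard that ends the loop.\<close>
    have "(\<Sum>k<Suc \<rho>. 1 + acost (Var ''p'') + ?c k) + (1 + acost (Var ''p'')) =
      (n + 1) * (120 * w + 180) + 86 + \<rho> * (Kmax * Kmax * (120 * w + 260) + 3)"
      by (subst sum.lessThan_Suc_shift) (simp add: algebra_simps)
    also have "\<dots> \<le> (n + 1) * (120 * w + 270) + \<rho> * (Kmax * Kmax * (120 * w + 270))"
    proof (rule add_mono)
      have "1 * 1 \<le> Kmax * Kmax" using K1 by (intro mult_mono) auto
      then have "3 \<le> Kmax * Kmax * 10" by linarith
      then have "Kmax * Kmax * (120 * w + 260) + 3 \<le> Kmax * Kmax * (120 * w + 260) + Kmax * Kmax * 10" by linarith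
      then show "\<rho> * (Kmax * Kmax * (120 * w + 260) + 3) \<le> \<rho> * (Kmax * Kmax * (120 * w + 270))"
        by (intro mult_left_mono) (simp_all add: algebra_simps)
    qed (simp add: algebra_simps)
    finally have "t \<le> (n + 1) * (120 * w + 270) + \<rho> * (Kmax * Kmax * (120 * w + 270))" using t by simp
    with I show "t \<le> (n + 1) * (120 * w + 270) + \<rho> * (Kmax * Kmax * (120 * w + 270)) \<and>
      unchanged (touched \<union> {''L'', ''U'', ''N'', ''p''}) sI s \<and>
      (\<exists>lo hi. generated s 1 lo hi (2 ^ (\<rho> + 1)) \<and> complete_upto s 1 ((6 / 5) ^ \<rho>) lo hi)"
      unfolding rounds_inv_def by auto
  qed
qed

end

section \<open>Setting up and decoding\<close>

text \<open>\<Delta> is not part of the input; the largest absolute value in the eliminated table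
  takes its place. The factor \<open>2 * eta\<close> turns it into the half-width of the
  box.\<close>

definition find_max :: com where
  "find_max = ''h'' ::= Const 0 ;; ''k'' ::= Const 0 ;;
     For ''k'' (Mul (Var ''m'') (Var ''n'')) (
       IfPos (Sub (Load ''A'' (Var ''k'')) (Var ''h'')) (''h'' ::= Load ''A'' (Var ''k'')) Skip ;;
       IfPos (Sub (Sub (Const 0) (Load ''A'' (Var ''k''))) (Var ''h'')) (''h'' ::= Sub (Const 0) (Load ''A'' (Var ''k''))) Skip) ;;
     ''h'' ::= Mul (Mul (Const 2) (Var ''eta'')) (Var ''h'')"

abbreviation "Smith x \<equiv> Load ''S'' (Add (Mul (Var x) (Var ''z'')) (Var x))"

text \<open>For integers, \<open>x * (2 - x)\<close> is positive only if x is 1. If all divisors are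
  1, the scan stops at the address of the diagonal entry z, which lies beyond the array and holds
  0.\<close>

definition find_nontrivial :: com where
  "find_nontrivial = ''z'' ::= Sub (Var ''n'') (Var ''m'') ;; ''q'' ::= Const 0 ;;
     WhilePos (Mul (Smith ''q'') (Sub (Const 2) (Smith ''q''))) (''q'' ::= Add (Var ''q'') (Const 1)) ;;
     ''w'' ::= Sub (Var ''n'') (Var ''q'')"

text \<open>The rows of G that matter are the last ones and hence consecutive in memory, so one
  block copy puts them below the eliminated rows.\<close>

definition copy_rows :: com where
  "copy_rows = ''k'' ::= Const 0 ;;
     For ''k'' (Mul (Sub (Var ''w'') (Var ''m'')) (Var ''n''))
       (Store ''A'' (Add (Mul (Var ''m'') (Var ''n'')) (Var ''k'')) (Load ''G'' (Add (Mul (Var ''q'') (Var ''n'')) (Var ''k''))))"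

text \<open>In the radix, \<open>t * t\<close> stands in for the absolute value of t, which it
  dominates, and the factor 4 leaves room for differences of digits. For a residue, \<open>D\<close>
  is the modulus itself, which makes the box test vacuous.\<close>

definition coordinates :: com where
  "coordinates = ''R'' ::= Const 1 ;; ''i'' ::= Const 0 ;;
     For ''i'' (Var ''w'') (
       IfPos (Sub (Var ''m'') (Var ''i''))
         (Store ''t'' (Var ''i'') (Load ''b'' (Var ''i'')) ;; Store ''D'' (Var ''i'') (Var ''h''))
         (''r'' ::= Add (Sub (Var ''i'') (Var ''m'')) (Var ''q'') ;;
          Store ''M'' (Var ''i'') (Smith ''r'') ;;
          Store ''t'' (Var ''i'') (Sub (Load ''g'' (Var ''r'')) (Mul (Load ''M'' (Var ''i'')) (Div (Load ''g'' (Var ''r'')) (Load ''M'' (Var ''i''))))) ;;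
          Store ''D'' (Var ''i'') (Load ''M'' (Var ''i''))) ;;
       ''R'' ::= Add (Var ''R'') (Mul (Const 4) (Add (Mul (Load ''t'' (Var ''i'')) (Load ''t'' (Var ''i''))) (Load ''D'' (Var ''i'')))) ;;
       ''j'' ::= Const 0 ;;
       For ''j'' (Var ''n'') (Store ''V'' (Add (Mul (Add (Var ''j'') (Const 1)) (Var ''w'')) (Var ''i'')) (At ''i'' ''j'')))"

text \<open>\<open>Q = 2 * p + 1\<close> exceeds \<open>2 ^ (rho + 1)\<close>, the largest size of a
  multiset that can occur; p is kept as the scale of the first round. The costs need a second pass
  because \<open>Q ^ n\<close> is available only after the first.\<close>

definition weights :: com where
  "weights = ''p'' ::= Const 1 ;; ''k'' ::= Const 0 ;; For ''k'' (Var ''rho'') (''p'' ::= Add (Var ''p'') (Var ''p'')) ;;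
     ''Q'' ::= Add (Add (Var ''p'') (Var ''p'')) (Const 1) ;;
     ''f'' ::= Const 1 ;; ''j'' ::= Const 0 ;;
     For ''j'' (Var ''n'') (Store ''E'' (Add (Var ''j'') (Const 1)) (Var ''f'') ;; ''f'' ::= Mul (Var ''f'') (Var ''Q'')) ;;
     ''j'' ::= Const 0 ;;
     For ''j'' (Var ''n'') (Store ''E'' (Add (Var ''j'') (Const 1))
       (Add (Load ''E'' (Add (Var ''j'') (Const 1))) (Mul (Load ''c'' (Var ''j'')) (Var ''f''))))"

definition start_rounds :: com where
  "start_rounds = ''L'' ::= Const 0 ;; ''U'' ::= Add (Var ''n'') (Const 1) ;; ''N'' ::= Const 1 ;; ''C'' ::= Var ''U''"

definition decode :: com where
  "decode = ''o'' ::= Const 0 ;; ''i'' ::= Const 0 ;;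
     For ''i'' (Var ''w'') (''o'' ::= Add (Mul (Var ''o'') (Var ''R'')) (Load ''t'' (Var ''i''))) ;;
     ''f'' ::= Load ''E'' (Load ''T'' (Var ''o'')) ;; ''j'' ::= Const 0 ;;
     For ''j'' (Var ''n'') (
       Store ''x'' (Var ''j'') (Sub (Var ''f'') (Mul (Var ''Q'') (Div (Var ''f'') (Var ''Q'')))) ;;
       ''f'' ::= Div (Var ''f'') (Var ''Q''))"

section \<open>Effect and cost of setup and decoding\<close>

lemma wp_find_max:
  assumes s: "s ''m'' 0 = int m" "s ''n'' 0 = int n"
    and b: "\<And>k. k < m * n \<Longrightarrow> \<bar>s ''A'' (int k)\<bar> \<le> Y" and Y: "0 \<le> Y" "Y \<le> W" "\<bar>2 * s ''eta'' 0\<bar> * Y \<le> W" and W: "int (m * n) \<le> W"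
  shows "wp W find_max (\<lambda>t s'. t \<le> 60 * (m * n) + 40 \<and> unchanged {''h'', ''k''} s s' \<and>
    (\<exists>H. 0 \<le> H \<and> s' ''h'' 0 = 2 * s ''eta'' 0 * H \<and> (\<forall>k<m * n. \<bar>s ''A'' (int k)\<bar> \<le> H) \<and> (H = 0 \<or> (\<exists>k<m * n. H = \<bar>s ''A'' (int k)\<bar>)))) s"
proof -
  define good where "good k H \<longleftrightarrow> 0 \<le> H \<and> (\<forall>k'<k. \<bar>s ''A'' (int k')\<bar> \<le> H) \<and> (H = 0 \<or> (\<exists>k'<k. H = \<bar>s ''A'' (int k')\<bar>))" for k :: nat and H
  define I where "I k s' \<longleftrightarrow> unchanged {''h'', ''k''} s s' \<and> good k (s' ''h'' 0)" for k s'
  have step: "good (Suc k) (max H \<bar>s ''A'' (int k)\<bar>)" if "good k H" for k H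
    using that unfolding good_def by (auto simp: less_Suc_eq max_def)
  have W0: "0 \<le> W" using W by linarith
  have Wmn: "int m * int n \<le> W" using W by simp
  show ?thesis unfolding find_max_def
    apply (simp add: wp_simps s W0 del: of_nat_mult)
    apply (rule wp_For[where l = 0 and N = "m * n" and c = 40 and I = I])
    subgoal by simp
    subgoal by simp
    subgoal by (simp add: I_def unchanged_def good_def)
    subgoal premises prems for k s'
    proof -
      have eq: "s' ''A'' = s ''A''" using prems by (simp add: I_def unchanged_def)
      have g: "good k (s' ''h'' 0)" using prems by (simp add: I_def)
      have "0 \<le> s' ''h'' 0" using g by (simp add: good_def)
      have un: "unchanged {''h'', ''k''} s (s'(''h'' := f))" for f using prems by (simp add: I_def unchanged_def)
      have un': "unchanged {''h'', ''k''} s s'" using prems by (simp add: I_def)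
      have st: "max (s' ''h'' 0) \<bar>s ''A'' (int k)\<bar> = x \<Longrightarrow> good (Suc k) x" for x using step[OF g] by simp
      show ?thesis using b[OF prems(2)] Y(2) prems(4) W0 \<open>0 \<le> s' ''h'' 0\<close> unfolding I_def
        by (auto simp: wp_simps eq un un' intro!: st)
    qed
    subgoal for k s' using s by (simp add: I_def unchanged_def)
    subgoal for k s' v by (auto simp: I_def unchanged_def)
    subgoal using W .
    subgoal premises prems for t s'
    proof -
      have g: "good (m * n) (s' ''h'' 0)" and un: "unchanged {''h'', ''k''} s s'" using prems by (auto simp: I_def)
      have eta: "s' ''eta'' = s ''eta''" using un by (simp add: unchanged_def)
      have "\<bar>s' ''h'' 0\<bar> \<le> Y" using g b Y(1) unfolding good_def by auto
      then have "\<bar>2 * s ''eta'' 0 * s' ''h'' 0\<bar> \<le> \<bar>2 * s ''eta'' 0\<bar> * Y" unfolding abs_mult by (intro mult_left_mono) auto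
      then have "\<bar>2 * s ''eta'' 0 * s' ''h'' 0\<bar> \<le> W" using Y(3) by linarith
      then show ?thesis using prems(3) g un W0
        by (auto simp: wp_simps eta unchanged_def good_def algebra_simps intro!: exI[of _ "s' ''h'' 0"])
    qed
    done
qed

lemma wp_find_nontrivial:
  assumes s: "s ''m'' 0 = int m" "s ''n'' 0 = int n" "m \<le> n"
    and S: "\<And>i. i < n - m \<Longrightarrow> 0 < s ''S'' (ix (n - m) i i)" "s ''S'' (ix (n - m) (n - m) (n - m)) = 0"
    and W: "int n \<le> W"
  shows "wp W find_nontrivial (\<lambda>t s'. t \<le> 40 * n + 60 \<and> unchanged {''z'', ''q'', ''w''} s s' \<and> s' ''z'' 0 = int (n - m) \<and>
    (\<exists>q\<le>n - m. s' ''q'' 0 = int q \<and> s' ''w'' 0 = int (n - q) \<and> (\<forall>i<q. s ''S'' (ix (n - m) i i) = 1) \<and>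
      (q < n - m \<longrightarrow> 1 < s ''S'' (ix (n - m) q q)))) s"
proof -
  let ?z = "n - m"
  define P where "P q \<longleftrightarrow> q = ?z \<or> q < ?z \<and> 1 < s ''S'' (ix ?z q q)" for q
  define N where "N = (LEAST q. P q)"
  have "P ?z" by (simp add: P_def)
  then have PN: "P N" unfolding N_def by (rule LeastI)
  have Nz: "N \<le> ?z" unfolding N_def by (rule Least_le) fact
  have one: "s ''S'' (ix ?z i i) = 1" if "i < N" for i
  proof -
    have "\<not> P i" using that unfolding N_def by (rule not_less_Least)
    then show ?thesis using that S(1)[of i] Nz by (simp add: P_def)
  qed
  have z: "int n - int m = int ?z" using s(3) by simp
  have W0: "0 \<le> W" using W by linarith
  show ?thesis unfolding find_nontrivial_def
    apply (simp add: wp_simps s(1,2) z W0 del: of_nat_diff)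
    apply (intro conjI)
    subgoal using W by simp
    apply (rule wp_WhilePos[where N = N and c = "\<lambda>_. 6" and
      I = "\<lambda>q s'. unchanged {''z'', ''q''} s s' \<and> s' ''z'' 0 = int ?z \<and> s' ''q'' 0 = int q"])
    subgoal by (simp add: unchanged_def)
    subgoal premises prems for q s'
    proof -
      have eq: "s' ''S'' = s ''S''" using prems by (simp add: unchanged_def)
      have "int q + 1 \<le> W" using prems(1) Nz W by linarith
      then show ?thesis using prems one[OF prems(1)]
        by (simp add: wp_simps eq W0 flip: ix_def del: of_nat_diff) (simp add: unchanged_def)
    qed
    subgoal premises prems for s'
    proof -
      have eq: "s' ''S'' = s ''S''" using prems by (simp add: unchanged_def)
      have "s ''S'' (ix ?z N N) = 0 \<or> 1 < s ''S'' (ix ?z N N)" using PN S(2) by (auto simp: P_def)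
      then have "\<not> 0 < s ''S'' (ix ?z N N) * (2 - s ''S'' (ix ?z N N))" by (auto simp: zero_less_mult_iff)
      then show ?thesis using prems by (simp add: eq flip: ix_def del: of_nat_diff)
    qed
    subgoal premises prems for t s'
    proof -
      have c: "s' ''n'' 0 = int n" "s' ''q'' 0 = int N" "s' ''z'' 0 = int ?z" using prems s by (auto simp: unchanged_def)
      have "int n - int N = int (n - N)" using Nz by simp
      moreover have "unchanged {''z'', ''q'', ''w''} s (s'(''w'' := f))" for f using prems by (simp add: unchanged_def)
      moreover have "int (n - N) \<le> W" using W by simp
      moreover have "t \<le> 30 * n + 30" using prems(2) Nz by simp
      ultimately show ?thesis using W0 Nz one PN by (auto simp: wp_simps c P_def simp del: of_nat_diff intro!: exI[of _ N])
    qed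
    done
qed

lemma wp_copy_rows:
  assumes s: "s ''m'' 0 = int m" "s ''n'' 0 = int n" "s ''w'' 0 = int w" "s ''q'' 0 = int q" "m \<le> w"
    and W: "\<And>k. k < (w - m) * n \<Longrightarrow> \<bar>s ''G'' (int (q * n + k))\<bar> \<le> W" "int (w * n) \<le> W"
  shows "wp W copy_rows (\<lambda>t s'. t \<le> 40 * (w * n) + 40 \<and> unchanged {''k'', ''A''} s s' \<and>
    (\<forall>k<m * n. s' ''A'' (int k) = s ''A'' (int k)) \<and>
    (\<forall>k<(w - m) * n. s' ''A'' (int (m * n + k)) = s ''G'' (int (q * n + k)))) s"
proof -
  define I where "I k s' \<longleftrightarrow> unchanged {''k'', ''A''} s s' \<and> (\<forall>l<m * n. s' ''A'' (int l) = s ''A'' (int l)) \<and>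
    (\<forall>l<k. s' ''A'' (int (m * n + l)) = s ''G'' (int (q * n + l)))" for k s'
  have W0: "0 \<le> W" using W(2) by linarith
  have mnw: "m * n + (w - m) * n = w * n" using s(5) by (simp flip: add_mult_distrib)
  have e: "(int w - int m) * int n = int ((w - m) * n)" using s(5) by simp
  show ?thesis unfolding copy_rows_def
    apply (simp add: wp_simps W0 del: of_nat_mult of_nat_add)
    apply (rule wp_For[where l = 0 and N = "(w - m) * n" and c = 20 and I = I])
    subgoal by simp
    subgoal by simp
    subgoal by (simp add: I_def unchanged_def)
    subgoal premises prems for k s'
    proof -
      have eq: "s' ''G'' = s ''G''" "s' ''m'' 0 = int m" "s' ''n'' 0 = int n" "s' ''q'' 0 = int q"
        using prems s by (auto simp: I_def unchanged_def)
      have i: "int m * int n + int k = int (m * n + k)" "int q * int n + int k = int (q * n + k)" by simp_all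
      have "I (Suc k) (s'(''A'' := (s' ''A'')(int (m * n + k) := s ''G'' (int (q * n + k)))))"
        using prems(3) by (auto simp: I_def unchanged_def less_Suc_eq simp del: of_nat_add of_nat_mult)
      moreover have "m * n + k \<le> w * n" using prems(2) mnw by simp
      then have "\<bar>int (m * n + k)\<bar> \<le> W" using W(2) by linarith
      ultimately show ?thesis using W(1)[OF prems(2)] prems(4)
        by (simp add: wp_simps eq i del: of_nat_add of_nat_mult)
    qed
    subgoal for k s' using s e by (simp add: I_def unchanged_def)
    subgoal for k s' v by (auto simp: I_def unchanged_def)
    subgoal
    proof -
      have "(w - m) * n \<le> w * n" using mnw by simp
      then show ?thesis using W(2) by linarith
    qed
    subgoal premises prems for t s'
    proof -
      have "(w - m) * n * 38 \<le> w * n * 38" using mnw by linarith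
      moreover have "t \<le> 12 + (w - m) * n * 38" using prems(3) by simp
      ultimately have "t \<le> 37 + 40 * (w * n)" by linarith
      then show ?thesis using prems(1) by (auto simp: I_def)
    qed
    done
qed

lemma wp_coordinates:
  fixes s :: store and m n w q :: nat
  assumes s: "s ''m'' 0 = int m" "s ''n'' 0 = int n" "s ''w'' 0 = int w" "s ''q'' 0 = int q" "s ''z'' 0 = int z" "s ''h'' 0 = H"
    and mw: "m \<le> w" "w + q \<le> n" and M0: "\<And>i. i < m \<Longrightarrow> s ''M'' (int i) = 0"
  defines "md \<equiv> \<lambda>i. if i < m then 0 else s ''S'' (ix z (i - m + q) (i - m + q))"
  defines "tau \<equiv> \<lambda>i. if i < m then s ''b'' (int i) else s ''g'' (int (i - m + q)) mod md i"
  defines "hh \<equiv> \<lambda>i. if i < m then H else md i"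
  defines "Rv \<equiv> \<lambda>k. 1 + (\<Sum>i<k. 4 * (tau i * tau i + hh i))"
  assumes W: "\<And>i. i < w \<Longrightarrow> \<bar>md i\<bar> \<le> W \<and> \<bar>tau i\<bar> \<le> W \<and> \<bar>hh i\<bar> \<le> W" "\<And>k. k \<le> w \<Longrightarrow> \<bar>Rv k\<bar> \<le> W"
    "int ((n + 2) * (w + 1)) \<le> W" "\<And>i j. i < w \<Longrightarrow> j < n \<Longrightarrow> \<bar>s ''A'' (ix n i j)\<bar> \<le> W"
  shows "wp W coordinates (\<lambda>t s'. t \<le> w * (50 * n + 150) + 50 \<and> unchanged {''R'', ''i'', ''t'', ''D'', ''M'', ''r'', ''j'', ''V''} s s' \<and>
    (\<forall>i<w. s' ''M'' (int i) = md i \<and> s' ''t'' (int i) = tau i \<and> s' ''D'' (int i) = hh i) \<and> s' ''R'' 0 = Rv w \<and>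
    (\<forall>i<w. s' ''V'' (ix w 0 i) = s ''V'' (ix w 0 i)) \<and> (\<forall>i<w. \<forall>j<n. s' ''V'' (ix w (Suc j) i) = s ''A'' (ix n i j))) s"
proof -
  define I where "I k s' \<longleftrightarrow> unchanged {''R'', ''i'', ''t'', ''D'', ''M'', ''r'', ''j'', ''V''} s s' \<and>
    (\<forall>i<k. s' ''M'' (int i) = md i \<and> s' ''t'' (int i) = tau i \<and> s' ''D'' (int i) = hh i) \<and> (\<forall>i<m. s' ''M'' (int i) = 0) \<and> s' ''R'' 0 = Rv k \<and>
    (\<forall>i<w. s' ''V'' (ix w 0 i) = s ''V'' (ix w 0 i)) \<and> (\<forall>i<k. \<forall>j<n. s' ''V'' (ix w (Suc j) i) = s ''A'' (ix n i j))" for k s'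
  have nW: "int n + 2 \<le> W" "int w \<le> W"
  proof -
    have "int (n + 2) \<le> W" by (rule order_trans[OF of_nat_mono W(3)]) simp
    then show "int n + 2 \<le> W" by simp
    show "int w \<le> W" by (rule order_trans[OF of_nat_mono W(3)]) simp
  qed
  have W0: "0 \<le> W" "1 \<le> W" using nW by linarith+
  \<comment> \<open>The common tail of both branches: extending the radix and copying coordinate i
    of all columns to the rows of \<open>V\<close>, where row 0 stays free for the empty
    multiset.\<close>
  have inner: "wp W (''R'' ::= Add (Var ''R'') (Mul (Const 4) (Add (Mul (Load ''t'' (Var ''i'')) (Load ''t'' (Var ''i''))) (Load ''D'' (Var ''i'')))) ;;
       ''j'' ::= Const 0 ;;
       For ''j'' (Var ''n'') (Store ''V'' (Add (Mul (Add (Var ''j'') (Const 1)) (Var ''w'')) (Var ''i'')) (At ''i'' ''j'')))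
     (\<lambda>t s''. t \<le> 50 * n + 50 \<and> s'' ''i'' 0 = int i \<and> I (Suc i) s'') s'"
    if i: "i < w" "s' ''i'' 0 = int i" and un: "unchanged {''R'', ''i'', ''t'', ''D'', ''M'', ''r'', ''j'', ''V''} s s'"
      and cs: "\<forall>k<Suc i. s' ''M'' (int k) = md k \<and> s' ''t'' (int k) = tau k \<and> s' ''D'' (int k) = hh k" "\<forall>k<m. s' ''M'' (int k) = 0"
      and R: "s' ''R'' 0 = Rv i" and V0: "\<forall>i<w. s' ''V'' (ix w 0 i) = s ''V'' (ix w 0 i)"
      and V: "\<forall>k<i. \<forall>j<n. s' ''V'' (ix w (Suc j) k) = s ''A'' (ix n k j)" for i s'
  proof -
    have c: "s' ''n'' 0 = int n" "s' ''w'' 0 = int w" using un s by (auto simp: unchanged_def)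
    have ti: "s' ''t'' (int i) = tau i" "s' ''D'' (int i) = hh i" using cs by auto
    have Rn: "Rv i + (4 * (tau i * tau i) + 4 * hh i) = Rv (Suc i)" by (simp add: Rv_def)
    have RW: "\<bar>Rv (Suc i)\<bar> \<le> W" using W(2) i by simp
    define J where "J j s'' \<longleftrightarrow> unchanged {''j'', ''V'', ''R''} s' s'' \<and> s'' ''R'' 0 = Rv (Suc i) \<and>
      (\<forall>i<w. s'' ''V'' (ix w 0 i) = s ''V'' (ix w 0 i)) \<and>
      (\<forall>k j'. k \<le> i \<longrightarrow> j' < n \<longrightarrow> (k < i \<or> j' < j) \<longrightarrow> s'' ''V'' (ix w (Suc j') k) = s ''A'' (ix n k j'))" for j s''
    show ?thesis
      apply (simp add: wp_simps i(2) ti R Rn RW W0)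
      apply (rule wp_For[where l = 0 and N = n and c = 30 and I = J])
      subgoal by simp
      subgoal by simp
      subgoal using V0 V by (simp add: J_def unchanged_def)
      subgoal premises prems for j s''
      proof -
        have c'': "s'' ''w'' 0 = int w" "s'' ''i'' 0 = int i" "s'' ''n'' 0 = int n" "s'' ''A'' = s ''A''"
          using prems(3) c i un by (auto simp: J_def unchanged_def)
        have ixS: "(int j + 1) * int w + int i = ix w (Suc j) i" by (simp add: ix_def algebra_simps)
        have "ix w (Suc j) i \<le> int ((n + 2) * (w + 1))"
        proof -
          have "Suc j * w + i \<le> n * w + w" using prems(2) i(1) mult_right_mono[of "Suc j" n w] by simp
          also have "\<dots> \<le> (n + 2) * (w + 1)" by simp
          finally have "int (Suc j * w + i) \<le> int ((n + 2) * (w + 1))" by (simp only: of_nat_le_iff)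
          then show ?thesis by (simp add: ix_def algebra_simps)
        qed
        then have "ix w (Suc j) i \<le> W" using W(3) by (rule order_trans)
        moreover have "0 \<le> ix w (Suc j) i" by (simp add: ix_def)
        ultimately have "\<bar>ix w (Suc j) i\<bar> \<le> W" by linarith
        moreover have "J (Suc j) (s''(''V'' := (s'' ''V'')(ix w (Suc j) i := s ''A'' (ix n i j))))"
          using prems(3) i(1) by (auto simp: J_def unchanged_def ix_eq_iff less_Suc_eq)
        ultimately show ?thesis using W(4)[OF i(1) prems(2)] prems(4)
          by (simp add: wp_simps c'' ixS flip: ix_def)
      qed
      subgoal for j s'' using c by (simp add: J_def unchanged_def)
      subgoal for j s'' v by (auto simp: J_def unchanged_def)
      subgoal using nW by simp
      subgoal premises prems for t s''
      proof -
        have J: "J n s''" by fact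
        have "unchanged {''R'', ''i'', ''t'', ''D'', ''M'', ''r'', ''j'', ''V''} s s''" using J un by (auto simp: J_def unchanged_def)
        moreover have eq: "s'' ''M'' = s' ''M''" "s'' ''t'' = s' ''t''" "s'' ''D'' = s' ''D''" "s'' ''i'' = s' ''i''"
          using J by (auto simp: J_def unchanged_def)
        ultimately have "I (Suc i) s''" unfolding I_def using J cs by (auto simp: J_def less_Suc_eq)
        then show ?thesis using prems(3) i(2) eq by simp
      qed
      done
  qed
  show ?thesis unfolding coordinates_def
    apply (simp add: wp_simps W0)
    apply (rule wp_For[where l = 0 and N = w and c = "50 * n + 130" and I = I])
    subgoal by simp
    subgoal by simp
    subgoal using M0 by (simp add: I_def unchanged_def Rv_def)
    subgoal premises prems for i s'
    proof -
      have I: "I i s'" and i: "i < w" "s' ''i'' 0 = int i" by fact+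
      have c: "s' ''m'' 0 = int m" "s' ''h'' 0 = H" "s' ''b'' = s ''b''" "s' ''g'' = s ''g''" "s' ''S'' = s ''S''" "s' ''q'' 0 = int q" "s' ''z'' 0 = int z"
        using I s by (auto simp: I_def unchanged_def)
      have iW: "\<bar>int i\<bar> \<le> W" using i nW by simp
      show ?thesis
      proof (cases "i < m")
        case True
        let ?s1 = "s'(''t'' := (s' ''t'')(int i := tau i), ''D'' := (s' ''D'')(int i := H))"
        have "wp W (''R'' ::= Add (Var ''R'') (Mul (Const 4) (Add (Mul (Load ''t'' (Var ''i'')) (Load ''t'' (Var ''i''))) (Load ''D'' (Var ''i'')))) ;;
           ''j'' ::= Const 0 ;;
           For ''j'' (Var ''n'') (Store ''V'' (Add (Mul (Add (Var ''j'') (Const 1)) (Var ''w'')) (Var ''i'')) (At ''i'' ''j'')))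
           (\<lambda>t s''. t \<le> 50 * n + 50 \<and> s'' ''i'' 0 = int i \<and> I (Suc i) s'') ?s1"
          by (rule inner) (use I i True in \<open>auto simp: I_def unchanged_def less_Suc_eq md_def hh_def\<close>)
        moreover have "tau i = s ''b'' (int i)" "hh i = H" using True by (auto simp: tau_def hh_def)
        moreover have "int m - int i > 0" using True by simp
        ultimately show ?thesis using W(1)[OF i(1)] iW
          apply (subst wp_Seq)
          apply (simp add: wp_IfPos wp_Store wp_Seq[where p = "Store ''t'' _ _"] i c)
          apply (erule wp_conseq)
          by simp
      next
        case False
        define l where "l = i - m + q"
        have mdl: "md i = s ''S'' (ix z l l)" "tau i = s ''g'' (int l) - md i * (s ''g'' (int l) div md i)" "hh i = md i"
          using False by (auto simp: md_def tau_def hh_def l_def minus_mult_div_eq_mod)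
        let ?s1 = "s'(''r'' := (s' ''r'')(0 := int l), ''M'' := (s' ''M'')(int i := md i), ''t'' := (s' ''t'')(int i := tau i), ''D'' := (s' ''D'')(int i := md i))"
        have s1: "unchanged {''R'', ''i'', ''t'', ''D'', ''M'', ''r'', ''j'', ''V''} s ?s1" "?s1 ''i'' 0 = int i" "?s1 ''R'' 0 = Rv i" "?s1 ''V'' = s' ''V''"
          using I i by (simp_all add: I_def unchanged_def)
        have s1': "?s1 ''M'' (int k) = md k \<and> ?s1 ''t'' (int k) = tau k \<and> ?s1 ''D'' (int k) = hh k" if "k < Suc i" for k
          using I mdl(3) that by (cases "k = i") (simp_all add: I_def)
        have s1'': "?s1 ''M'' (int k) = 0" if "k < m" for k using I False that by (auto simp: I_def)
        have inn: "wp W (''R'' ::= Add (Var ''R'') (Mul (Const 4) (Add (Mul (Load ''t'' (Var ''i'')) (Load ''t'' (Var ''i''))) (Load ''D'' (Var ''i'')))) ;;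
           ''j'' ::= Const 0 ;;
           For ''j'' (Var ''n'') (Store ''V'' (Add (Mul (Add (Var ''j'') (Const 1)) (Var ''w'')) (Var ''i'')) (At ''i'' ''j'')))
           (\<lambda>t s''. t \<le> 50 * n + 50 \<and> s'' ''i'' 0 = int i \<and> I (Suc i) s'') ?s1"
          by (rule inner[OF i(1) s1(2,1) allI[OF impI[OF s1']] allI[OF impI[OF s1'']] s1(3)]) (use I in \<open>simp_all add: I_def\<close>)
        have il: "int i - int m + int q = int l" using False by (simp add: l_def)
        have lW: "\<bar>int l\<bar> \<le> W" using i(1) mw False nW by (simp add: l_def)
        have neg: "\<not> int m - int i > 0" using False by simp
        show ?thesis
          apply (subst wp_Seq)
          using W(1)[OF i(1)] iW lW inn neg
          apply (simp add: wp_IfPos wp_Store wp_Seq[where p = "Store ''r'' _ _"] wp_Seq[where p = "Store ''M'' _ _"] wp_Seq[where p = "Store ''t'' _ _"]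
            i c il W0 mdl(3) flip: ix_def mdl(1,2))
          apply (erule wp_conseq)
          by simp
      qed
    qed
    subgoal for i s' using s by (simp add: I_def unchanged_def)
    subgoal for i s' v by (auto simp: I_def unchanged_def)
    subgoal using nW by simp
    subgoal premises prems for t s'
    proof -
      have "w * (142 + 50 * n) \<le> w * (50 * n + 150)" by (intro mult_left_mono) auto
      moreover have "t \<le> 6 + w * (142 + 50 * n)" using prems(3) by (simp add: algebra_simps)
      ultimately have "t \<le> 44 + w * (50 * n + 150)" by linarith
      then show ?thesis using prems(1) by (auto simp: I_def)
    qed
    done
qed

lemma wp_weights:
  assumes s: "s ''n'' 0 = int n" "s ''rho'' 0 = int \<rho>"
  defines "Q \<equiv> 2 ^ (\<rho> + 1) + 1 :: int"
  assumes W: "Q ^ (n + 1) \<le> W" "\<And>j. j < n \<Longrightarrow> \<bar>Q ^ j + s ''c'' (int j) * Q ^ n\<bar> \<le> W" "int n + 1 \<le> W" "int \<rho> \<le> W"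
  shows "wp W weights (\<lambda>t s'. t \<le> 30 * \<rho> + 80 * n + 80 \<and> unchanged {''p'', ''k'', ''Q'', ''f'', ''j'', ''E''} s s' \<and>
    s' ''p'' 0 = 2 ^ \<rho> \<and> s' ''Q'' 0 = Q \<and> s' ''E'' 0 = s ''E'' 0 \<and>
    (\<forall>j<n. s' ''E'' (int (Suc j)) = Q ^ j + s ''c'' (int j) * Q ^ n)) s"
proof -
  have Q1: "1 \<le> Q" by (simp add: Q_def)
  have QW: "Q ^ j \<le> W" if "j \<le> n + 1" for j
    using power_increasing[OF that Q1] W(1) by linarith
  have Q0: "0 \<le> Q ^ j" for j using Q1 by simp
  have pW: "2 ^ k \<le> W" if "k \<le> \<rho> + 1" for k :: nat
  proof -
    have "(2::int) ^ k \<le> 2 ^ (\<rho> + 1)" using that by (intro power_increasing) auto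
    then show ?thesis using QW[of 1] by (simp add: Q_def)
  qed
  have W1: "1 \<le> W" "0 \<le> W" using W(3) by linarith+
  let ?I1 = "\<lambda>k s'. unchanged {''p'', ''k''} s s' \<and> s' ''p'' 0 = 2 ^ k"
  let ?I2 = "\<lambda>k s'. unchanged {''p'', ''k'', ''Q'', ''f'', ''j'', ''E''} s s' \<and> s' ''p'' 0 = 2 ^ \<rho> \<and> s' ''Q'' 0 = Q \<and>
    s' ''E'' 0 = s ''E'' 0 \<and> s' ''f'' 0 = Q ^ k \<and> (\<forall>j<k. s' ''E'' (int (Suc j)) = Q ^ j)"
  let ?I3 = "\<lambda>k s'. unchanged {''p'', ''k'', ''Q'', ''f'', ''j'', ''E''} s s' \<and> s' ''p'' 0 = 2 ^ \<rho> \<and> s' ''Q'' 0 = Q \<and>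
    s' ''E'' 0 = s ''E'' 0 \<and> s' ''f'' 0 = Q ^ n \<and> (\<forall>j<n. s' ''E'' (int (Suc j)) = Q ^ j + (if j < k then s ''c'' (int j) * Q ^ n else 0))"
  show ?thesis unfolding weights_def
    apply (simp add: wp_simps W1)
    apply (rule wp_For[where l = 0 and N = \<rho> and c = 15 and I = ?I1])
    subgoal by simp
    subgoal by simp
    subgoal by (simp add: unchanged_def)
    subgoal for k s' using pW[of "Suc k"] by (auto simp: wp_simps unchanged_def W1)
    subgoal for k s' using s by (simp add: unchanged_def)
    subgoal for k s' v by (auto simp: unchanged_def)
    subgoal using W(4) by simp
    subgoal premises prems for t s1
    proof -
      have s1: "s1 ''n'' 0 = int n" "s1 ''p'' 0 = 2 ^ \<rho>" "s1 ''E'' = s ''E''" "unchanged {''p'', ''k''} s s1"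
        using prems s by (auto simp: unchanged_def)
      have Qe: "2 * 2 ^ \<rho> + 1 = Q" "1 + 2 * 2 ^ \<rho> = Q" by (auto simp: Q_def)
      have QW': "\<bar>Q\<bar> \<le> W" using QW[of 1] Q1 by simp
      show ?thesis
        apply (simp add: wp_simps s1 W1 Qe QW')
        apply (rule wp_For[where l = 0 and N = n and c = 25 and I = ?I2])
        subgoal by simp
        subgoal by simp
        subgoal using s1 by (simp add: unchanged_def)
        subgoal premises p2 for j s2
        proof -
          have "Q ^ j * Q = Q ^ Suc j" by simp
          then have "\<bar>Q ^ j * Q\<bar> \<le> W" "\<bar>Q ^ j\<bar> \<le> W" using QW[of "Suc j"] QW[of j] p2(2) Q0[of "Suc j"] Q0[of j] by (auto simp: mult.commute)
          moreover have "int j + 1 \<le> W" using p2(2) W(3) by simp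
          ultimately show ?thesis using p2
            by (auto simp: wp_simps unchanged_def W1 less_Suc_eq mult.commute)
        qed
        subgoal for j s2 using s by (simp add: unchanged_def)
        subgoal for j s2 v by (auto simp: unchanged_def)
        subgoal using W(3) by simp
        subgoal premises p2 for t2 s2
        proof -
          show ?thesis
            apply (rule wp_For[where l = 0 and N = n and c = 30 and I = ?I3])
            subgoal by simp
            subgoal by simp
            subgoal using p2 by (simp add: unchanged_def)
            subgoal premises p3 for j s3
            proof -
              have "s3 ''c'' = s ''c''" "s3 ''E'' (int j + 1) = Q ^ j" "s3 ''f'' 0 = Q ^ n" using p3 by (auto simp: unchanged_def add.commute)
              moreover have "int j + 1 \<le> W" using p3(2) W(3) by simp
              moreover have "\<bar>Q ^ j + s ''c'' (int j) * Q ^ n\<bar> \<le> W" using W(2) p3(2) .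
              ultimately show ?thesis using p3
                by (auto simp: wp_simps unchanged_def W1 less_Suc_eq)
            qed
            subgoal for j s2 using s by (simp add: unchanged_def)
            subgoal for j s2 v by (auto simp: unchanged_def)
            subgoal using W(3) by simp
            subgoal using prems(3) p2(3) by auto
            done
        qed
        done
    qed
    done
qed

lemma wp_decode:
  assumes s: "s ''n'' 0 = int n" "s ''w'' 0 = int w" "s ''R'' 0 = R" "\<And>i. i < w \<Longrightarrow> s ''t'' (int i) = tau i"
    "s ''T'' (horner R tau w) = k" "s ''E'' k = F" "s ''Q'' 0 = Q"
    and F: "0 \<le> F" "F \<le> W" "0 < Q" "Q \<le> W" and W: "int n + 1 \<le> W" "int w \<le> W" "\<And>i. i \<le> w \<Longrightarrow> \<bar>horner R tau i\<bar> \<le> W"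
  shows "wp W decode (\<lambda>t s'. t \<le> 40 * w + 60 * n + 60 \<and> (\<forall>j<n. s' ''x'' (int j) = F div Q ^ j mod Q)) s"
proof -
  have W0: "0 \<le> W" using W by linarith
  let ?I1 = "\<lambda>i s'. unchanged {''o'', ''i''} s s' \<and> s' ''o'' 0 = horner R tau i"
  let ?I2 = "\<lambda>j s'. s' ''n'' 0 = int n \<and> s' ''Q'' 0 = Q \<and> s' ''f'' 0 = F div Q ^ j \<and> (\<forall>j'<j. s' ''x'' (int j') = F div Q ^ j' mod Q)"
  have fb: "\<bar>F div Q ^ j\<bar> \<le> W" for j
  proof -
    have "0 \<le> F div Q ^ j" using F by (simp add: pos_imp_zdiv_nonneg_iff)
    moreover have "F div Q ^ j \<le> F" using zdiv_mono2[OF F(1), of 1 "Q ^ j"] F(3) by (simp add: int_one_le_iff_zero_less)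
    ultimately show ?thesis using F(2) by linarith
  qed
  show ?thesis unfolding decode_def
    apply (simp add: wp_simps W0)
    apply (rule wp_For[where l = 0 and N = w and c = 20 and I = ?I1])
    subgoal by simp
    subgoal by simp
    subgoal by (simp add: unchanged_def)
    subgoal premises prems for i s'
    proof -
      have "s' ''R'' 0 = R" "s' ''t'' (int i) = tau i" using prems s by (auto simp: unchanged_def)
      then show ?thesis using prems W(3)[of "Suc i"] by (auto simp: wp_simps unchanged_def W0)
    qed
    subgoal for i s' using s by (simp add: unchanged_def)
    subgoal for i s' v by (auto simp: unchanged_def)
    subgoal using W by simp
    subgoal premises prems for t s1
    proof -
      have c: "s1 ''n'' 0 = int n" "s1 ''T'' (horner R tau w) = k" "s1 ''E'' k = F" "s1 ''Q'' 0 = Q" "s1 ''o'' 0 = horner R tau w"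
        using prems s by (auto simp: unchanged_def)
      have FW: "\<bar>F\<bar> \<le> W" using F by simp
      show ?thesis
        apply (simp add: wp_simps c W0 FW)
        apply (rule wp_For[where l = 0 and N = n and c = 40 and I = ?I2])
        subgoal by simp
        subgoal by simp
        subgoal using c by simp
        subgoal premises p2 for j s2
        proof -
          have d: "s2 ''Q'' 0 = Q" "s2 ''f'' 0 = F div Q ^ j" "s2 ''n'' 0 = int n" using p2 by auto
          have "F div Q ^ j - Q * (F div Q ^ j div Q) = F div Q ^ j mod Q" by (simp add: minus_mult_div_eq_mod)
          moreover have "\<bar>F div Q ^ j mod Q\<bar> \<le> W" using F pos_mod_bound[OF F(3), of "F div Q ^ j"] pos_mod_sign[OF F(3), of "F div Q ^ j"] by linarith
          moreover have "F div Q ^ j div Q = F div Q ^ Suc j" using zdiv_zmult2_eq[of Q F "Q ^ j"] F(3) by (simp add: mult.commute)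
          moreover have "\<bar>int j\<bar> \<le> W" using p2(2) W(1) by simp
          ultimately show ?thesis using p2 fb[of "Suc j"]
            by (simp add: wp_simps d W0 less_Suc_eq del: power_Suc)
        qed
        subgoal for j s2 by simp
        subgoal for j s2 v by auto
        subgoal using W by simp
        subgoal for t2 s2 using prems(3) by auto
        done
    qed
    done
qed

section \<open>Multisets as vectors of multiplicities, and their base-Q digits\<close>

lemma sum_mset_eq_sum_count:
  fixes f :: "nat \<Rightarrow> int"
  assumes "set_mset X \<subseteq> {..<n}"
  shows "(\<Sum>j\<in>#X. f j) = (\<Sum>j<n. int (count X j) * f j)"
  using assms
proof (induction X)
  case (add x X)
  have "(\<Sum>j<n. int (count (add_mset x X) j) * f j) = (\<Sum>j<n. int (count X j) * f j + (if j = x then f j else 0))"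
    by (rule sum.cong) (auto simp: algebra_simps)
  also have "\<dots> = (\<Sum>j<n. int (count X j) * f j) + f x" using add.prems by (simp add: sum.distrib)
  finally show ?case using add by simp
qed simp

lemma sum_mset_adj_mat:
  fixes M A :: "int mat"
  assumes M: "M \<in> carrier_mat m m" and A: "A \<in> carrier_mat m n" and X: "set_mset X \<subseteq> {..<n}" and i: "i < m"
  shows "(\<Sum>j\<in>#X. (adj_mat M * A) $$ (i, j)) = (adj_mat M *\<^sub>v (A *\<^sub>v vec n (\<lambda>j. int (count X j)))) $ i"
proof -
  have aM: "adj_mat M \<in> carrier_mat m m" using adj_mat[OF M] by auto
  define C where "C = adj_mat M * A"
  have C: "C \<in> carrier_mat m n" using aM A by (simp add: C_def)
  have "(adj_mat M *\<^sub>v (A *\<^sub>v vec n (\<lambda>j. int (count X j)))) = C *\<^sub>v vec n (\<lambda>j. int (count X j))"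
    unfolding C_def by (rule assoc_mult_mat_vec[OF aM A, symmetric]) simp
  moreover have "(C *\<^sub>v vec n (\<lambda>j. int (count X j))) $ i = (\<Sum>j<n. int (count X j) * C $$ (i, j))"
    using i C by (simp add: scalar_prod_def atLeast0LessThan mult.commute)
  ultimately show ?thesis unfolding C_def[symmetric] sum_mset_eq_sum_count[OF X] by simp
qed

lemma digit_sum_bounds:
  fixes d :: "nat \<Rightarrow> int"
  assumes "\<And>j. j < n \<Longrightarrow> 0 \<le> d j \<and> d j < Q" "0 < Q"
  shows "0 \<le> (\<Sum>j<n. d j * Q ^ j)" "(\<Sum>j<n. d j * Q ^ j) < Q ^ n"
proof -
  show "0 \<le> (\<Sum>j<n. d j * Q ^ j)" using assms by (intro sum_nonneg) auto
  show "(\<Sum>j<n. d j * Q ^ j) < Q ^ n" using assms(1)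
  proof (induction n)
    case (Suc n)
    have "(d n + 1) * Q ^ n \<le> Q * Q ^ n" using Suc.prems[of n] assms(2) by (intro mult_right_mono) auto
    moreover have "(\<Sum>j<n. d j * Q ^ j) < Q ^ n" using Suc by simp
    ultimately show ?case by (simp add: algebra_simps)
  qed simp
qed

text \<open>The digits below k contribute less than \<open>Q ^ k\<close>, and the digits above k and
  the summand with t are multiples of \<open>Q ^ Suc k\<close>. In the application t is the
  cost.\<close>

lemma digit_extract:
  fixes d :: "nat \<Rightarrow> int"
  assumes d: "\<And>j. j < n \<Longrightarrow> 0 \<le> d j \<and> d j < Q" and Q: "0 < Q" and k: "k < n"
  shows "((\<Sum>j<n. d j * Q ^ j) + t * Q ^ n) div Q ^ k mod Q = d k"
proof -
  define lo where "lo = (\<Sum>j<k. d j * Q ^ j)"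
  have lo: "0 \<le> lo" "lo < Q ^ k" unfolding lo_def using digit_sum_bounds[of k d Q] d Q k by auto
  have "(\<Sum>j<n. d j * Q ^ j) = lo + (\<Sum>j=k..<n. d j * Q ^ j)"
    unfolding lo_def using sum.atLeastLessThan_concat[of 0 k n "\<lambda>j. d j * Q ^ j"] k by (simp add: atLeast0LessThan)
  also have "(\<Sum>j=k..<n. d j * Q ^ j) = d k * Q ^ k + (\<Sum>j=Suc k..<n. d j * Q ^ j)"
    by (rule sum.atLeast_Suc_lessThan[OF k])
  finally have "(\<Sum>j<n. d j * Q ^ j) = lo + (d k * Q ^ k + (\<Sum>j=Suc k..<n. d j * Q ^ j))" .
  moreover have "(\<Sum>j=Suc k..<n. d j * Q ^ j) = Q ^ Suc k * (\<Sum>j=Suc k..<n. d j * Q ^ (j - Suc k))"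
    unfolding sum_distrib_left by (rule sum.cong) (auto simp: mult.left_commute simp flip: power_add power_Suc)
  moreover have "Q ^ n = Q ^ Suc k * Q ^ (n - Suc k)" using k by (simp flip: power_add power_Suc)
  ultimately have e: "(\<Sum>j<n. d j * Q ^ j) + t * Q ^ n = lo + (d k + Q * ((\<Sum>j=Suc k..<n. d j * Q ^ (j - Suc k)) + t * Q ^ (n - Suc k))) * Q ^ k"
    by (simp add: algebra_simps)
  have "Q ^ k \<noteq> 0" using Q by simp
  then have "((\<Sum>j<n. d j * Q ^ j) + t * Q ^ n) div Q ^ k = d k + Q * ((\<Sum>j=Suc k..<n. d j * Q ^ (j - Suc k)) + t * Q ^ (n - Suc k))"
    unfolding e using lo by simp
  then show ?thesis using d[OF k] by simp
qed

section \<open>Row-major storage\<close>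

lemma length_concat_uniform: "(\<And>x. x \<in> set xs \<Longrightarrow> length x = n) \<Longrightarrow> length (concat xs) = length xs * n"
  by (induction xs) auto

lemma nth_concat_uniform:
  "(\<And>x. x \<in> set xs \<Longrightarrow> length x = n) \<Longrightarrow> i < length xs \<Longrightarrow> j < n \<Longrightarrow> concat xs ! (i * n + j) = xs ! i ! j"
proof (induction xs arbitrary: i)
  case (Cons x xs)
  then show ?case by (cases i) (auto simp: nth_append)
qed simp

lemma length_row_major: "length (row_major M) = dim_row M * dim_col M"
  unfolding row_major_def by (subst length_concat_uniform[of _ "dim_col M"]) (auto simp: rows_def)

lemma nth_row_major: "i < dim_row M \<Longrightarrow> j < dim_col M \<Longrightarrow> row_major M ! (i * dim_col M + j) = M $$ (i, j)"
  unfolding row_major_def by (subst nth_concat_uniform) (auto simp: rows_def list_of_vec_index)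

lemma set_row_major: "set (row_major M) = elements_mat M"
  unfolding row_major_def elements_mat_def rows_def by (auto simp: list_of_vec_index in_set_conv_nth row_def)

text \<open>A state consists of a lattice point in the box and one residue for each remaining
  coordinate. Together these determine it, so the two counts multiply.\<close>

lemma card_states_le:
  fixes M A :: "int mat" and a :: "nat \<Rightarrow> nat \<Rightarrow> int" and md tau :: "nat \<Rightarrow> int" and p H :: int
  assumes M: "M \<in> carrier_mat m m" and d: "det M \<noteq> 0" and A: "A \<in> carrier_mat m n" and mw: "m \<le> w"
    and a: "\<And>i j. i < m \<Longrightarrow> j < n \<Longrightarrow> a j i = (adj_mat M * A) $$ (i, j)"
    and md: "\<And>i. i < m \<Longrightarrow> md i = 0" "\<And>i. m \<le> i \<Longrightarrow> i < w \<Longrightarrow> 0 < md i" and p: "0 < p"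
  defines "T \<equiv> {\<lambda>i\<in>{..<w}. (\<Sum>j\<in>#X. a j i) mod md i | X. set_mset X \<subseteq> {..<n} \<and>
      (\<forall>i<m. \<bar>p * ((\<Sum>j\<in>#X. a j i) mod md i) - tau i\<bar> \<le> p * H)}"
  shows "finite T \<and> card T \<le> nat \<bar>det M\<bar> * (nat (2 * H div \<bar>det M\<bar>) + 1) ^ m * (\<Prod>i=m..<w. nat (md i))"
proof -
  let ?L = "{\<lambda>i\<in>{..<m}. (adj_mat M *\<^sub>v y) $ i | y. y \<in> carrier_vec m \<and>
     (\<forall>i<m. \<bar>p * (adj_mat M *\<^sub>v y) $ i - tau i\<bar> \<le> p * H)}"
  let ?P = "\<Pi>\<^sub>E i\<in>{m..<w}. {0..<md i}"
  define F where "F u = (restrict u {..<m}, restrict u {m..<w})" for u :: "nat \<Rightarrow> int"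
  have L: "finite ?L" "card ?L \<le> nat \<bar>det M\<bar> * (nat (2 * H div \<bar>det M\<bar>) + 1) ^ m"
    using card_lattice_points_in_box[OF M d p] by auto
  have P: "finite ?P" "card ?P = (\<Prod>i=m..<w. nat (md i))" by (auto simp: card_PiE intro: finite_PiE)
  have inj: "inj_on F T"
  proof (rule inj_onI)
    fix u v assume uv: "u \<in> T" "v \<in> T" "F u = F v"
    have "u i = v i" if "i < w" for i
    proof (cases "i < m")
      case True
      then show ?thesis using uv(3) by (auto simp: F_def dest!: fun_cong[of _ _ i])
    next
      case False
      have "restrict u {m..<w} i = restrict v {m..<w} i" using uv(3) by (simp add: F_def)
      then show ?thesis using False that by simp
    qed
    moreover have "u \<in> extensional {..<w}" "v \<in> extensional {..<w}" using uv by (auto simp: T_def)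
    ultimately show "u = v" by (auto intro: extensionalityI)
  qed
  have img: "F u \<in> ?L \<times> ?P" if u: "u \<in> T" for u
  proof -
    from u obtain X where X: "set_mset X \<subseteq> {..<n}" "u = (\<lambda>i\<in>{..<w}. (\<Sum>j\<in>#X. a j i) mod md i)"
      "\<forall>i<m. \<bar>p * ((\<Sum>j\<in>#X. a j i) mod md i) - tau i\<bar> \<le> p * H" unfolding T_def by blast
    let ?y = "A *\<^sub>v vec n (\<lambda>j. int (count X j))"
    have y: "(\<Sum>j\<in>#X. a j i) = (adj_mat M *\<^sub>v ?y) $ i" if "i < m" for i
    proof -
      have "(\<Sum>j\<in>#X. a j i) = (\<Sum>j\<in>#X. (adj_mat M * A) $$ (i, j))"
        by (rule arg_cong[of _ _ sum_mset], rule image_mset_cong) (use a X(1) that in auto)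
      then show ?thesis using sum_mset_adj_mat[OF M A X(1) that] by simp
    qed
    have "restrict u {..<m} = (\<lambda>i\<in>{..<m}. (adj_mat M *\<^sub>v ?y) $ i)"
      using mw by (auto simp: X(2) y md(1) fun_eq_iff)
    moreover have "\<forall>i<m. \<bar>p * (adj_mat M *\<^sub>v ?y) $ i - tau i\<bar> \<le> p * H" using X(3) y md(1) by simp
    moreover have "?y \<in> carrier_vec m" using A by (auto intro!: carrier_vecI)
    ultimately have "restrict u {..<m} \<in> ?L" by blast
    moreover have "restrict u {m..<w} \<in> ?P" using md(2) by (auto simp: X(2))
    ultimately show ?thesis by (simp add: F_def)
  qed
  have "finite T" using inj_on_finite[OF inj, of "?L \<times> ?P"] img L P by blast
  moreover have "card T \<le> card (?L \<times> ?P)" using card_inj_on_le[OF inj, of "?L \<times> ?P"] img L P by blast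
  moreover have "card (?L \<times> ?P) \<le> nat \<bar>det M\<bar> * (nat (2 * H div \<bar>det M\<bar>) + 1) ^ m * (\<Prod>i=m..<w. nat (md i))"
    unfolding card_cartesian_product P(2) using L(2) by (rule mult_right_mono) simp
  ultimately show ?thesis by simp
qed

text \<open>In the first m coordinates the doubled part deviates by \<open>p * H\<close> from the
  box of X and by another \<open>p * H\<close> from the split, with
  \<open>H = 2 * \<lceil>h\<rceil> * y\<close>; the sum is exactly the allowance at scale
  \<open>2 * p\<close>. In the other coordinates residue and target both lie between 0 and the
  modulus, so the condition always holds.\<close>

lemma split_in_box:
  fixes a :: "nat \<Rightarrow> nat \<Rightarrow> int" and md tau :: "nat \<Rightarrow> int" and p y :: int
  assumes h: "discrepancy_bound m h" "1 \<le> h" and y: "0 \<le> y"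
    and a: "\<And>i j. i < m \<Longrightarrow> j < n \<Longrightarrow> \<bar>a j i\<bar> \<le> y"
    and md: "\<And>i. i < m \<Longrightarrow> md i = 0" "\<And>i. m \<le> i \<Longrightarrow> i < w \<Longrightarrow> 0 < md i \<and> 0 \<le> tau i \<and> tau i < md i"
    and hh: "\<And>i. i < w \<Longrightarrow> hh i = (if i < m then 2 * \<lceil>h\<rceil> * y else md i)" and mw: "m \<le> w"
    and X: "set_mset X \<subseteq> {..<n}" "real (size X) \<le> (6 / 5) ^ Suc k" "0 < p"
    and box: "\<forall>i<w. \<bar>p * ((\<Sum>j\<in>#X. a j i) mod md i) - tau i\<bar> \<le> p * hh i"
  shows "\<exists>Y1 Y2. X = Y1 + Y2 \<and> real (size Y1) \<le> (6 / 5) ^ k \<and> real (size Y2) \<le> (6 / 5) ^ k \<and>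
    (\<forall>i<w. \<bar>2 * p * ((\<Sum>j\<in>#Y1. a j i) mod md i) - tau i\<bar> \<le> 2 * p * hh i) \<and>
    (\<forall>i<w. \<bar>2 * p * ((\<Sum>j\<in>#Y2. a j i) mod md i) - tau i\<bar> \<le> 2 * p * hh i)"
proof -
  define \<sigma> where "\<sigma> Y i = (\<Sum>j\<in>#Y. a j i)" for Y i
  have "\<exists>Y1 Y2. X = Y1 + Y2 \<and> real (size Y1) \<le> (6 / 5) ^ k \<and> real (size Y2) \<le> (6 / 5) ^ k \<and>
    (\<forall>i<m. \<bar>2 * \<sigma> Y1 i - \<sigma> X i\<bar> \<le> 2 * \<lceil>h\<rceil> * y \<and> \<bar>2 * \<sigma> Y2 i - \<sigma> X i\<bar> \<le> 2 * \<lceil>h\<rceil> * y)"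
    unfolding \<sigma>_def by (rule split_multiset[OF h y _ X(2)]) (use a X(1) in auto)
  then obtain Y1 Y2 where Y: "X = Y1 + Y2" "real (size Y1) \<le> (6 / 5) ^ k" "real (size Y2) \<le> (6 / 5) ^ k"
    "\<And>i. i < m \<Longrightarrow> \<bar>2 * \<sigma> Y1 i - \<sigma> X i\<bar> \<le> 2 * \<lceil>h\<rceil> * y" "\<And>i. i < m \<Longrightarrow> \<bar>2 * \<sigma> Y2 i - \<sigma> X i\<bar> \<le> 2 * \<lceil>h\<rceil> * y" by blast
  have key: "\<bar>2 * p * (\<sigma> Z i mod md i) - tau i\<bar> \<le> 2 * p * hh i"
    if i: "i < w" and Z: "\<And>i. i < m \<Longrightarrow> \<bar>2 * \<sigma> Z i - \<sigma> X i\<bar> \<le> 2 * \<lceil>h\<rceil> * y" for Z i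
  proof (cases "i < m")
    case True
    define H where "H = 2 * \<lceil>h\<rceil> * y"
    have "\<bar>p * (\<sigma> X i mod md i) - tau i\<bar> \<le> p * hh i" using box[rule_format, OF i] unfolding \<sigma>_def .
    then have 1: "\<bar>p * \<sigma> X i - tau i\<bar> \<le> p * H" using md(1)[OF True] hh[OF i] True by (simp add: H_def)
    have 2: "\<bar>p * (2 * \<sigma> Z i - \<sigma> X i)\<bar> \<le> p * H" unfolding abs_mult H_def using X(3) Z[OF True] by simp
    have "2 * p * \<sigma> Z i - tau i = p * (2 * \<sigma> Z i - \<sigma> X i) + (p * \<sigma> X i - tau i)" by (simp add: algebra_simps)
    then have "\<bar>2 * p * \<sigma> Z i - tau i\<bar> \<le> p * H + p * H" using 1 2 by linarith
    then show ?thesis using True md(1) hh i by (simp add: H_def algebra_simps)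
  next
    case False
    have m: "0 < md i" "0 \<le> tau i" "tau i < md i" using md(2)[of i] False i by auto
    have u: "0 \<le> \<sigma> Z i mod md i" "\<sigma> Z i mod md i < md i" using m by auto
    have "0 \<le> 2 * p * (\<sigma> Z i mod md i)" "2 * p * (\<sigma> Z i mod md i) \<le> 2 * p * md i" using u X(3) by auto
    moreover have "1 * md i \<le> 2 * p * md i" using X(3) m by (intro mult_right_mono) auto
    ultimately have "\<bar>2 * p * (\<sigma> Z i mod md i) - tau i\<bar> \<le> 2 * p * md i" using m by linarith
    then show ?thesis using hh[OF i] False by simp
  qed
  show ?thesis using Y(1-3) key[OF _ Y(4)] key[OF _ Y(5)] unfolding \<sigma>_def by blast
qed

section \<open>The integer program\<close>

lemma abs_le_two_power_bitlen: "\<bar>v\<bar> \<le> 2 ^ nat (bitlen \<bar>v\<bar>)"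
  using bitlen_bounds[of "\<bar>v\<bar>"] by (cases "v = 0") (auto simp: less_imp_le)

lemma entry_le_two_power_bits:
  assumes "(x, xs) \<in> set inp" "v \<in> set xs"
  shows "\<bar>v\<bar> \<le> 2 ^ input_bits inp"
proof -
  have "1 + nat (bitlen \<bar>v\<bar>) \<le> (\<Sum>v\<leftarrow>xs. 1 + nat (bitlen \<bar>v\<bar>))"
    by (rule member_le_sum_list) (use assms(2) in auto)
  also have "\<dots> \<le> input_bits inp" unfolding input_bits_def
    by (rule member_le_sum_list) (use assms(1) in \<open>force+\<close>)
  finally have "(2::int) ^ nat (bitlen \<bar>v\<bar>) \<le> 2 ^ input_bits inp" by (intro power_increasing) auto
  then show ?thesis using abs_le_two_power_bitlen[of v] by linarith
qed

lemma length_le_sum_bits: "length xs \<le> (\<Sum>v\<leftarrow>xs. 1 + nat (bitlen \<bar>v\<bar>))" for xs :: "int list"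
  by (induction xs) auto

lemma input_length_le_bits: "input_length inp \<le> input_bits inp"
  unfolding input_length_def input_bits_def
  by (rule sum_list_mono) (use length_le_sum_bits in auto)

lemma initial_store_row_major:
  assumes "map_of inp x = Some (row_major M)" "M \<in> carrier_mat r k" "i < r" "j < k"
  shows "initial_store inp x (ix k i j) = M $$ (i, j)"
proof -
  have "nat (ix k i j) = i * k + j" by (simp add: ix_def nat_add_distrib nat_mult_distrib)
  moreover have "0 \<le> ix k i j" "ix k i j < int (length (row_major M))"
    using ix_bounds[OF assms(3,4)] assms(2) by (auto simp: length_row_major)
  ultimately show ?thesis using assms nth_row_major[of i M j]
    by (simp add: initial_store_def)
qed

lemma initial_store_list_of_vec:
  assumes "map_of inp x = Some (list_of_vec v)" "i < dim_vec v"
  shows "initial_store inp x (int i) = v $ i"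
  using assms by (simp add: initial_store_def list_of_vec_index)

lemma two_power_mult: "0 \<le> x \<Longrightarrow> x \<le> 2 ^ a \<Longrightarrow> 0 \<le> y \<Longrightarrow> y \<le> 2 ^ b \<Longrightarrow> x * y \<le> (2 ^ (a + b) :: int)"
  unfolding power_add by (rule mult_mono) auto

lemma two_power_add: "x \<le> 2 ^ a \<Longrightarrow> y \<le> 2 ^ b \<Longrightarrow> x + y \<le> (2 ^ (max a b + 1) :: int)"
proof -
  assume "x \<le> 2 ^ a" "y \<le> 2 ^ b"
  moreover have "(2::int) ^ a \<le> 2 ^ max a b" "(2::int) ^ b \<le> 2 ^ max a b" by (intro power_increasing; simp)+
  ultimately show ?thesis unfolding power_add power_one_right by linarith
qed

lemma two_power_power: "0 \<le> x \<Longrightarrow> x \<le> 2 ^ a \<Longrightarrow> x ^ k \<le> (2 ^ (a * k) :: int)"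
  unfolding power_mult by (rule power_mono)

locale ip =
  fixes h :: real and m n :: nat and A G S :: "int mat" and g b c :: "int vec" and \<rho> :: nat and J :: "nat set"
  assumes disc: "discrepancy_bound m h" and m0: "0 < m" and mn: "m \<le> n"
    and A: "A \<in> carrier_mat m n" and G: "G \<in> carrier_mat (n - m) n" and S: "S \<in> carrier_mat (n - m) (n - m)"
    and snf: "smith_normal_form S" and g: "g \<in> carrier_vec (n - m)" and b: "b \<in> carrier_vec m"
    and c: "c \<in> carrier_vec n" "\<forall>j<n. 0 \<le> c $ j" and \<rho>0: "0 < \<rho>"
    and opt: "\<exists>z. optimal_solution A G S g b c z \<and> real_of_int (\<Sum>j<n. \<bar>z $ j\<bar>) \<le> (6 / 5) ^ \<rho>"
    and J: "J \<subseteq> {..<n}" "card J = m" and B: "det (submatrix A UNIV J) \<noteq> 0"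
begin

abbreviation "inp \<equiv> problem_input m n A G S g b c \<rho> J h"

definition "s0 = initial_store inp"
definition "N = input_bits inp + \<rho>"
definition "jl i = sorted_list_of_set J ! i"
text \<open>Carrying the right-hand side as an extra column lets one invariant describe the arrays
  \<open>A\<close> and \<open>b\<close> together.\<close>

definition "Ab = mat m (Suc n) (\<lambda>(i, j). if j < n then A $$ (i, j) else b $ i)"

lemma h_ge_1: "1 \<le> h" by (rule discrepancy_bound_ge_1[OF disc m0])

lemma finite_J: "finite J" using J(1) finite_subset by auto

lemma len_jl: "length (sorted_list_of_set J) = m" using J finite_J by simp

lemma jl_bij: "bij_betw jl {..<m} J"
proof -
  have "bij_betw (\<lambda>i. sorted_list_of_set J ! i) {..<length (sorted_list_of_set J)} (set (sorted_list_of_set J))"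
    by (rule bij_betw_nth) simp_all
  then show ?thesis using len_jl finite_J by (simp add: jl_def[abs_def])
qed

lemma jl_less: "i < m \<Longrightarrow> jl i < n"
  using jl_bij J(1) by (auto simp: bij_betw_def)

lemma Ab: "Ab \<in> carrier_mat m (Suc n)" by (simp add: Ab_def)

lemma select_Ab: "(\<And>j. j < m \<Longrightarrow> f j < n) \<Longrightarrow> select_cols Ab f = select_cols A f"
  using A by (intro eq_matI) (auto simp: select_cols_def Ab_def less_SucI)

lemma det_jl: "det (select_cols Ab jl) \<noteq> 0"
  using abs_det_select_cols_bij[OF A J(1) jl_bij] B select_Ab[of jl] jl_less by simp

text \<open>A and G together have n rows of length n. Costs of order \<open>n * n\<close> are
  therefore linear in the input.\<close>

lemma square_le_input_length: "n * n \<le> input_length inp"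
proof -
  have "m * n + (n - m) * n \<le> input_length inp"
    using A G by (simp add: input_length_def problem_input_def length_row_major)
  then show ?thesis using mn by (simp flip: add_mult_distrib)
qed

lemma n_le_N: "n \<le> N" "n * n \<le> N" "\<rho> \<le> N" "1 \<le> N" "m \<le> N"
proof -
  show "n * n \<le> N" using square_le_input_length input_length_le_bits[of inp] by (simp add: N_def)
  then show "n \<le> N" by (cases n) auto
  then show "m \<le> N" using mn by simp
  show "\<rho> \<le> N" "1 \<le> N" using \<rho>0 by (auto simp: N_def)
qed

lemma entry: "(x, xs) \<in> set inp \<Longrightarrow> v \<in> set xs \<Longrightarrow> \<bar>v\<bar> \<le> 2 ^ N"
proof -
  assume "(x, xs) \<in> set inp" "v \<in> set xs"
  then have "\<bar>v\<bar> \<le> 2 ^ input_bits inp" by (rule entry_le_two_power_bits)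
  also have "\<dots> \<le> (2::int) ^ N" by (intro power_increasing) (auto simp: N_def)
  finally show ?thesis .
qed

lemma entries:
  "i < m \<Longrightarrow> j < n \<Longrightarrow> \<bar>A $$ (i, j)\<bar> \<le> 2 ^ N" "i < n - m \<Longrightarrow> j < n \<Longrightarrow> \<bar>G $$ (i, j)\<bar> \<le> 2 ^ N"
  "i < n - m \<Longrightarrow> j < n - m \<Longrightarrow> \<bar>S $$ (i, j)\<bar> \<le> 2 ^ N" "i < n - m \<Longrightarrow> \<bar>g $ i\<bar> \<le> 2 ^ N" "i < m \<Longrightarrow> \<bar>b $ i\<bar> \<le> 2 ^ N"
  "j < n \<Longrightarrow> \<bar>c $ j\<bar> \<le> 2 ^ N" "\<bar>\<lceil>h\<rceil>\<bar> \<le> 2 ^ N"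
proof -
  have mat: "\<bar>X $$ (i, j)\<bar> \<le> 2 ^ N" if "(x, row_major X) \<in> set inp" "X \<in> carrier_mat k l" "i < k" "j < l" for x X k l i j
    by (rule entry[OF that(1)]) (unfold set_row_major, rule elements_matI[OF that(2-4) refl])
  have vec: "\<bar>v $ i\<bar> \<le> 2 ^ N" if "(x, list_of_vec v) \<in> set inp" "v \<in> carrier_vec k" "i < k" for x v k i
    by (rule entry[OF that(1)]) (use that(2,3) in \<open>auto simp: in_set_conv_nth list_of_vec_index intro!: exI[of _ i]\<close>)
  show "i < m \<Longrightarrow> j < n \<Longrightarrow> \<bar>A $$ (i, j)\<bar> \<le> 2 ^ N"
    by (rule mat[OF _ A, of "''A''"]) (simp_all add: problem_input_def)
  show "i < n - m \<Longrightarrow> j < n \<Longrightarrow> \<bar>G $$ (i, j)\<bar> \<le> 2 ^ N"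
    by (rule mat[OF _ G, of "''G''"]) (simp_all add: problem_input_def)
  show "i < n - m \<Longrightarrow> j < n - m \<Longrightarrow> \<bar>S $$ (i, j)\<bar> \<le> 2 ^ N"
    by (rule mat[OF _ S, of "''S''"]) (simp_all add: problem_input_def)
  show "i < n - m \<Longrightarrow> \<bar>g $ i\<bar> \<le> 2 ^ N" by (rule vec[OF _ g, of "''g''"]) (simp_all add: problem_input_def)
  show "i < m \<Longrightarrow> \<bar>b $ i\<bar> \<le> 2 ^ N" by (rule vec[OF _ b, of "''b''"]) (simp_all add: problem_input_def)
  show "j < n \<Longrightarrow> \<bar>c $ j\<bar> \<le> 2 ^ N" by (rule vec[OF _ c(1), of "''c''"]) (simp_all add: problem_input_def)
  show "\<bar>\<lceil>h\<rceil>\<bar> \<le> 2 ^ N" by (rule entry[of "''eta''" "[\<lceil>h\<rceil>]"]) (simp_all add: problem_input_def)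
qed

lemma s0_simps:
  "s0 ''m'' 0 = int m" "s0 ''n'' 0 = int n" "s0 ''rho'' 0 = int \<rho>" "s0 ''eta'' 0 = \<lceil>h\<rceil>"
  "i < m \<Longrightarrow> j < n \<Longrightarrow> s0 ''A'' (ix n i j) = A $$ (i, j)"
  "l < n - m \<Longrightarrow> j < n \<Longrightarrow> s0 ''G'' (ix n l j) = G $$ (l, j)"
  "l < n - m \<Longrightarrow> k < n - m \<Longrightarrow> s0 ''S'' (ix (n - m) l k) = S $$ (l, k)"
  "s0 ''S'' (ix (n - m) (n - m) (n - m)) = 0"
  "l < n - m \<Longrightarrow> s0 ''g'' (int l) = g $ l" "i < m \<Longrightarrow> s0 ''b'' (int i) = b $ i" "j < n \<Longrightarrow> s0 ''c'' (int j) = c $ j"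
  "i < m \<Longrightarrow> s0 ''B'' (int i) = int (jl i)"
  "s0 ''u'' = (\<lambda>_. 0)" "s0 ''M'' = (\<lambda>_. 0)" "s0 ''V'' = (\<lambda>_. 0)" "s0 ''E'' = (\<lambda>_. 0)" "s0 ''T'' = (\<lambda>_. 0)"
proof -
  show "s0 ''m'' 0 = int m" "s0 ''n'' 0 = int n" "s0 ''rho'' 0 = int \<rho>" "s0 ''eta'' 0 = \<lceil>h\<rceil>"
    by (simp_all add: s0_def initial_store_def problem_input_def)
  show "s0 ''u'' = (\<lambda>_. 0)" "s0 ''M'' = (\<lambda>_. 0)" "s0 ''V'' = (\<lambda>_. 0)" "s0 ''E'' = (\<lambda>_. 0)" "s0 ''T'' = (\<lambda>_. 0)"
    by (simp_all add: s0_def initial_store_def problem_input_def fun_eq_iff)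
  show "s0 ''A'' (ix n i j) = A $$ (i, j)" if "i < m" "j < n"
    unfolding s0_def by (rule initial_store_row_major[OF _ A that]) (simp add: problem_input_def)
  show "s0 ''G'' (ix n l j) = G $$ (l, j)" if "l < n - m" "j < n"
    unfolding s0_def by (rule initial_store_row_major[OF _ G that]) (simp add: problem_input_def)
  show "s0 ''S'' (ix (n - m) l k) = S $$ (l, k)" if "l < n - m" "k < n - m"
    unfolding s0_def by (rule initial_store_row_major[OF _ S that]) (simp add: problem_input_def)
  show "s0 ''S'' (ix (n - m) (n - m) (n - m)) = 0"
  proof -
    have "map_of inp ''S'' = Some (row_major S)" by (simp add: problem_input_def)
    moreover have "\<not> ix (n - m) (n - m) (n - m) < int (length (row_major S))"
      using S by (simp add: length_row_major ix_def del: of_nat_diff)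
    ultimately show ?thesis by (simp add: s0_def initial_store_def)
  qed
  show "s0 ''g'' (int l) = g $ l" if "l < n - m"
    unfolding s0_def by (rule initial_store_list_of_vec) (use g that in \<open>auto simp: problem_input_def\<close>)
  show "s0 ''b'' (int i) = b $ i" if "i < m"
    unfolding s0_def by (rule initial_store_list_of_vec) (use b that in \<open>auto simp: problem_input_def\<close>)
  show "s0 ''c'' (int j) = c $ j" if "j < n"
    unfolding s0_def by (rule initial_store_list_of_vec) (use c that in \<open>auto simp: problem_input_def\<close>)
  show "s0 ''B'' (int i) = int (jl i)" if "i < m"
    using that len_jl by (simp add: s0_def initial_store_def problem_input_def jl_def)
qed

lemma S_pos: "l < n - m \<Longrightarrow> 0 < S $$ (l, l)"
  using snf S by (simp add: smith_normal_form_def)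

lemma S_offdiag: "l < n - m \<Longrightarrow> k < n - m \<Longrightarrow> l \<noteq> k \<Longrightarrow> S $$ (l, k) = 0"
  using snf S by (auto simp: smith_normal_form_def diagonal_mat_def)

text \<open>Divisibility of positive integers gives the order. Hence the divisors equal to 1 form an
  initial segment, and a single scan finds all of them.\<close>

lemma S_mono: "l \<le> k \<Longrightarrow> k < n - m \<Longrightarrow> S $$ (l, l) \<le> S $$ (k, k)"
proof (induction k rule: dec_induct)
  case (step k)
  have "S $$ (k, k) dvd S $$ (Suc k, Suc k)" using snf S step.prems by (auto simp: smith_normal_form_def)
  then have "S $$ (k, k) \<le> S $$ (Suc k, Suc k)" using S_pos[of "Suc k"] step.prems by (intro zdvd_imp_le) auto
  then show ?case using step by simp
qed simp

lemma det_S: "det S = (\<Prod>l<n - m. S $$ (l, l))"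
proof -
  have "det S = prod_list (diag_mat S)"
    by (rule det_upper_triangular[OF _ S]) (use S S_offdiag in auto)
  then show ?thesis using S by (simp add: prod_list_diag_prod atLeast0LessThan)
qed

lemma det_S_pos: "0 < det S" unfolding det_S by (rule prod_pos) (use S_pos in auto)

lemma max_minor_pos: "0 < max_minor A"
  using abs_det_select_cols_le_max_minor[OF A mn, of jl] jl_less det_jl select_Ab[of jl] by fastforce

end

section \<open>Bit lengths in terms of N\<close>

context ip begin

lemma D_le: "fact m * (2 ^ N) ^ m \<le> (2 ^ (2 * (N * N)) :: int)"
proof -
  have "(fact m :: int) \<le> of_nat (m ^ m)" by (rule fact_le_power)
  also have "\<dots> = int m ^ m" by simp
  also have "\<dots> \<le> (2 ^ N) ^ m"
  proof (rule power_mono)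
    have "m < 2 ^ N" using n_le_N(5) less_exp[of N] by (rule le_less_trans)
    then have "int m < int (2 ^ N)" by (simp only: of_nat_less_iff)
    then show "int m \<le> 2 ^ N" by simp
  qed simp
  finally have "fact m * (2 ^ N) ^ m \<le> (2 ^ N) ^ m * ((2 ^ N) ^ m :: int)" by (rule mult_right_mono) simp
  also have "\<dots> = 2 ^ (2 * (N * m))" by (simp add: mult_2 power_add flip: power_mult)
  also have "\<dots> \<le> 2 ^ (2 * (N * N))" using n_le_N(5) by (intro power_increasing) auto
  finally show ?thesis .
qed

lemma N_powers_mono: "N \<le> N * N" "N * N \<le> N * N * N" "1 \<le> N * N" "1 \<le> N * N * N"
  using n_le_N(4) by (auto simp: Suc_le_eq)

lemma le_two_power_mono: "x \<le> 2 ^ k \<Longrightarrow> k \<le> l \<Longrightarrow> x \<le> (2 ^ l :: int)"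
  by (rule order_trans) (auto intro: power_increasing)

lemma nat_le_two_power: "k \<le> N \<Longrightarrow> int k \<le> 2 ^ N"
proof -
  assume "k \<le> N"
  then have "k < 2 ^ N" using less_exp[of N] by (rule le_less_trans)
  then have "int k < int (2 ^ N)" by (simp only: of_nat_less_iff)
  then show ?thesis by simp
qed

lemma h_int: "1 \<le> \<lceil>h\<rceil>" using h_ge_1 by linarith

end

text \<open>The new parameters are what a run determines: the matrix M left by the elimination, the
  order f of its columns, the largest table entry H0 and the number q of dropped rows of G.\<close>

locale ip_tab = ip +
  fixes M :: "int mat" and f :: "nat \<Rightarrow> nat" and H0 :: int and q :: nat and W :: int
  assumes M: "M = select_cols A f" and f: "bij_betw f {..<m} J"
    and H0: "0 \<le> H0" "\<And>i j. i < m \<Longrightarrow> j < n \<Longrightarrow> \<bar>(adj_mat M * Ab) $$ (i, j)\<bar> \<le> H0"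
      "H0 = 0 \<or> (\<exists>i<m. \<exists>j<n. H0 = \<bar>(adj_mat M * Ab) $$ (i, j)\<bar>)"
    and q: "q \<le> n - m" "\<And>l. l < q \<Longrightarrow> S $$ (l, l) = 1" "q < n - m \<Longrightarrow> 1 < S $$ (q, q)"
    and W20: "2 ^ (20 * (N * N * N)) \<le> W"
begin

definition "w = n - q"
definition "Y i j = (adj_mat M * Ab) $$ (i, j)"
definition "H = 2 * \<lceil>h\<rceil> * H0"
definition "a j i = (if i < m then Y i j else G $$ (i - m + q, j))"
definition "md i = (if i < m then 0 else S $$ (i - m + q, i - m + q))"
definition "tau i = (if i < m then Y i n else g $ (i - m + q) mod md i)"
definition "hh i = (if i < m then H else md i)"
definition "r = (\<Sum>i<w. tau i * tau i + hh i)"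
definition "R = 4 * r + 1"
definition Qb :: int where "Qb = 2 ^ (\<rho> + 1) + 1"
definition "wt j = Qb ^ j + c $ j * Qb ^ n"
text \<open>Classes modulo \<open>det M\<close>, times grid points of one class in the box, times
  residues modulo S.\<close>

definition "Kmax = nat \<bar>det M\<bar> * (nat (2 * H div \<bar>det M\<bar>) + 1) ^ m * nat (det S)"
definition "\<beta> = 2 ^ N + r"
definition "Emax = 2 ^ (N + 1) * Qb ^ n"

lemma Mc: "M \<in> carrier_mat m m" using A by (simp add: M select_cols_def)

lemma fn: "i < m \<Longrightarrow> f i < n" using f J(1) by (auto simp: bij_betw_def)

lemma absdet: "\<bar>det M\<bar> = \<bar>det (submatrix A UNIV J)\<bar>"
  unfolding M by (rule abs_det_select_cols_bij[OF A J(1) f])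

lemma detM: "det M \<noteq> 0" using absdet B by simp

lemma mw: "m \<le> w" "w \<le> n" "w - m = n - m - q" using q(1) mn by (auto simp: w_def)

lemma idx: "m \<le> i \<Longrightarrow> i < w \<Longrightarrow> i - m + q < n - m" using q(1) by (auto simp: w_def)

lemma md_pos: "m \<le> i \<Longrightarrow> i < w \<Longrightarrow> 1 < md i"
proof -
  assume i: "m \<le> i" "i < w"
  then have "1 < S $$ (q, q)" using q(3) idx[OF i] by simp
  also have "\<dots> \<le> S $$ (i - m + q, i - m + q)" using idx[OF i] by (intro S_mono) auto
  finally show ?thesis using i by (simp add: md_def)
qed

lemma detS_md: "det S = (\<Prod>i=m..<w. md i)"
proof -
  have "(\<Prod>l<n - m. S $$ (l, l)) = (\<Prod>l=q..<n - m. S $$ (l, l))"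
    by (rule prod.mono_neutral_right) (use q in auto)
  also have "\<dots> = (\<Prod>i=m..<w. md i)"
    by (rule prod.reindex_bij_witness[of _ "\<lambda>i. i - m + q" "\<lambda>l. l - q + m"]) (use q mn in \<open>auto simp: w_def md_def\<close>)
  finally show ?thesis by (simp add: det_S)
qed

text \<open>Every remaining divisor is at least 2. This limits their number by the logarithm of
  \<open>det S\<close> and is the source of the logarithmic factor in the running time.\<close>

lemma two_pow_le_detS: "2 ^ (w - m) \<le> det S"
proof -
  have "(\<Prod>i=m..<w. (2::int)) \<le> (\<Prod>i=m..<w. md i)"
    by (rule prod_mono) (use md_pos in \<open>force simp: less_imp_le\<close>)
  then show ?thesis by (simp add: detS_md)
qed

lemma Y_det: "i < m \<Longrightarrow> j \<le> n \<Longrightarrow> Y i j = det (replace_col M (col Ab j) i)"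
  by (simp add: Y_def adj_mat_mult_index[OF Mc Ab])

text \<open>Replacing one column of M by a column of A yields another selection of columns of A,
  whose determinant is bounded by \<Delta>. The right-hand side, column n, is excluded because no
  such bound holds for it.\<close>

lemma Y_le_max_minor: assumes "i < m" "j < n" shows "\<bar>Y i j\<bar> \<le> max_minor A"
proof -
  have "replace_col M (col Ab j) i = select_cols A (f(i := j))"
    using assms A fn by (intro eq_matI) (auto simp: replace_col_def M select_cols_def Ab_def)
  then show ?thesis using Y_det[OF assms(1)] assms fn
    by (simp add: abs_det_select_cols_le_max_minor[OF A mn])
qed

lemma H0_le: "H0 \<le> max_minor A"
  using H0(3) Y_le_max_minor max_minor_pos unfolding Y_def by fastforce

lemma Ab_le: "i < m \<Longrightarrow> j < Suc n \<Longrightarrow> \<bar>Ab $$ (i, j)\<bar> \<le> 2 ^ N"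
  using entries(1,5) by (auto simp: Ab_def)

lemma M_le: "i < m \<Longrightarrow> j < m \<Longrightarrow> \<bar>M $$ (i, j)\<bar> \<le> 2 ^ N"
  using entries(1) fn A by (auto simp: M select_cols_def)

lemma Y_le: assumes "i < m" "j \<le> n" shows "\<bar>Y i j\<bar> \<le> 2 ^ (2 * (N * N))"
proof -
  have "\<bar>Y i j\<bar> \<le> fact m * (2 ^ N) ^ m" unfolding Y_det[OF assms]
    by (rule abs_det_le) (use assms Mc Ab Ab_le M_le in \<open>auto simp: replace_col_def\<close>)
  then show ?thesis using D_le by linarith
qed

lemma detM_le: "\<bar>det M\<bar> \<le> 2 ^ (2 * (N * N))"
  using abs_det_le[OF Mc M_le] D_le by linarith

lemma le_W: "x \<le> 2 ^ k \<Longrightarrow> k \<le> 20 * (N * N * N) \<Longrightarrow> x \<le> W"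
  using le_two_power_mono[of x k "20 * (N * N * N)"] W20 by linarith

lemma H_bounds: "0 \<le> H" "H0 \<le> H" "H \<le> 2 ^ (4 * (N * N))"
proof -
  show "0 \<le> H" using H0(1) h_int by (simp add: H_def)
  have "1 \<le> 2 * \<lceil>h\<rceil>" using h_int by linarith
  then have "1 * H0 \<le> 2 * \<lceil>h\<rceil> * H0" using H0(1) by (rule mult_right_mono)
  then show "H0 \<le> H" by (simp add: H_def)
  have "H0 \<le> 2 ^ (2 * (N * N))" using H0(3) Y_le unfolding Y_def by fastforce
  moreover have "2 * \<lceil>h\<rceil> \<le> 2 ^ (1 + N)" using entries(7) h_int by simp
  ultimately have "H \<le> 2 ^ (1 + N + 2 * (N * N))" unfolding H_def
    using H0(1) h_int by (intro two_power_mult) auto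
  then show "H \<le> 2 ^ (4 * (N * N))" by (rule le_two_power_mono) (use N_powers_mono in linarith)
qed

lemma md_bounds: "i < w \<Longrightarrow> 0 \<le> md i" "i < w \<Longrightarrow> md i \<le> 2 ^ N"
proof -
  show "i < w \<Longrightarrow> 0 \<le> md i" using md_pos[of i] by (cases "i < m") (auto simp: md_def)
  show "i < w \<Longrightarrow> md i \<le> 2 ^ N" using entries(3)[of "i - m + q" "i - m + q"] idx[of i] by (auto simp: md_def)
qed

lemma md_mod: "m \<le> i \<Longrightarrow> i < w \<Longrightarrow> 0 \<le> tau i \<and> tau i < md i"
  using md_pos[of i] by (simp add: tau_def)

lemma tau_le: "i < w \<Longrightarrow> \<bar>tau i\<bar> \<le> 2 ^ (2 * (N * N))"
proof (cases "i < m")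
  case True
  then show ?thesis using Y_le[of i n] by (simp add: tau_def)
next
  case False
  assume i: "i < w"
  have "\<bar>tau i\<bar> \<le> 2 ^ N" using md_mod[of i] md_bounds(2)[of i] False i by simp
  then show ?thesis by (rule le_two_power_mono) (use N_powers_mono in linarith)
qed

lemma hh_bounds: "i < w \<Longrightarrow> 0 \<le> hh i" "i < w \<Longrightarrow> hh i \<le> 2 ^ (4 * (N * N))"
proof -
  show "i < w \<Longrightarrow> 0 \<le> hh i" using H_bounds md_bounds by (simp add: hh_def)
  have "i < w \<Longrightarrow> md i \<le> 2 ^ (4 * (N * N))" by (rule le_two_power_mono[OF md_bounds(2)]) (use N_powers_mono in linarith)+
  then show "i < w \<Longrightarrow> hh i \<le> 2 ^ (4 * (N * N))" using H_bounds by (simp add: hh_def)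
qed

lemma term_bounds: assumes "i < w" shows "0 \<le> tau i * tau i + hh i" "tau i * tau i + hh i \<le> 2 ^ (4 * (N * N) + 1)"
  "tau i * tau i + hh i \<le> r"
proof -
  have nn: "0 \<le> tau i * tau i + hh i" if "i < w" for i using hh_bounds(1)[OF that] by simp
  then show "0 \<le> tau i * tau i + hh i" using assms by simp
  have "\<bar>tau i\<bar> * \<bar>tau i\<bar> \<le> 2 ^ (2 * (N * N) + 2 * (N * N))" using tau_le[OF assms] by (intro two_power_mult) auto
  then have "tau i * tau i \<le> 2 ^ (4 * (N * N))" by (simp add: mult_2[symmetric] flip: power_add)
  then show "tau i * tau i + hh i \<le> 2 ^ (4 * (N * N) + 1)" using hh_bounds(2)[OF assms] by simp
  show "tau i * tau i + hh i \<le> r" unfolding r_def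
    by (rule member_le_sum) (use assms nn in auto)
qed

lemma r_bounds: "0 \<le> r" "r \<le> 2 ^ (6 * (N * N))"
proof -
  show "0 \<le> r" unfolding r_def by (rule sum_nonneg) (use term_bounds(1) in auto)
  have "r \<le> (\<Sum>i<w. 2 ^ (4 * (N * N) + 1))" unfolding r_def by (rule sum_mono) (use term_bounds(2) in auto)
  also have "\<dots> = int w * 2 ^ (4 * (N * N) + 1)" by simp
  also have "\<dots> \<le> 2 ^ (N + (4 * (N * N) + 1))"
    by (rule two_power_mult) (use nat_le_two_power[of w] mw n_le_N in auto)
  finally show "r \<le> 2 ^ (6 * (N * N))" by (rule le_two_power_mono) (use N_powers_mono in linarith)
qed

lemma tau_hh_r: "i < w \<Longrightarrow> \<bar>tau i\<bar> + hh i \<le> r"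
proof -
  assume i: "i < w"
  have "\<bar>tau i\<bar> \<le> tau i * tau i"
  proof (cases "tau i = 0")
    case False
    then have "\<bar>tau i\<bar> * 1 \<le> \<bar>tau i\<bar> * \<bar>tau i\<bar>" by (intro mult_left_mono) auto
    then show ?thesis by simp
  qed simp
  then show ?thesis using term_bounds(3)[OF i] by linarith
qed

lemma Qb_bounds: "1 \<le> Qb" "Qb \<le> 2 ^ (3 * N)" "Qb ^ n \<le> 2 ^ (3 * (N * N))" "Qb ^ (n + 1) \<le> 2 ^ (6 * (N * N))"
proof -
  show Q1: "1 \<le> Qb" by (simp add: Qb_def)
  have e: "Qb = 2 * 2 ^ \<rho> + 1" "2 ^ (\<rho> + 2) = (4 * 2 ^ \<rho> :: int)" by (simp_all add: Qb_def power_add)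
  have "(1::int) \<le> 2 ^ \<rho>" by simp
  then have "Qb \<le> 2 ^ (\<rho> + 2)" unfolding e by linarith
  then show Q: "Qb \<le> 2 ^ (3 * N)" by (rule le_two_power_mono) (use n_le_N in linarith)
  have e: "Qb ^ k \<le> 2 ^ (3 * N * k)" for k using Q1 Q by (intro two_power_power) auto
  show "Qb ^ n \<le> 2 ^ (3 * (N * N))" by (rule le_two_power_mono[OF e]) (use n_le_N in simp)
  show "Qb ^ (n + 1) \<le> 2 ^ (6 * (N * N))"
    by (rule le_two_power_mono[OF e]) (use mult_left_mono[of "n + 1" "2 * N" "3 * N"] n_le_N in simp)
qed

lemma Emax_le: "0 \<le> Emax" "2 ^ (\<rho> + 2) * (Emax + 1) \<le> 2 ^ (9 * (N * N))"
proof -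
  show E0: "0 \<le> Emax" using Qb_bounds by (simp add: Emax_def)
  have "Emax \<le> 2 ^ ((N + 1) + 3 * (N * N))" unfolding Emax_def using Qb_bounds by (intro two_power_mult) auto
  then have "Emax + 1 \<le> 2 ^ (N + 2 + 3 * (N * N))"
    using one_le_power[of "2::int" "N + 1 + 3 * (N * N)"] by (simp add: power_add)
  then have "2 ^ (\<rho> + 2) * (Emax + 1) \<le> 2 ^ ((\<rho> + 2) + (N + 2 + 3 * (N * N)))"
    using E0 by (intro two_power_mult) auto
  then show "2 ^ (\<rho> + 2) * (Emax + 1) \<le> 2 ^ (9 * (N * N))" by (rule le_two_power_mono) (use N_powers_mono n_le_N in linarith)
qed

lemma wt_bounds: "j < n \<Longrightarrow> 0 \<le> wt j \<and> wt j \<le> Emax"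
proof -
  assume j: "j < n"
  have "Qb ^ j \<le> Qb ^ n" using j Qb_bounds by (intro power_increasing) auto
  moreover have "c $ j * Qb ^ n \<le> 2 ^ N * Qb ^ n" using entries(6)[OF j] Qb_bounds by (intro mult_right_mono) auto
  moreover have "1 * Qb ^ n \<le> 2 ^ N * Qb ^ n" using Qb_bounds by (intro mult_right_mono) auto
  ultimately have "wt j \<le> Emax" by (simp add: wt_def Emax_def)
  moreover have "0 \<le> wt j" using c(2) j Qb_bounds by (simp add: wt_def)
  ultimately show ?thesis by simp
qed

lemma detS_le: "det S \<le> 2 ^ (N * N)"
proof -
  have "det S \<le> (\<Prod>l<n - m. 2 ^ N)" unfolding det_S
    by (rule prod_mono) (use entries(3) S_pos in \<open>force simp: less_imp_le\<close>)
  also have "\<dots> = 2 ^ (N * (n - m))" by (simp add: power_mult)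
  finally show ?thesis by (rule le_two_power_mono) (use n_le_N in simp)
qed

lemma Kmax_pos: "1 \<le> Kmax"
  using detM det_S_pos by (simp add: Kmax_def Suc_le_eq)

text \<open>The m-th power of a box width with O(N^2) bits is one of the reasons why bit lengths
  reach the order of N^3.\<close>

lemma Kmax_le: "int Kmax \<le> 2 ^ (9 * (N * N * N))"
proof -
  define D where "D = 2 * H div \<bar>det M\<bar>"
  have D: "0 \<le> D" "D \<le> 2 * H"
  proof -
    show "0 \<le> D" using H_bounds detM by (simp add: D_def pos_imp_zdiv_nonneg_iff)
    have "2 * H div \<bar>det M\<bar> \<le> 2 * H div 1" using H_bounds detM by (intro zdiv_mono2) auto
    then show "D \<le> 2 * H" by (simp add: D_def)
  qed
  have K: "int Kmax = \<bar>det M\<bar> * (D + 1) ^ m * det S"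
    using D(1) det_S_pos by (simp add: Kmax_def D_def add.commute)
  have "2 ^ (4 * (N * N) + 2) = (4 * 2 ^ (4 * (N * N)) :: int)" by (simp add: power_add)
  moreover have "(1::int) \<le> 2 ^ (4 * (N * N))" by simp
  ultimately have "D + 1 \<le> 2 ^ (4 * (N * N) + 2)" using D H_bounds(3) by linarith
  then have "D + 1 \<le> 2 ^ (6 * (N * N))" by (rule le_two_power_mono) (use N_powers_mono in linarith)
  then have "(D + 1) ^ m \<le> 2 ^ (6 * (N * N) * m)" using D by (intro two_power_power) auto
  then have "(D + 1) ^ m \<le> 2 ^ (6 * (N * N * N))" by (rule le_two_power_mono) (use n_le_N in simp)
  then have "int Kmax \<le> 2 ^ (2 * (N * N) + 6 * (N * N * N) + N * N)" unfolding K
    using detM_le D detS_le det_S_pos by (intro two_power_mult) auto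
  then show ?thesis by (rule le_two_power_mono) (use N_powers_mono in linarith)
qed

lemma cells_le: "int ((n + 4 + (\<rho> + 1) * Kmax) * (w + 1)) \<le> 2 ^ (19 * (N * N * N))"
proof -
  have N2: "int (n + 4) \<le> 2 ^ (N + 3)"
  proof -
    have "int n \<le> 2 ^ N" using nat_le_two_power n_le_N by simp
    moreover have "(1::int) \<le> 2 ^ N" by simp
    moreover have "2 ^ (N + 3) = (8 * 2 ^ N :: int)" by (simp add: power_add)
    ultimately show ?thesis by linarith
  qed
  have \<rho>1: "int (\<rho> + 1) \<le> 2 ^ (N + 1)" and w1: "int (w + 1) \<le> 2 ^ (N + 1)"
  proof -
    have "2 ^ (N + 1) = (2 * 2 ^ N :: int)" "(1::int) \<le> 2 ^ N" by simp_all
    moreover have "int \<rho> \<le> 2 ^ N" "int w \<le> 2 ^ N" using nat_le_two_power n_le_N mw by auto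
    ultimately show "int (\<rho> + 1) \<le> 2 ^ (N + 1)" "int (w + 1) \<le> 2 ^ (N + 1)" by linarith+
  qed
  have "int (\<rho> + 1) * int Kmax \<le> 2 ^ (N + 1 + 9 * (N * N * N))" using \<rho>1 Kmax_le by (intro two_power_mult) auto
  then have "int (n + 4) + int (\<rho> + 1) * int Kmax \<le> 2 ^ (max (N + 3) (N + 1 + 9 * (N * N * N)) + 1)"
    by (rule two_power_add[OF N2])
  then have "int (n + 4) + int (\<rho> + 1) * int Kmax \<le> 2 ^ (N + 4 + 9 * (N * N * N))" by (rule le_two_power_mono) simp
  then have "(int (n + 4) + int (\<rho> + 1) * int Kmax) * int (w + 1) \<le> 2 ^ ((N + 4 + 9 * (N * N * N)) + (N + 1))"
    using w1 by (intro two_power_mult) auto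
  then have "(int (n + 4) + int (\<rho> + 1) * int Kmax) * int (w + 1) \<le> 2 ^ (19 * (N * N * N))"
    by (rule le_two_power_mono) (use N_powers_mono in linarith)
  then show ?thesis by (simp only: of_nat_add of_nat_mult)
qed

sublocale dp W n w \<rho> Kmax a wt md tau hh R r \<beta> Emax
proof
  fix i assume i: "i < w"
  have "0 \<le> \<bar>tau i\<bar> + hh i" using hh_bounds(1)[OF i] by simp
  then have r0: "0 \<le> r" "hh i \<le> r" using tau_hh_r[OF i] by linarith+
  show "0 \<le> md i \<and> md i \<le> r" using md_bounds[OF i] r0 by (auto simp: hh_def md_def)
  show "0 \<le> hh i" by (rule hh_bounds(1)[OF i])
  show "\<bar>tau i\<bar> + hh i \<le> r" by (rule tau_hh_r[OF i])
  fix j assume j: "j < n"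
  have small: "\<bar>a j i\<bar> \<le> r" if "i < m"
    using H0(2)[OF that j] H_bounds(2) r0 that by (simp add: a_def Y_def hh_def)
  then show "\<bar>a j i\<bar> \<le> r" if "md i = 0" using that md_pos[of i] i by (cases "i < m") auto
  show "\<bar>a j i\<bar> \<le> \<beta>"
  proof (cases "i < m")
    case True
    moreover have "(0::int) \<le> 2 ^ N" by simp
    ultimately show ?thesis using small unfolding \<beta>_def by linarith
  next
    case False
    then have "\<bar>a j i\<bar> \<le> 2 ^ N" using entries(2)[OF idx[of i] j] i by (simp add: a_def)
    then show ?thesis using r0 unfolding \<beta>_def by linarith
  qed
next
  show "2 * r < R" "0 \<le> r" "r \<le> \<beta>" using r_bounds(1) by (auto simp: R_def \<beta>_def)
  show "0 \<le> Emax" by (rule Emax_le)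
  show "1 \<le> Kmax" by (rule Kmax_pos)
  show "(R + 1) ^ w \<le> W"
  proof -
    have "2 ^ (6 * (N * N) + 3) = (8 * 2 ^ (6 * (N * N)) :: int)" by (simp add: power_add)
    moreover have "(1::int) \<le> 2 ^ (6 * (N * N))" by simp
    ultimately have "R + 1 \<le> 2 ^ (6 * (N * N) + 3)" using r_bounds unfolding R_def by linarith
    then have "R + 1 \<le> 2 ^ (9 * (N * N))" by (rule le_two_power_mono) (use N_powers_mono in linarith)
    then have "(R + 1) ^ w \<le> 2 ^ (9 * (N * N) * w)" using r_bounds by (intro two_power_power) (auto simp: R_def)
    then show ?thesis by (rule le_W) (use n_le_N mw mult_left_mono[of w N "9 * (N * N)"] in simp)
  qed
  show "2 * \<beta> \<le> W"
  proof -
    have "\<beta> \<le> 2 ^ (max N (6 * (N * N)) + 1)" unfolding \<beta>_def by (rule two_power_add) (use r_bounds in auto)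
    then have "2 * \<beta> \<le> 2 ^ (max N (6 * (N * N)) + 2)" by simp
    moreover have "max N (6 * (N * N)) \<le> 6 * (N * N)" using N_powers_mono by simp
    then have "max N (6 * (N * N)) + 2 \<le> 20 * (N * N * N)" using N_powers_mono by linarith
    ultimately show ?thesis by (rule le_W)
  qed
  show "2 ^ (\<rho> + 2) * (Emax + 1) \<le> W" by (rule le_W[OF Emax_le(2)]) (use N_powers_mono in linarith)
  show "int ((n + 4 + (\<rho> + 1) * Kmax) * (w + 1)) \<le> W" by (rule le_W[OF cells_le]) simp
qed (use wt_bounds in auto)

end

section \<open>States, feasible points and the optimum\<close>

context ip_tab begin

lemma Y_A: "i < m \<Longrightarrow> j < n \<Longrightarrow> Y i j = (adj_mat M * A) $$ (i, j)"
proof -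
  assume ij: "i < m" "j < n"
  have "col Ab j = col A j" using A ij by (intro eq_vecI) (auto simp: Ab_def)
  then show ?thesis using Y_det[of i j] adj_mat_mult_index[OF Mc A ij] ij by simp
qed

lemma Y_b: "i < m \<Longrightarrow> Y i n = (adj_mat M *\<^sub>v b) $ i"
proof -
  assume i: "i < m"
  have aM: "adj_mat M \<in> carrier_mat m m" using adj_mat[OF Mc] by auto
  have "col Ab n = b" using b by (intro eq_vecI) (auto simp: Ab_def)
  moreover have "Y i n = row (adj_mat M) i \<bullet> col Ab n" using i aM Ab by (simp add: Y_def)
  ultimately show ?thesis using i aM by simp
qed

lemma states_count: "0 < p \<Longrightarrow> finite (states p) \<and> card (states p) \<le> Kmax"
proof -
  assume p: "0 < p"
  let ?T = "{\<lambda>i\<in>{..<w}. (\<Sum>j\<in>#X. a j i) mod md i | X. set_mset X \<subseteq> {..<n} \<and>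
      (\<forall>i<m. \<bar>p * ((\<Sum>j\<in>#X. a j i) mod md i) - tau i\<bar> \<le> p * H)}"
  have T: "finite ?T \<and> card ?T \<le> nat \<bar>det M\<bar> * (nat (2 * H div \<bar>det M\<bar>) + 1) ^ m * (\<Prod>i=m..<w. nat (md i))"
  proof (rule card_states_le[OF Mc detM A mw(1) _ _ _ p])
    show "0 < md i" if "m \<le> i" "i < w" for i using md_pos[OF that] by simp
  qed (auto simp: a_def Y_A md_def)
  have "(\<Prod>i=m..<w. nat (md i)) = nat (det S)"
  proof -
    have "int (\<Prod>i=m..<w. nat (md i)) = (\<Prod>i=m..<w. md i)"
      unfolding of_nat_prod by (rule prod.cong) (use md_bounds(1) in auto)
    then show ?thesis unfolding detS_md by linarith
  qed
  moreover have "states p \<subseteq> ?T"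
  proof
    fix u assume "u \<in> states p"
    then obtain X where X: "u = (\<lambda>i\<in>{..<w}. st X i)" "set_mset X \<subseteq> {..<n}" "box p (st X)"
      unfolding states_def by blast
    have "\<bar>p * ((\<Sum>j\<in>#X. a j i) mod md i) - tau i\<bar> \<le> p * H" if "i < m" for i
    proof -
      have "i < w" using that mw(1) by simp
      then have "\<bar>p * st X i - tau i\<bar> \<le> p * hh i" using X(3) unfolding box_def by blast
      then have "\<bar>p * st X i - tau i\<bar> \<le> p * H" using that by (simp add: hh_def)
      then show ?thesis unfolding st_def .
    qed
    then show "u \<in> ?T" using X(1,2) unfolding st_def by blast
  qed
  ultimately show ?thesis using T card_mono[of ?T "states p"] finite_subset[of "states p" ?T] by (auto simp: Kmax_def)
qed

lemma split_states:
  assumes X: "set_mset X \<subseteq> {..<n}" "real (size X) \<le> (6 / 5) ^ Suc k" "0 < p" "box p (st X)"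
  shows "\<exists>Y1 Y2. X = Y1 + Y2 \<and> real (size Y1) \<le> (6 / 5) ^ k \<and> real (size Y2) \<le> (6 / 5) ^ k \<and>
    box (2 * p) (st Y1) \<and> box (2 * p) (st Y2)"
  unfolding box_def st_def
proof (rule split_in_box[OF disc h_ge_1 H0(1), where n = n])
  show "\<And>i j. i < m \<Longrightarrow> j < n \<Longrightarrow> \<bar>a j i\<bar> \<le> H0" using H0(2) by (simp add: a_def Y_def)
  show "\<And>i. i < m \<Longrightarrow> md i = 0" by (simp add: md_def)
  show "\<And>i. m \<le> i \<Longrightarrow> i < w \<Longrightarrow> 0 < md i \<and> 0 \<le> tau i \<and> tau i < md i" using md_pos md_mod by force
  show "\<And>i. i < w \<Longrightarrow> hh i = (if i < m then 2 * \<lceil>h\<rceil> * H0 else md i)" by (simp add: hh_def H_def)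
  show "\<forall>i<w. \<bar>p * ((\<Sum>j\<in>#X. a j i) mod md i) - tau i\<bar> \<le> p * hh i" using X(4) by (simp add: box_def st_def)
qed (use X mw in auto)

definition "vec_of X = vec n (\<lambda>j. int (count X j))"

lemma mult_S: "y \<in> carrier_vec (n - m) \<Longrightarrow> l < n - m \<Longrightarrow> (S *\<^sub>v y) $ l = S $$ (l, l) * y $ l"
proof -
  assume y: "y \<in> carrier_vec (n - m)" and l: "l < n - m"
  have "(S *\<^sub>v y) $ l = (\<Sum>k<n - m. S $$ (l, k) * y $ k)"
    using S y l by (simp add: scalar_prod_def atLeast0LessThan)
  also have "\<dots> = (\<Sum>k<n - m. if k = l then S $$ (l, l) * y $ l else 0)"
    by (rule sum.cong) (use S_offdiag l in auto)
  finally show ?thesis using l by simp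
qed

lemma st_upper: assumes X: "set_mset X \<subseteq> {..<n}" and i: "i < m"
  shows "st X i = (adj_mat M *\<^sub>v (A *\<^sub>v vec_of X)) $ i"
proof -
  have "(\<Sum>j\<in>#X. a j i) = (\<Sum>j\<in>#X. (adj_mat M * A) $$ (i, j))"
    by (rule arg_cong[of _ _ sum_mset], rule image_mset_cong) (use X i in \<open>auto simp: a_def Y_A\<close>)
  then show ?thesis using sum_mset_adj_mat[OF Mc A X i] i by (simp add: st_def md_def vec_of_def)
qed

lemma st_lower: assumes X: "set_mset X \<subseteq> {..<n}" and i: "m \<le> i" "i < w"
  shows "st X i = (G *\<^sub>v vec_of X) $ (i - m + q) mod md i"
proof -
  have "(\<Sum>j\<in>#X. a j i) = (\<Sum>j<n. int (count X j) * G $$ (i - m + q, j))"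
    using i by (simp add: sum_mset_eq_sum_count[OF X] a_def)
  also have "\<dots> = (G *\<^sub>v vec_of X) $ (i - m + q)"
    using G idx[OF i] by (simp add: vec_of_def scalar_prod_def atLeast0LessThan mult.commute)
  finally show ?thesis by (simp add: st_def)
qed

text \<open>Multiplication by the adjugate loses nothing, since M undoes it up to the nonzero factor
  \<open>det M\<close>. The congruences of the dropped rows are modulo 1 and hold for every integer
  vector.\<close>

lemma feasible_iff:
  assumes X: "set_mset X \<subseteq> {..<n}"
  shows "feasible A G S g b (vec_of X) \<longleftrightarrow> (\<forall>i<w. st X i = tau i)"
proof
  assume feas: "feasible A G S g b (vec_of X)"
  show "\<forall>i<w. st X i = tau i"
  proof (intro allI impI)
    fix i assume i: "i < w"
    show "st X i = tau i"
    proof (cases "i < m")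
      case True
      then show ?thesis using st_upper[OF X True] feas Y_b by (simp add: feasible_def tau_def)
    next
      case False
      then have il: "m \<le> i" "i - m + q < n - m" using idx[of i] i by auto
      from feas obtain y where y: "y \<in> carrier_vec (n - m)" "G *\<^sub>v vec_of X - g = S *\<^sub>v y"
        using S by (auto simp: feasible_def)
      have "(G *\<^sub>v vec_of X - g) $ (i - m + q) = S $$ (i - m + q, i - m + q) * y $ (i - m + q)"
        unfolding y(2) by (rule mult_S[OF y(1) il(2)])
      then have "(G *\<^sub>v vec_of X) $ (i - m + q) - g $ (i - m + q) = md i * y $ (i - m + q)"
        using g G il False by (simp add: md_def)
      then have "(G *\<^sub>v vec_of X) $ (i - m + q) mod md i = g $ (i - m + q) mod md i"
        by (metis dvd_triv_left mod_eq_dvd_iff)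
      then show ?thesis using st_lower[OF X il(1) i] False by (simp add: tau_def)
    qed
  qed
next
  assume eq: "\<forall>i<w. st X i = tau i"
  have aM: "adj_mat M \<in> carrier_mat m m" using adj_mat[OF Mc] by auto
  have Ax: "A *\<^sub>v vec_of X \<in> carrier_vec m" using A by (auto intro!: carrier_vecI)
  have "adj_mat M *\<^sub>v (A *\<^sub>v vec_of X) = adj_mat M *\<^sub>v b"
  proof (rule eq_vecI)
    fix i assume "i < dim_vec (adj_mat M *\<^sub>v b)"
    then have i: "i < m" using aM by simp
    then show "(adj_mat M *\<^sub>v (A *\<^sub>v vec_of X)) $ i = (adj_mat M *\<^sub>v b) $ i"
      using eq mw(1) st_upper[OF X i] Y_b[OF i] by (simp add: tau_def)
  qed (use aM in simp)
  then have "M *\<^sub>v (adj_mat M *\<^sub>v (A *\<^sub>v vec_of X)) = M *\<^sub>v (adj_mat M *\<^sub>v b)" by simp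
  then have e: "(det M \<cdot>\<^sub>m 1\<^sub>m m) *\<^sub>v (A *\<^sub>v vec_of X) = (det M \<cdot>\<^sub>m 1\<^sub>m m) *\<^sub>v b"
    using assoc_mult_mat_vec[OF Mc aM Ax] assoc_mult_mat_vec[OF Mc aM b] adj_mat(2)[OF Mc] by simp
  have dm: "((det M \<cdot>\<^sub>m 1\<^sub>m m) *\<^sub>v v) $ i = det M * v $ i" if "v \<in> carrier_vec m" "i < m" for v i
    using that by (simp add: scalar_prod_def mult.assoc if_distrib[of "\<lambda>x. x * _"] flip: sum_distrib_left cong: if_cong)
  have Axb: "A *\<^sub>v vec_of X = b"
  proof (rule eq_vecI)
    fix i assume "i < dim_vec b"
    then have i: "i < m" using b by simp
    have "det M * (A *\<^sub>v vec_of X) $ i = det M * b $ i" using dm[OF Ax i] dm[OF b i] unfolding e by linarith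
    then show "(A *\<^sub>v vec_of X) $ i = b $ i" using detM by simp
  qed (use A b in simp)
  define y where "y = vec (n - m) (\<lambda>l. ((G *\<^sub>v vec_of X) $ l - g $ l) div S $$ (l, l))"
  have y: "y \<in> carrier_vec (n - m)" by (simp add: y_def)
  have "G *\<^sub>v vec_of X - g = S *\<^sub>v y"
  proof (rule eq_vecI)
    fix l assume "l < dim_vec (S *\<^sub>v y)"
    then have l: "l < n - m" using S by simp
    have "S $$ (l, l) dvd (G *\<^sub>v vec_of X) $ l - g $ l"
    proof (cases "l < q")
      case True
      then show ?thesis using q(2) by simp
    next
      case False
      define i where "i = l - q + m"
      have i: "m \<le> i" "i < w" "i - m + q = l" using False l q(1) by (auto simp: i_def w_def)
      have "(G *\<^sub>v vec_of X) $ l mod S $$ (l, l) = g $ l mod S $$ (l, l)"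
        using eq i st_lower[OF X i(1,2)] by (simp add: tau_def md_def)
      then show ?thesis by (simp add: mod_eq_dvd_iff)
    qed
    then show "(G *\<^sub>v vec_of X - g) $ l = (S *\<^sub>v y) $ l"
      using mult_S[OF y l] l g G by (simp add: y_def)
  qed (use S G g in simp)
  then show "feasible A G S g b (vec_of X)"
    using Axb y S A by (auto simp: feasible_def vec_of_def)
qed

lemma ev_eq:
  assumes "set_mset X \<subseteq> {..<n}"
  shows "ev X = (\<Sum>j<n. int (count X j) * Qb ^ j) + (c \<bullet> vec_of X) * Qb ^ n"
  using c(1) by (simp add: ev_def sum_mset_eq_sum_count[OF assms] wt_def vec_of_def scalar_prod_def atLeast0LessThan
      distrib_left sum.distrib sum_distrib_left sum_distrib_right mult_ac)

lemma digits_of: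
  assumes "set_mset X \<subseteq> {..<n}" "size X \<le> 2 ^ (\<rho> + 1)"
  shows "0 \<le> int (count X j) \<and> int (count X j) < Qb"
proof -
  have "count X j \<le> 2 ^ (\<rho> + 1)" using count_le_size[of X j] assms(2) by linarith
  then have "int (count X j) \<le> int (2 ^ (\<rho> + 1))" by (simp only: of_nat_le_iff)
  then show ?thesis by (simp add: Qb_def)
qed

text \<open>The multiset behind the final entry need not be the optimal solution that is assumed to
  be small. It has the same coordinates, hence is feasible, and its size is at most
  \<open>2 ^ (\<rho> + 1)\<close>, so its multiplicities can be recovered as digits.\<close>

lemma read_off_optimum:
  assumes gen: "generated s 1 lo hi (2 ^ (\<rho> + 1))" and compl: "complete_upto s 1 ((6 / 5) ^ \<rho>) lo hi"
  shows "\<exists>F k. s ''T'' (horner R tau w) = k \<and> s ''E'' k = F \<and> 0 \<le> F \<and> F \<le> W \<and>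
    optimal_solution A G S g b c (vec n (\<lambda>j. F div Qb ^ j mod Qb))"
proof -
  from opt obtain z where z: "feasible A G S g b z" "\<And>y. feasible A G S g b y \<Longrightarrow> c \<bullet> z \<le> c \<bullet> y"
    "real_of_int (\<Sum>j<n. \<bar>z $ j\<bar>) \<le> (6 / 5) ^ \<rho>" by (auto simp: optimal_solution_def)
  have zc: "z \<in> carrier_vec n" "\<And>j. j < n \<Longrightarrow> 0 \<le> z $ j" using z(1) A by (auto simp: feasible_def)
  define Z where "Z = (\<Sum>j<n. replicate_mset (nat (z $ j)) j)"
  have cZ: "count Z j = (if j < n then nat (z $ j) else 0)" for j
    by (simp add: Z_def count_sum)
  have setZ: "set_mset Z \<subseteq> {..<n}"
  proof
    fix j assume "j \<in># Z"
    then have "count Z j \<noteq> 0" by simp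
    then show "j \<in> {..<n}" by (auto simp: cZ split: if_splits)
  qed
  have zZ: "z = vec_of Z" using zc by (intro eq_vecI) (auto simp: vec_of_def cZ)
  have "int (size Z) = (\<Sum>j\<in>#Z. 1)" by simp
  also have "\<dots> = (\<Sum>j<n. \<bar>z $ j\<bar>)" unfolding sum_mset_eq_sum_count[OF setZ]
    by (rule sum.cong) (use zc in \<open>auto simp: cZ\<close>)
  finally have "real (size Z) = real_of_int (\<Sum>j<n. \<bar>z $ j\<bar>)" by linarith
  then have sizeZ: "real (size Z) \<le> (6 / 5) ^ \<rho>" using z(3) by simp
  have "real (size Z) \<le> 2 ^ (\<rho> + 1)"
  proof -
    have "(6 / 5 :: real) ^ \<rho> \<le> 2 ^ \<rho>" by (rule power_mono) auto
    also have "\<dots> \<le> 2 ^ (\<rho> + 1)" by simp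
    finally show ?thesis using sizeZ by linarith
  qed
  then have sizeZ2: "size Z \<le> 2 ^ (\<rho> + 1)" by (metis of_nat_le_iff of_nat_numeral of_nat_power)
  have stZ: "\<forall>i<w. st Z i = tau i" using feasible_iff[OF setZ] z(1) zZ by simp
  have "box 1 (st Z)" using stZ hh_bounds(1) by (simp add: box_def)
  then obtain k where k: "lo \<le> k" "k < hi" "\<forall>i<w. s ''V'' (ix w k i) = st Z i" "s ''E'' (int k) \<le> ev Z"
    using compl setZ sizeZ unfolding complete_upto_def by blast
  from gen k obtain X where X: "set_mset X \<subseteq> {..<n}" "size X \<le> 2 ^ (\<rho> + 1)" "\<forall>i<w. s ''V'' (ix w k i) = st X i"
    "s ''E'' (int k) = ev X" "s ''T'' (horner R (st X) w) = int k" unfolding generated_def by blast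
  have stX: "\<forall>i<w. st X i = tau i" using X(3) k(3) stZ by simp
  have T: "s ''T'' (horner R tau w) = int k"
  proof -
    have "horner R (st X) w = horner R tau w" by (rule horner_cong) (use stX in simp)
    then show ?thesis using X(5) by simp
  qed
  define F where "F = ev X"
  have F: "0 \<le> F" "F \<le> W"
  proof -
    have b: "0 \<le> ev X" "ev X \<le> int (size X) * Emax" using ev_bound[OF X(1)] by auto
    have "int (size X) \<le> int (2 ^ (\<rho> + 1))" using X(2) by (simp only: of_nat_le_iff)
    then have "int (size X) * Emax \<le> 2 ^ (\<rho> + 2) * (Emax + 1)" using Emax_le(1)
      by (intro mult_mono) auto
    then show "0 \<le> F" "F \<le> W" using b W(3) unfolding F_def by linarith+
  qed
  have dig: "F div Qb ^ j mod Qb = int (count X j)" if "j < n" for j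
    unfolding F_def ev_eq[OF X(1)] by (rule digit_extract) (use digits_of[OF X(1,2)] Qb_bounds(1) that in auto)
  then have vX: "vec n (\<lambda>j. F div Qb ^ j mod Qb) = vec_of X" by (intro eq_vecI) (auto simp: vec_of_def)
  have feasX: "feasible A G S g b (vec_of X)" using feasible_iff[OF X(1)] stX by simp
  have "c \<bullet> vec_of X \<le> c \<bullet> z"
  proof (rule ccontr)
    assume "\<not> c \<bullet> vec_of X \<le> c \<bullet> z"
    then have "c \<bullet> z + 1 \<le> c \<bullet> vec_of X" by simp
    then have "(c \<bullet> z + 1) * Qb ^ n \<le> (c \<bullet> vec_of X) * Qb ^ n" using Qb_bounds(1) by (intro mult_right_mono) auto
    moreover have "0 \<le> (\<Sum>j<n. int (count X j) * Qb ^ j)" using Qb_bounds(1) by (intro sum_nonneg) auto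
    \<comment> \<open>The multiplicities of \<open>Z\<close> together weigh less than one unit of
      cost. If \<open>Z\<close> were cheaper than X, its value would be below the stored
      minimum.\<close>
    moreover have "(\<Sum>j<n. int (count Z j) * Qb ^ j) < Qb ^ n"
      by (rule digit_sum_bounds(2)) (use digits_of[OF setZ sizeZ2] Qb_bounds(1) in auto)
    ultimately have "ev Z < ev X" unfolding ev_eq[OF X(1)] ev_eq[OF setZ] zZ[symmetric] by (simp add: algebra_simps)
    then show False using k(4) X(4) by simp
  qed
  then have "optimal_solution A G S g b c (vec_of X)"
    using feasX z(2) by (fastforce simp: optimal_solution_def)
  then show ?thesis using T X(4) F vX by (intro exI[of _ F] exI[of _ "int k"]) (simp add: F_def)
qed

text \<open>w is m plus at most the logarithm of \<open>det S\<close>. The time bound asks for a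
  product, and bounding the sum by a product costs the factor 2.\<close>

lemma w_le_log: "real w \<le> 2 * real m * max 1 (log 2 (real_of_int \<bar>det S\<bar>))"
proof -
  have "(2::real) ^ (w - m) \<le> real_of_int \<bar>det S\<bar>"
    using two_pow_le_detS by (metis abs_of_pos det_S_pos of_int_le_iff of_int_numeral of_int_power)
  then have "real (w - m) \<le> log 2 (real_of_int \<bar>det S\<bar>)"
    using det_S_pos by (simp add: le_log_iff powr_realpow)
  moreover have "real w = real m + real (w - m)" using mw by simp
  moreover have "max 1 (log 2 (real_of_int \<bar>det S\<bar>)) \<le> real m * max 1 (log 2 (real_of_int \<bar>det S\<bar>))"
    using m0 by (simp add: mult_le_cancel_right1)
  moreover have "real m * 1 \<le> real m * max 1 (log 2 (real_of_int \<bar>det S\<bar>))" by (intro mult_left_mono) auto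
  ultimately show ?thesis by linarith
qed

text \<open>The width of the box is \<open>2 * H\<close>, H contains another factor 2, and
  \<lceil>h\<rceil> is at most 2h: this gives 8 \<kappa> h. The additional grid point is absorbed by
  one more \<kappa> h, which is at least 1; hence the 9.\<close>

lemma Kmax_real:
  defines "\<kappa> \<equiv> real_of_int (max_minor A) / real_of_int \<bar>det (submatrix A UNIV J)\<bar>"
  shows "1 \<le> \<kappa>" "real Kmax \<le> real_of_int (max_minor A) * (9 * (\<kappa> * h)) ^ m * real_of_int \<bar>det S\<bar>"
proof -
  let ?d = "\<bar>det M\<bar>" and ?\<Delta> = "max_minor A"
  have d: "0 < ?d" "?d \<le> ?\<Delta>"
    using detM abs_det_select_cols_le_max_minor[OF A mn fn] by (auto simp: M)
  have \<kappa>: "\<kappa> = real_of_int ?\<Delta> / real_of_int ?d" by (simp add: \<kappa>_def absdet)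
  show \<kappa>1: "1 \<le> \<kappa>" using d by (simp add: \<kappa>)
  have D: "real (nat (2 * H div ?d)) \<le> 2 * real_of_int H / real_of_int ?d"
  proof -
    have "0 \<le> 2 * H div ?d" using H_bounds d by (simp add: pos_imp_zdiv_nonneg_iff)
    then have "real (nat (2 * H div ?d)) = real_of_int (2 * H div ?d)" by simp
    also have "\<dots> \<le> real_of_int (2 * H) / real_of_int ?d" by (rule real_of_int_div4)
    finally show ?thesis by simp
  qed
  have "real_of_int H \<le> (4 * h) * real_of_int ?\<Delta>"
  proof -
    have "real_of_int \<lceil>h\<rceil> \<le> 2 * h" using h_ge_1 by linarith
    then have "real_of_int (2 * \<lceil>h\<rceil>) * real_of_int H0 \<le> (4 * h) * real_of_int ?\<Delta>"
      using H0_le H0(1) h_ge_1 by (intro mult_mono) auto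
    then show ?thesis by (simp add: H_def)
  qed
  then have "2 * real_of_int H / real_of_int ?d \<le> 2 * ((4 * h) * real_of_int ?\<Delta>) / real_of_int ?d"
    using d by (intro divide_right_mono) auto
  also have "\<dots> = 8 * (\<kappa> * h)" by (simp add: \<kappa> field_simps)
  finally have "real (nat (2 * H div ?d)) + 1 \<le> 8 * (\<kappa> * h) + 1" using D by linarith
  also have "1 * 1 \<le> \<kappa> * h" using \<kappa>1 h_ge_1 by (intro mult_mono) auto
  then have "8 * (\<kappa> * h) + 1 \<le> 9 * (\<kappa> * h)" by simp
  finally have "(real (nat (2 * H div ?d)) + 1) ^ m \<le> (9 * (\<kappa> * h)) ^ m" by (intro power_mono) auto
  moreover have "real (nat ?d) \<le> real_of_int ?\<Delta>" using d by simp
  moreover have "real Kmax = real (nat ?d) * (real (nat (2 * H div ?d)) + 1) ^ m * real (nat (det S))"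
    by (simp add: Kmax_def add.commute)
  moreover have "real (nat (det S)) = real_of_int \<bar>det S\<bar>" using det_S_pos by simp
  moreover have "0 \<le> (9 * (\<kappa> * h)) ^ m" "0 \<le> real_of_int ?\<Delta>" using \<kappa>1 h_ge_1 d by auto
  ultimately show "real Kmax \<le> real_of_int ?\<Delta> * (9 * (\<kappa> * h)) ^ m * real_of_int \<bar>det S\<bar>"
    by (simp only:) (intro mult_mono mult_nonneg_nonneg; simp)
qed

end

section \<open>The solver\<close>

text \<open>The functions of \<open>ip_tab\<close> refer to the matrices, which agree with the
  memory only for indices below w, so agreement is required only there.\<close>

lemma wp_coordinates_eq:
  fixes s :: store and m n w q :: nat and md tau hh :: "nat \<Rightarrow> int"
  assumes s: "s ''m'' 0 = int m" "s ''n'' 0 = int n" "s ''w'' 0 = int w" "s ''q'' 0 = int q" "s ''z'' 0 = int z" "s ''h'' 0 = H"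
    and mw: "m \<le> w" "w + q \<le> n" and M0: "\<And>i. i < m \<Longrightarrow> s ''M'' (int i) = 0"
    and md: "\<And>i. i < w \<Longrightarrow> md i = (if i < m then 0 else s ''S'' (ix z (i - m + q) (i - m + q)))"
    and tau: "\<And>i. i < w \<Longrightarrow> tau i = (if i < m then s ''b'' (int i) else s ''g'' (int (i - m + q)) mod md i)"
    and hh: "\<And>i. i < w \<Longrightarrow> hh i = (if i < m then H else md i)"
    and W: "\<And>i. i < w \<Longrightarrow> \<bar>md i\<bar> \<le> W \<and> \<bar>tau i\<bar> \<le> W \<and> \<bar>hh i\<bar> \<le> W"
      "\<And>k. k \<le> w \<Longrightarrow> \<bar>1 + (\<Sum>i<k. 4 * (tau i * tau i + hh i))\<bar> \<le> W"
      "int ((n + 2) * (w + 1)) \<le> W" "\<And>i j. i < w \<Longrightarrow> j < n \<Longrightarrow> \<bar>s ''A'' (ix n i j)\<bar> \<le> W"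
  shows "wp W coordinates (\<lambda>t s'. t \<le> w * (50 * n + 150) + 50 \<and> unchanged {''R'', ''i'', ''t'', ''D'', ''M'', ''r'', ''j'', ''V''} s s' \<and>
    (\<forall>i<w. s' ''M'' (int i) = md i \<and> s' ''t'' (int i) = tau i \<and> s' ''D'' (int i) = hh i) \<and>
    s' ''R'' 0 = 1 + (\<Sum>i<w. 4 * (tau i * tau i + hh i)) \<and>
    (\<forall>i<w. s' ''V'' (ix w 0 i) = s ''V'' (ix w 0 i)) \<and> (\<forall>i<w. \<forall>j<n. s' ''V'' (ix w (Suc j) i) = s ''A'' (ix n i j))) s"
proof -
  let ?md = "\<lambda>i. if i < m then 0 else s ''S'' (ix z (i - m + q) (i - m + q))"
  let ?tau = "\<lambda>i. if i < m then s ''b'' (int i) else s ''g'' (int (i - m + q)) mod ?md i"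
  let ?hh = "\<lambda>i. if i < m then H else ?md i"
  have e: "?md i = md i" "?tau i = tau i" "?hh i = hh i" if "i < w" for i
    using md[OF that] tau[OF that] hh[OF that] by auto
  have R: "1 + (\<Sum>i<k. 4 * (?tau i * ?tau i + ?hh i)) = 1 + (\<Sum>i<k. 4 * (tau i * tau i + hh i))" if "k \<le> w" for k
    by (rule arg_cong[of _ _ "(+) 1"], rule sum.cong[OF refl]) (use e(2,3) that in auto)
  show ?thesis
  proof (rule wp_conseq[OF wp_coordinates[OF s mw M0]])
    show "\<bar>?md i\<bar> \<le> W \<and> \<bar>?tau i\<bar> \<le> W \<and> \<bar>?hh i\<bar> \<le> W" if "i < w" for i
      using W(1)[OF that] md[OF that] tau[OF that] hh[OF that] by (cases "i < m") simp_all
    show "\<bar>1 + (\<Sum>i<k. 4 * (?tau i * ?tau i + ?hh i))\<bar> \<le> W" if "k \<le> w" for k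
      unfolding R[OF that] by (rule W(2)[OF that])
  qed (use W(3,4) e R[of w] in \<open>auto simp only: order_refl\<close>)
qed

definition solver :: com where
  "solver = eliminate ;; find_max ;; find_nontrivial ;; copy_rows ;; coordinates ;; weights ;; start_rounds ;; rounds ;; decode"

text \<open>The elimination term \<open>m * m * n\<close> is split into \<open>m ^ 4\<close> and
  \<open>n * n\<close>: the second is linear in the input, and the first is left to be absorbed by
  the exponential factor.\<close>

lemma setup_time:
  fixes m n w \<rho> K :: nat
  assumes "1 \<le> m" "m \<le> w" "w \<le> n"
  shows "(m * (m * (70 * n + 160) + 112) + 20) + (60 * (m * n) + 40) + (40 * n + 60) + (40 * (w * n) + 40) +
    (w * (50 * n + 150) + 50) + (30 * \<rho> + 80 * n + 80) + 20 +
    ((n + 1) * (120 * w + 270) + \<rho> * (K * K * (120 * w + 270))) + (40 * w + 60 * n + 60)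
    \<le> 4000 * (n * n) + 70 * m ^ 4 + 30 * \<rho> + \<rho> * (K * K * (390 * w))"
proof -
  have 1: "m * n \<le> n * n" "w * n \<le> n * n" "m * m \<le> n * n" using assms by (auto intro: mult_mono)
  have 2: "n \<le> n * n" "1 \<le> n * n" "m \<le> n * n" "w \<le> n * n" using assms by (auto intro: le_trans[of _ n] simp: Suc_le_eq)
  have 3: "m * m * n \<le> m ^ 4 + n * n"
  proof -
    have "x * y \<le> x * x + y * y" for x y :: nat by (cases "x \<le> y") (simp_all add: trans_le_add1 trans_le_add2)
    from this[of "m * m" n] show ?thesis by (simp add: eval_nat_numeral algebra_simps)
  qed
  have 4: "K * K * (120 * w + 270) \<le> K * K * (390 * w)" using assms by (intro mult_left_mono) auto
  then have 5: "\<rho> * (K * K * (120 * w + 270)) \<le> \<rho> * (K * K * (390 * w))" by (rule mult_left_mono) simp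
  have "m * (m * (70 * n + 160) + 112) = 70 * (m * m * n) + 160 * (m * m) + 112 * m" by (simp add: algebra_simps)
  moreover have "w * (50 * n + 150) = 50 * (w * n) + 150 * w" by (simp add: algebra_simps)
  moreover have "(n + 1) * (120 * w + 270) = 120 * (w * n) + 270 * n + 120 * w + 270" by (simp add: algebra_simps)
  ultimately show ?thesis using 1 2 3 5 by linarith
qed

lemma power4_le: "m ^ 4 \<le> 16 ^ m" for m :: nat
proof -
  have "m ^ 4 \<le> (2 ^ m) ^ 4" using less_exp[of m] by (intro power_mono) auto
  also have "\<dots> = (2 ^ 4) ^ m" unfolding power_mult[symmetric] by (simp add: mult.commute)
  also have "\<dots> = 16 ^ m" by simp
  finally show ?thesis .
qed

text \<open>Each term is at most a multiple of P, with multiples adding up to 880 = 70 + 30 + 780;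
  the 780 is 390 times the 2 in the bound on w. Raising the base from 9 to 4000 gains
  \<open>(4000 / 9) ^ (2 * m)\<close>, which exceeds 880 because m is positive.\<close>

lemma total_time:
  fixes K m w \<rho> :: nat and X \<Delta> dS L :: real
  assumes m: "1 \<le> m" and \<rho>: "1 \<le> \<rho>" and X: "1 \<le> X" and \<Delta>: "1 \<le> \<Delta>" and dS: "1 \<le> dS" and L: "1 \<le> L"
    and K: "real K \<le> \<Delta> * (9 * X) ^ m * dS" and w: "real w \<le> 2 * real m * L"
  shows "70 * real (m ^ 4) + 30 * real \<rho> + real \<rho> * (real K * real K * (390 * real w))
    \<le> real \<rho> * real m * (4000 * X) ^ (2 * m) * \<Delta>\<^sup>2 * dS\<^sup>2 * L"
proof -
  define Z where "Z = (9 * X) ^ (2 * m) * \<Delta>\<^sup>2 * dS\<^sup>2"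
  define P where "P = real \<rho> * real m * L * Z"
  have sq: "1 \<le> \<Delta>\<^sup>2" "1 \<le> dS\<^sup>2" using \<Delta> dS by auto
  have sq3: "1 \<le> (9 * X) ^ (2 * m)" by (rule one_le_power) (use X in simp)
  have one: "1 \<le> a * b" if "1 \<le> a" "1 \<le> b" for a b :: real using mult_mono[of 1 a 1 b] that by simp
  have mult_ge: "a \<le> a * b" if "0 \<le> a" "1 \<le> b" for a b :: real using mult_left_mono[of 1 b a] that by simp
  have Z1: "1 \<le> Z" unfolding Z_def by (intro one sq sq3)
  have \<rho>mL: "real \<rho> \<le> real \<rho> * real m * L" "1 \<le> real \<rho> * real m * L"
    using m \<rho> L mult_ge[of "real \<rho>" "real m * L"] one[of "real m" L] one[of "real \<rho>" "real m * L"] by (auto simp: mult.assoc)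
  have "real (m ^ 4) \<le> real (16 ^ m)" using power4_le[of m] by (simp only: of_nat_le_iff)
  also have "\<dots> \<le> (81 * X\<^sup>2) ^ m"
  proof -
    have "16 * 1 \<le> 81 * X\<^sup>2" using X one_le_power[of X 2] by (intro mult_mono) auto
    then have "(16::real) ^ m \<le> (81 * X\<^sup>2) ^ m" by (intro power_mono) linarith+
    moreover have "real (16 ^ m) = 16 ^ m" by simp
    ultimately show ?thesis by linarith
  qed
  also have "\<dots> = (9 * X) ^ (2 * m)"
  proof -
    have "81 * X\<^sup>2 = (9 * X)\<^sup>2" by (simp add: power2_eq_square)
    then show ?thesis by (simp only: power_mult)
  qed
  also have "\<dots> \<le> Z" unfolding Z_def mult.assoc by (rule mult_ge[OF order_trans[OF zero_le_one sq3] one[OF sq]])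
  also have "\<dots> \<le> P" unfolding P_def using mult_ge[of Z "real \<rho> * real m * L"] Z1 \<rho>mL(2) by (simp add: mult.commute)
  finally have 1: "real (m ^ 4) \<le> P" .
  have "real \<rho> \<le> P" unfolding P_def using mult_ge[of "real \<rho> * real m * L" Z] Z1 \<rho>mL by linarith
  note 2 = this
  have "real K * real K \<le> (\<Delta> * (9 * X) ^ m * dS) * (\<Delta> * (9 * X) ^ m * dS)"
    using K by (intro mult_mono) auto
  also have "\<dots> = Z"
  proof -
    have "(9 * X) ^ (2 * m) = (9 * X) ^ m * (9 * X) ^ m" by (simp only: mult_2 power_add)
    then show ?thesis unfolding Z_def power2_eq_square by (simp only: mult_ac)
  qed
  finally have "real K * real K * (390 * real w) \<le> Z * (390 * (2 * real m * L))"
    using w Z1 by (intro mult_mono) auto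
  then have "real \<rho> * (real K * real K * (390 * real w)) \<le> real \<rho> * (Z * (390 * (2 * real m * L)))"
    by (rule mult_left_mono) simp
  then have 3: "real \<rho> * (real K * real K * (390 * real w)) \<le> 780 * P" by (simp add: P_def mult_ac)
  have "880 \<le> ((4000 / 9) ^ (2 * m) :: real)"
  proof -
    have "880 \<le> ((4000 / 9) ^ 2 :: real)" by (simp add: power2_eq_square)
    also have "\<dots> \<le> (4000 / 9) ^ (2 * m)" using m by (intro power_increasing) auto
    finally show ?thesis .
  qed
  then have "880 * P \<le> (4000 / 9) ^ (2 * m) * P" using Z1 L by (intro mult_right_mono) (auto simp: P_def)
  also have "\<dots> = real \<rho> * real m * L * (((4000 / 9) * (9 * X)) ^ (2 * m) * \<Delta>\<^sup>2 * dS\<^sup>2)"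
    unfolding P_def Z_def power_mult_distrib by (simp add: mult_ac)
  finally have "880 * P \<le> real \<rho> * real m * (4000 * X) ^ (2 * m) * \<Delta>\<^sup>2 * dS\<^sup>2 * L" by (simp add: mult_ac)
  then show ?thesis using 1 2 3 by linarith
qed

context ip begin

lemma exec_solver:
  assumes W20: "2 ^ (20 * (N * N * N)) \<le> W"
  shows "\<exists>t s x w K. exec W solver s0 t s \<and> optimal_solution A G S g b c x \<and> holds_vec s ''x'' x \<and>
    t \<le> 4000 * (n * n) + 70 * m ^ 4 + 30 * \<rho> + \<rho> * (K * K * (390 * w)) \<and>
    real w \<le> 2 * real m * max 1 (log 2 (real_of_int \<bar>det S\<bar>)) \<and>
    real K \<le> real_of_int (max_minor A) *
      (9 * (real_of_int (max_minor A) / real_of_int \<bar>det (submatrix A UNIV J)\<bar> * h)) ^ m * real_of_int \<bar>det S\<bar> \<and>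
    1 \<le> real_of_int (max_minor A) / real_of_int \<bar>det (submatrix A UNIV J)\<bar>"
proof -
  have toW: "x \<le> W" if "x \<le> 2 ^ k" "k \<le> 20 * (N * N * N)" for x :: int and k
    using le_two_power_mono[OF that] W20 by linarith
  have NW: "2 ^ N \<le> W" by (rule toW[OF order_refl]) (use N_powers_mono in linarith)
  have natW: "int k \<le> W" if "k \<le> N" for k using nat_le_two_power[OF that] NW by linarith
  have mn_N: "m * n \<le> N" using n_le_N(2) mult_right_mono[OF mn, of n] by linarith
  have W1: "1 \<le> W" using natW[of 1] n_le_N by simp
  have "(2::int) ^ (2 * (N * N)) \<le> W" by (rule toW[OF order_refl]) (use N_powers_mono in linarith)
  note W2 = this
  interpret el: elimination W m n Ab jl "2 ^ N" s0
  proof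
    show "\<bar>Ab $$ (i, j)\<bar> \<le> 2 ^ N" if "i < m" "j < Suc n" for i j
      using entries(1,5) that by (auto simp: Ab_def)
    show "fact m * (2 ^ N) ^ m \<le> W" using D_le W2 by linarith
    show "int (m * n) \<le> W" by (rule natW[OF mn_N])
  qed (use Ab jl_less det_jl natW n_le_N W1 s0_simps in auto)
  have "wp W eliminate (\<lambda>t s. t \<le> m * (m * (70 * n + 160) + 112) + 20 \<and> unchanged el.touched s0 s \<and>
    (\<exists>M idx. elim_inv m n Ab jl m s M idx)) s0"
    by (rule el.wp_eliminate) (use s0_simps in \<open>auto simp: Ab_def\<close>)
  then obtain t1 s1 M idx where e1: "exec W eliminate s0 t1 s1" and t1: "t1 \<le> m * (m * (70 * n + 160) + 112) + 20"
    and u1: "unchanged el.touched s0 s1" and inv: "elim_inv m n Ab jl m s1 M idx" unfolding wp_def by blast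
  have Mc: "M \<in> carrier_mat m m" using inv by (simp add: elim_inv_def)
  have bijS: "J \<subseteq> {..<Suc n}" using J by auto
  have cols: "\<exists>r<m. col M r = col Ab (jl i)" if "i < m" for i using inv that by (auto simp: elim_inv_def)
  \<comment> \<open>After m steps all columns of J have been brought in, so M is the given submatrix
    up to the order of its columns.\<close>
  obtain f where f: "bij_betw f {..<m} J" "M = select_cols Ab f"
    by (rule cols_bij[OF Mc Ab jl_bij bijS det_jl cols])
  have fn: "f i < n" if "i < m" for i using f(1) J(1) that by (auto simp: bij_betw_def)
  have Msel: "M = select_cols A f" using f(2) select_Ab[OF fn] by simp
  have tabA: "s1 ''A'' (ix n i j) = (adj_mat M * Ab) $$ (i, j)" if "i < m" "j < n" for i j
    using inv that by (simp add: elim_inv_def)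
  have tabb: "s1 ''b'' (int i) = (adj_mat M * Ab) $$ (i, n)" if "i < m" for i
    using inv that by (simp add: elim_inv_def)
  have tab_le: "\<bar>(adj_mat M * Ab) $$ (i, j)\<bar> \<le> 2 ^ (2 * (N * N))" if "i < m" "j < Suc n" for i j
    using elim_inv_table_bound[OF inv Ab el.\<beta> jl_less order_refl that] D_le by linarith
  have ixk: "int k = ix n (k div n) (k mod n)" "k div n < m" "k mod n < n" if "k < m * n" for k
  proof -
    have "0 < n" using m0 mn by simp
    then show "k mod n < n" by simp
    show "k div n < m" using that by (simp add: less_mult_imp_div_less)
    show "int k = ix n (k div n) (k mod n)" unfolding ix_def by (simp flip: of_nat_mult of_nat_add)
  qed
  have c1: "s1 ''m'' 0 = int m" "s1 ''n'' 0 = int n" "s1 ''eta'' 0 = \<lceil>h\<rceil>" using u1 s0_simps by (auto simp: unchanged_def)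
  have "wp W find_max (\<lambda>t s'. t \<le> 60 * (m * n) + 40 \<and> unchanged {''h'', ''k''} s1 s' \<and>
    (\<exists>H. 0 \<le> H \<and> s' ''h'' 0 = 2 * s1 ''eta'' 0 * H \<and> (\<forall>k<m * n. \<bar>s1 ''A'' (int k)\<bar> \<le> H) \<and> (H = 0 \<or> (\<exists>k<m * n. H = \<bar>s1 ''A'' (int k)\<bar>)))) s1"
  proof (rule wp_find_max[where s = s1, OF c1(1,2)])
    show "\<bar>s1 ''A'' (int k)\<bar> \<le> 2 ^ (2 * (N * N))" if "k < m * n" for k
      using ixk[OF that] tabA tab_le by simp
    show "\<bar>2 * s1 ''eta'' 0\<bar> * 2 ^ (2 * (N * N)) \<le> W"
    proof -
      have "\<bar>2 * s1 ''eta'' 0\<bar> \<le> 2 ^ (1 + N)" using entries(7) c1(3) by simp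
      then have "\<bar>2 * s1 ''eta'' 0\<bar> * 2 ^ (2 * (N * N)) \<le> 2 ^ (1 + N + 2 * (N * N))" by (intro two_power_mult) auto
      then show ?thesis by (rule toW) (use N_powers_mono in linarith)
    qed
    show "int (m * n) \<le> W" by (rule natW[OF mn_N])
  qed (use W2 in auto)
  then obtain t2 s2 H0 where e2: "exec W find_max s1 t2 s2" and t2: "t2 \<le> 60 * (m * n) + 40"
    and u2: "unchanged {''h'', ''k''} s1 s2" and h2: "s2 ''h'' 0 = 2 * \<lceil>h\<rceil> * H0" and H0: "0 \<le> H0" "\<forall>k<m * n. \<bar>s1 ''A'' (int k)\<bar> \<le> H0"
      "H0 = 0 \<or> (\<exists>k<m * n. H0 = \<bar>s1 ''A'' (int k)\<bar>)" unfolding wp_def c1 by blast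
  have c2: "s2 ''m'' 0 = int m" "s2 ''n'' 0 = int n" "s2 ''S'' = s0 ''S''" using u1 u2 s0_simps by (auto simp: unchanged_def)
  have "wp W find_nontrivial (\<lambda>t s'. t \<le> 40 * n + 60 \<and> unchanged {''z'', ''q'', ''w''} s2 s' \<and> s' ''z'' 0 = int (n - m) \<and>
    (\<exists>q\<le>n - m. s' ''q'' 0 = int q \<and> s' ''w'' 0 = int (n - q) \<and> (\<forall>i<q. s2 ''S'' (ix (n - m) i i) = 1) \<and>
      (q < n - m \<longrightarrow> 1 < s2 ''S'' (ix (n - m) q q)))) s2"
    by (rule wp_find_nontrivial[where s = s2, OF c2(1,2) mn]) (use c2(3) s0_simps(7,8) S_pos natW n_le_N in auto)
  then obtain t3 s3 q where e3: "exec W find_nontrivial s2 t3 s3" and t3: "t3 \<le> 40 * n + 60"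
    and u3: "unchanged {''z'', ''q'', ''w''} s2 s3" and c3: "s3 ''z'' 0 = int (n - m)" "s3 ''q'' 0 = int q" "s3 ''w'' 0 = int (n - q)"
    and q: "q \<le> n - m" "\<forall>i<q. s0 ''S'' (ix (n - m) i i) = 1" "q < n - m \<longrightarrow> 1 < s0 ''S'' (ix (n - m) q q)"
    unfolding wp_def c2 by blast
  \<comment> \<open>Only at this point of the run are M, H0 and q known, so the locale is
    interpreted with the values just computed.\<close>
  interpret tb: ip_tab h m n A G S g b c \<rho> J M f H0 q W
  proof
    show "\<bar>(adj_mat M * Ab) $$ (i, j)\<bar> \<le> H0" if "i < m" "j < n" for i j
    proof -
      have "ix n i j = int (nat (ix n i j))" "nat (ix n i j) < m * n" using ix_bounds[OF that] by linarith+
      then show ?thesis using H0(2) tabA[OF that] by metis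
    qed
    show "H0 = 0 \<or> (\<exists>i<m. \<exists>j<n. H0 = \<bar>(adj_mat M * Ab) $$ (i, j)\<bar>)"
      using H0(3) ixk tabA by metis
    show "S $$ (l, l) = 1" if "l < q" for l using q that s0_simps(7)[of l l] by auto
    show "q < n - m \<Longrightarrow> 1 < S $$ (q, q)" using q(3) s0_simps(7)[of q q] by auto
  qed (use Msel f(1) H0(1) q(1) W20 in auto)
  have wq: "n - q = tb.w" by (simp add: tb.w_def)
  have wN: "tb.w \<le> N" using tb.mw n_le_N by simp
  have wnN: "tb.w * n \<le> N" using tb.mw mult_right_mono[of tb.w n n] n_le_N by linarith
  have c3': "s3 ''m'' 0 = int m" "s3 ''n'' 0 = int n" "s3 ''w'' 0 = int tb.w" "s3 ''A'' = s1 ''A''" "s3 ''G'' = s0 ''G''"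
    using u1 u2 u3 c3 s0_simps by (auto simp: unchanged_def wq)
  have Gcell: "s3 ''G'' (int (q * n + k)) = G $$ (q + k div n, k mod n)" "q + k div n < n - m" "k mod n < n" if "k < (tb.w - m) * n" for k
  proof -
    have n0: "0 < n" using m0 mn by simp
    then show kn: "k mod n < n" by simp
    have "k div n < tb.w - m" using that by (simp add: less_mult_imp_div_less)
    then show ql: "q + k div n < n - m" using tb.mw(3) by linarith
    have "q * n + k = (q + k div n) * n + k mod n" by (simp add: add_mult_distrib)
    then have "int (q * n + k) = ix n (q + k div n) (k mod n)" unfolding ix_def by (simp only: of_nat_add of_nat_mult)
    then show "s3 ''G'' (int (q * n + k)) = G $$ (q + k div n, k mod n)" using s0_simps(6)[OF ql kn] c3'(5) by simp
  qed
  have "wp W copy_rows (\<lambda>t s'. t \<le> 40 * (tb.w * n) + 40 \<and> unchanged {''k'', ''A''} s3 s' \<and>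
    (\<forall>k<m * n. s' ''A'' (int k) = s3 ''A'' (int k)) \<and>
    (\<forall>k<(tb.w - m) * n. s' ''A'' (int (m * n + k)) = s3 ''G'' (int (q * n + k)))) s3"
  proof (rule wp_copy_rows[where s = s3, OF c3'(1-3) c3(2) tb.mw(1)])
    show "\<bar>s3 ''G'' (int (q * n + k))\<bar> \<le> W" if "k < (tb.w - m) * n" for k
      using Gcell[OF that] entries(2)[of "q + k div n" "k mod n"] NW by simp
    show "int (tb.w * n) \<le> W" by (rule natW[OF wnN])
  qed
  then obtain t4 s4 where e4: "exec W copy_rows s3 t4 s4" and t4: "t4 \<le> 40 * (tb.w * n) + 40"
    and u4: "unchanged {''k'', ''A''} s3 s4" and A4: "\<forall>k<m * n. s4 ''A'' (int k) = s3 ''A'' (int k)"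
      "\<forall>k<(tb.w - m) * n. s4 ''A'' (int (m * n + k)) = s3 ''G'' (int (q * n + k))" unfolding wp_def by blast
  have a4: "s4 ''A'' (ix n i j) = tb.a j i" if i: "i < tb.w" and j: "j < n" for i j
  proof (cases "i < m")
    case True
    have "ix n i j = int (nat (ix n i j))" "nat (ix n i j) < m * n" using ix_bounds[OF True j] by linarith+
    then have "s4 ''A'' (ix n i j) = s3 ''A'' (ix n i j)" using A4(1) by metis
    then show ?thesis using tabA[OF True j] True c3'(4) by (simp add: tb.a_def tb.Y_def)
  next
    case False
    define k where "k = (i - m) * n + j"
    have k: "k < (tb.w - m) * n"
    proof -
      have "k < Suc (i - m) * n" using j by (simp add: k_def)
      also have "\<dots> \<le> (tb.w - m) * n" using i False by (intro mult_right_mono) auto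
      finally show ?thesis .
    qed
    have "m * n + k = i * n + j" using False by (simp add: k_def flip: add_mult_distrib)
    then have "ix n i j = int (m * n + k)" unfolding ix_def by (simp only: of_nat_add of_nat_mult)
    moreover have "k div n = i - m" "k mod n = j" using j by (auto simp: k_def)
    ultimately show ?thesis using A4(2) k Gcell(1)[OF k] False by (simp add: tb.a_def add.commute)
  qed
  have c4: "s4 ''m'' 0 = int m" "s4 ''n'' 0 = int n" "s4 ''w'' 0 = int tb.w" "s4 ''q'' 0 = int q" "s4 ''z'' 0 = int (n - m)"
    "s4 ''h'' 0 = tb.H" "s4 ''M'' = (\<lambda>_. 0)" "s4 ''S'' = s0 ''S''" "s4 ''g'' = s0 ''g''" "s4 ''b'' = s1 ''b''"
    using u1 u2 u3 u4 c3 c3' h2 s0_simps(14) by (auto simp: unchanged_def tb.H_def)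
  have RW: "tb.R + 1 \<le> W" "0 \<le> tb.r"
  proof -
    show r0: "0 \<le> tb.r" by (rule tb.r_bounds)
    have "(tb.R + 1) ^ 1 \<le> (tb.R + 1) ^ tb.w" using r0 m0 tb.mw by (intro power_increasing) (auto simp: tb.R_def)
    then show "tb.R + 1 \<le> W" using tb.W(1) by simp
  qed
  have Rsum: "1 + (\<Sum>i<tb.w. 4 * (tb.tau i * tb.tau i + tb.hh i)) = tb.R"
    by (simp add: tb.R_def tb.r_def sum_distrib_left)
  have rW: "tb.r \<le> W" using RW by (simp add: tb.R_def)
  have term0: "0 \<le> 4 * (tb.tau i * tb.tau i + tb.hh i)" if "i < tb.w" for i by (rule mult_nonneg_nonneg[OF _ tb.term_bounds(1)[OF that]]) simp
  have "wp W coordinates (\<lambda>t s'. t \<le> tb.w * (50 * n + 150) + 50 \<and> unchanged {''R'', ''i'', ''t'', ''D'', ''M'', ''r'', ''j'', ''V''} s4 s' \<and>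
    (\<forall>i<tb.w. s' ''M'' (int i) = tb.md i \<and> s' ''t'' (int i) = tb.tau i \<and> s' ''D'' (int i) = tb.hh i) \<and>
    s' ''R'' 0 = 1 + (\<Sum>i<tb.w. 4 * (tb.tau i * tb.tau i + tb.hh i)) \<and>
    (\<forall>i<tb.w. s' ''V'' (ix tb.w 0 i) = s4 ''V'' (ix tb.w 0 i)) \<and> (\<forall>i<tb.w. \<forall>j<n. s' ''V'' (ix tb.w (Suc j) i) = s4 ''A'' (ix n i j))) s4"
  proof (rule wp_coordinates_eq[where s = s4, OF c4(1-6) tb.mw(1)])
    show "tb.w + q \<le> n" using q(1) by (simp add: tb.w_def)
    show "tb.md i = (if i < m then 0 else s4 ''S'' (ix (n - m) (i - m + q) (i - m + q)))" if "i < tb.w" for i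
      using tb.idx[of i] that s0_simps(7) by (simp add: tb.md_def c4 del: of_nat_diff)
    show "tb.tau i = (if i < m then s4 ''b'' (int i) else s4 ''g'' (int (i - m + q)) mod tb.md i)" if "i < tb.w" for i
      using tb.idx[of i] that s0_simps(9) tabb[of i] by (simp add: tb.tau_def tb.Y_def c4 del: of_nat_diff of_nat_add)
    show "\<bar>tb.md i\<bar> \<le> W \<and> \<bar>tb.tau i\<bar> \<le> W \<and> \<bar>tb.hh i\<bar> \<le> W" if "i < tb.w" for i
      using tb.md_bounds[OF that] tb.tau_hh_r[OF that] tb.hh_bounds(1)[OF that] NW rW by simp
    show "\<bar>1 + (\<Sum>i<k. 4 * (tb.tau i * tb.tau i + tb.hh i))\<bar> \<le> W" if "k \<le> tb.w" for k
    proof -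
      have "(\<Sum>i<k. 4 * (tb.tau i * tb.tau i + tb.hh i)) \<le> (\<Sum>i<tb.w. 4 * (tb.tau i * tb.tau i + tb.hh i))"
        by (rule sum_mono2) (use that term0 in auto)
      moreover have "0 \<le> (\<Sum>i<k. 4 * (tb.tau i * tb.tau i + tb.hh i))"
        by (rule sum_nonneg) (use that term0 in force)
      ultimately show ?thesis using Rsum RW(1) by linarith
    qed
    show "int ((n + 2) * (tb.w + 1)) \<le> W"
      by (rule order_trans[OF of_nat_mono tb.W(4)]) (intro mult_right_mono; simp)
    show "\<bar>s4 ''A'' (ix n i j)\<bar> \<le> W" if "i < tb.w" "j < n" for i j
      unfolding a4[OF that] using tb.col(1)[OF that] tb.W(2) by linarith
  qed (auto simp: c4 tb.hh_def)
  then obtain t5 s5 where e5: "exec W coordinates s4 t5 s5" and t5: "t5 \<le> tb.w * (50 * n + 150) + 50"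
    and u5: "unchanged {''R'', ''i'', ''t'', ''D'', ''M'', ''r'', ''j'', ''V''} s4 s5"
    and M5: "\<forall>i<tb.w. s5 ''M'' (int i) = tb.md i \<and> s5 ''t'' (int i) = tb.tau i \<and> s5 ''D'' (int i) = tb.hh i"
    and R5: "s5 ''R'' 0 = tb.R" and V5: "\<forall>i<tb.w. s5 ''V'' (ix tb.w 0 i) = s4 ''V'' (ix tb.w 0 i)"
      "\<forall>i<tb.w. \<forall>j<n. s5 ''V'' (ix tb.w (Suc j) i) = tb.a j i"
    unfolding wp_def Rsum using a4 by auto
  have c5: "s5 ''n'' 0 = int n" "s5 ''rho'' 0 = int \<rho>" "s5 ''c'' = s0 ''c''" "s5 ''E'' = (\<lambda>_. 0)" "s5 ''T'' = (\<lambda>_. 0)" "s5 ''w'' 0 = int tb.w"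
    using u1 u2 u3 u4 u5 c4 s0_simps(3,16,17) by (auto simp: unchanged_def)
  have V0: "s4 ''V'' = (\<lambda>_. 0)" using u1 u2 u3 u4 s0_simps(15) by (auto simp: unchanged_def)
  have QbW: "tb.Qb ^ (n + 1) \<le> W" by (rule toW[OF tb.Qb_bounds(4)]) (use N_powers_mono in linarith)
  have EmW: "2 * (tb.Emax + 1) \<le> W"
  proof -
    have "(2::int) \<le> 2 ^ (\<rho> + 2)" by (rule self_le_power) auto
    then have "2 * (tb.Emax + 1) \<le> 2 ^ (\<rho> + 2) * (tb.Emax + 1)"
      by (rule mult_right_mono) (use tb.Emax_le(1) in simp)
    then show ?thesis using tb.W(3) by linarith
  qed
  have nW: "int n + 1 \<le> W"
  proof -
    have "int (n + 1) \<le> W"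
      by (rule order_trans[OF of_nat_mono tb.W(4)]) (use mult_mono[of "n + 1" "n + 4 + (\<rho> + 1) * tb.Kmax" 1 "tb.w + 1"] in simp)
    then show ?thesis by simp
  qed
  have "wp W weights (\<lambda>t s'. t \<le> 30 * \<rho> + 80 * n + 80 \<and> unchanged {''p'', ''k'', ''Q'', ''f'', ''j'', ''E''} s5 s' \<and>
    s' ''p'' 0 = 2 ^ \<rho> \<and> s' ''Q'' 0 = 2 ^ (\<rho> + 1) + 1 \<and> s' ''E'' 0 = s5 ''E'' 0 \<and>
    (\<forall>j<n. s' ''E'' (int (Suc j)) = (2 ^ (\<rho> + 1) + 1) ^ j + s5 ''c'' (int j) * (2 ^ (\<rho> + 1) + 1) ^ n)) s5"
  proof (rule wp_weights[where s = s5, OF c5(1,2)])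
    show "(2 ^ (\<rho> + 1) + 1) ^ (n + 1) \<le> W" using QbW by (simp only: tb.Qb_def)
    show "\<bar>(2 ^ (\<rho> + 1) + 1) ^ j + s5 ''c'' (int j) * (2 ^ (\<rho> + 1) + 1) ^ n\<bar> \<le> W" if "j < n" for j
    proof -
      have "\<bar>tb.wt j\<bar> \<le> W" using tb.wt_bounds[OF that] EmW tb.Emax_le(1) by auto
      then show ?thesis by (simp only: c5(3) s0_simps(11)[OF that] tb.wt_def tb.Qb_def)
    qed
  qed (use nW natW n_le_N in auto)
  then obtain t6 s6 where e6: "exec W weights s5 t6 s6" and t6: "t6 \<le> 30 * \<rho> + 80 * n + 80"
    and u6: "unchanged {''p'', ''k'', ''Q'', ''f'', ''j'', ''E''} s5 s6" and c6: "s6 ''p'' 0 = 2 ^ \<rho>" "s6 ''Q'' 0 = tb.Qb" "s6 ''E'' 0 = 0"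
      "\<forall>j<n. s6 ''E'' (int (Suc j)) = tb.wt j"
    unfolding wp_def tb.Qb_def[symmetric] using c5(3,4) s0_simps(11) by (auto simp: tb.wt_def)
  have n6: "s6 ''n'' 0 = int n" using u6 c5 by (simp add: unchanged_def)
  have "wp W start_rounds (\<lambda>t s'. t \<le> 20 \<and> unchanged {''L'', ''U'', ''N'', ''C''} s6 s' \<and> s' ''L'' 0 = 0 \<and> s' ''U'' 0 = int (n + 1) \<and>
    s' ''N'' 0 = 1 \<and> s' ''C'' 0 = int (n + 1)) s6"
    unfolding start_rounds_def using nW W1 n6 by (simp add: wp_simps) (auto simp: unchanged_def)
  then obtain t7 s7 where e7: "exec W start_rounds s6 t7 s7" and t7: "t7 \<le> 20"
    and u7: "unchanged {''L'', ''U'', ''N'', ''C''} s6 s7" and c7: "s7 ''L'' 0 = 0" "s7 ''U'' 0 = int (n + 1)"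
    "s7 ''N'' 0 = 1" "s7 ''C'' 0 = int (n + 1)" unfolding wp_def by blast
  have eq7: "s7 ''V'' = s5 ''V''" "s7 ''E'' = s6 ''E''" "s7 ''M'' = s5 ''M''" "s7 ''t'' = s5 ''t''" "s7 ''D'' = s5 ''D''"
    "s7 ''R'' = s5 ''R''" "s7 ''w'' = s5 ''w''" "s7 ''p'' = s6 ''p''" "s7 ''T'' = s5 ''T''" "s7 ''Q'' = s6 ''Q''" "s7 ''n'' = s6 ''n''"
    using u6 u7 by (auto simp: unchanged_def)
  have start7: "tb.start s7" unfolding tb.start_def
    using c7 c6 V5 V0 eq7 by simp
  have par7: "tb.params s7" unfolding tb.params_def using M5 R5 c5 eq7 by simp
  have "wp W rounds (\<lambda>t s. t \<le> (n + 1) * (120 * tb.w + 270) + \<rho> * (tb.Kmax * tb.Kmax * (120 * tb.w + 270)) \<and>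
    unchanged (tb.touched \<union> {''L'', ''U'', ''N'', ''p''}) s7 s \<and>
    (\<exists>lo hi. tb.generated s 1 lo hi (2 ^ (\<rho> + 1)) \<and> tb.complete_upto s 1 ((6 / 5) ^ \<rho>) lo hi)) s7"
    by (rule tb.wp_rounds[OF start7 par7 c7(4) _ _ tb.states_count tb.split_states]) (use c6 c5 eq7 in auto)
  then obtain t8 s8 lo hi where e8: "exec W rounds s7 t8 s8"
    and t8: "t8 \<le> (n + 1) * (120 * tb.w + 270) + \<rho> * (tb.Kmax * tb.Kmax * (120 * tb.w + 270))"
    and u8: "unchanged (tb.touched \<union> {''L'', ''U'', ''N'', ''p''}) s7 s8"
    and gen: "tb.generated s8 1 lo hi (2 ^ (\<rho> + 1))" "tb.complete_upto s8 1 ((6 / 5) ^ \<rho>) lo hi" unfolding wp_def by blast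
  obtain F k where F: "s8 ''T'' (horner tb.R tb.tau tb.w) = k" "s8 ''E'' k = F" "0 \<le> F" "F \<le> W"
    and opt: "optimal_solution A G S g b c (vec n (\<lambda>j. F div tb.Qb ^ j mod tb.Qb))"
    using tb.read_off_optimum[OF gen] by blast
  have c8: "s8 ''n'' 0 = int n" "s8 ''w'' 0 = int tb.w" "s8 ''R'' 0 = tb.R" "s8 ''Q'' 0 = tb.Qb" "\<And>i. i < tb.w \<Longrightarrow> s8 ''t'' (int i) = tb.tau i"
    using u8 eq7 M5 R5 c5 c6 n6 by (auto simp: unchanged_def)
  have "wp W decode (\<lambda>t s'. t \<le> 40 * tb.w + 60 * n + 60 \<and> (\<forall>j<n. s' ''x'' (int j) = F div tb.Qb ^ j mod tb.Qb)) s8"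
  proof (rule wp_decode[where s = s8, OF c8(1-3,5) F(1,2) c8(4) F(3,4)])
    show "0 < tb.Qb" using tb.Qb_bounds(1) by simp
    show "tb.Qb \<le> W" by (rule order_trans[OF self_le_power QbW]) (use tb.Qb_bounds(1) in auto)
    show "\<bar>horner tb.R tb.tau i\<bar> \<le> W" if "i \<le> tb.w" for i
    proof -
      have "\<bar>horner tb.R tb.tau i\<bar> < (tb.R + 1) ^ i"
      proof (rule horner_bound)
        fix l assume "l < i"
        then have "l < tb.w" using that by simp
        then show "\<bar>tb.tau l\<bar> \<le> tb.R" using tb.tau_hh_r[of l] tb.hh_bounds(1)[of l] RW(2) by (simp add: tb.R_def)
      qed (use RW in \<open>simp add: tb.R_def\<close>)
      also have "\<dots> \<le> (tb.R + 1) ^ tb.w" using RW that by (intro power_increasing) (auto simp: tb.R_def)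
      finally show ?thesis using tb.W(1) by linarith
    qed
  qed (use nW natW wN in auto)
  then obtain t9 s9 where e9: "exec W decode s8 t9 s9" and t9: "t9 \<le> 40 * tb.w + 60 * n + 60"
    and x9: "\<forall>j<n. s9 ''x'' (int j) = F div tb.Qb ^ j mod tb.Qb" unfolding wp_def by blast
  have ex: "exec W solver s0 (t1 + (t2 + (t3 + (t4 + (t5 + (t6 + (t7 + (t8 + t9)))))))) s9"
    unfolding solver_def using e1 e2 e3 e4 e5 e6 e7 e8 e9 by (intro exec.Seq)
  have le: "t1 + (t2 + (t3 + (t4 + (t5 + (t6 + (t7 + (t8 + t9))))))) \<le>
    4000 * (n * n) + 70 * m ^ 4 + 30 * \<rho> + \<rho> * (tb.Kmax * tb.Kmax * (390 * tb.w))"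
    unfolding add.assoc[symmetric]
    by (rule order_trans[OF add_mono[OF add_mono[OF add_mono[OF add_mono[OF add_mono[OF add_mono[OF add_mono[OF add_mono]]]]]]] setup_time])
      (rule t1 t2 t3 t4 t5 t6 t7 t8 t9 tb.mw | use m0 in simp)+
  have x: "holds_vec s9 ''x'' (vec n (\<lambda>j. F div tb.Qb ^ j mod tb.Qb))" using x9 by (simp add: holds_vec_def)
  show ?thesis
    by (rule exI[of _ "t1 + (t2 + (t3 + (t4 + (t5 + (t6 + (t7 + (t8 + t9)))))))"], rule exI[of _ s9],
        rule exI[of _ "vec n (\<lambda>j. F div tb.Qb ^ j mod tb.Qb)"], rule exI[of _ tb.w], rule exI[of _ tb.Kmax])
      (rule conjI[OF ex conjI[OF opt conjI[OF x conjI[OF le conjI[OF tb.w_le_log conjI[OF tb.Kmax_real(2,1)]]]]]])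
qed

end

theorem theorem8:
  shows "\<exists>(P :: com) (C :: real) (K :: nat). C > 0 \<and>
    (\<forall>(\<eta> :: nat \<Rightarrow> real) (m :: nat) (n :: nat) (A :: int mat) (G :: int mat) (S :: int mat)
      (g :: int vec) (b :: int vec) (c :: int vec) (\<rho> :: nat) (J :: nat set) (B :: int mat)
      (\<Delta> :: int) (\<kappa> :: real) (inp :: input).
      (\<forall>k>0. discrepancy_bound k (\<eta> k)) \<longrightarrow>
      0 < m \<longrightarrow> m \<le> n \<longrightarrow>
      A \<in> carrier_mat m n \<longrightarrow> G \<in> carrier_mat (n - m) n \<longrightarrow> unimodular_mat (A @\<^sub>r G) \<longrightarrow>
      S \<in> carrier_mat (n - m) (n - m) \<longrightarrow> det S \<noteq> 0 \<longrightarrow> smith_normal_form S \<longrightarrow>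
      g \<in> carrier_vec (n - m) \<longrightarrow> b \<in> carrier_vec m \<longrightarrow>
      c \<in> carrier_vec n \<longrightarrow> (\<forall>j<n. 0 \<le> c $ j) \<longrightarrow>
      \<Delta> = max_minor A \<longrightarrow>
      0 < \<rho> \<longrightarrow>
      (\<exists>z. optimal_solution A G S g b c z \<and> real_of_int (\<Sum>j<n. \<bar>z $ j\<bar>) \<le> (6 / 5) ^ \<rho>) \<longrightarrow>
      J \<subseteq> {..<n} \<longrightarrow> card J = m \<longrightarrow> B = submatrix A UNIV J \<longrightarrow> det B \<noteq> 0 \<longrightarrow>
      \<kappa> = real_of_int \<Delta> / real_of_int \<bar>det B\<bar> \<longrightarrow>
      inp = problem_input m n A G S g b c \<rho> J (\<eta> m) \<longrightarrow>
      (\<exists>t s x.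
        exec (2 ^ (K * (input_bits inp + \<rho>) ^ K)) P (initial_store inp) t s \<and>
        optimal_solution A G S g b c x \<and> holds_vec s ''x'' x \<and>
        real t \<le> C * real (input_length inp)
          + real \<rho> * real m * (C * \<kappa> * \<eta> m) ^ (2 * m) * (real_of_int \<Delta>)\<^sup>2
            * (real_of_int \<bar>det S\<bar>)\<^sup>2 * max 1 (log 2 (real_of_int \<bar>det S\<bar>))))"
proof (rule exI[of _ solver], rule exI[of _ 4000], rule exI[of _ 20], intro conjI allI impI, goal_cases)
  case 1
  show ?case by simp
next
  case (2 \<eta> m n A G S g b c \<rho> J B \<Delta> \<kappa> inp)
  interpret ip "\<eta> m" m n A G S g b c \<rho> J
    by unfold_locales (use 2 in auto)
  have inp: "inp = problem_input m n A G S g b c \<rho> J (\<eta> m)" using 2 by simp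
  \<comment> \<open>The same number 20 serves as factor and as exponent, so the required
    \<open>20 * N ^ 3\<close> is enlarged to \<open>20 * N ^ 20\<close>.\<close>
  have W: "(2::int) ^ (20 * (N * N * N)) \<le> 2 ^ (20 * (input_bits inp + \<rho>) ^ 20)"
  proof -
    have "N * N * N = N ^ 3" by (simp add: eval_nat_numeral)
    also have "\<dots> \<le> N ^ 20" using n_le_N(4) by (intro power_increasing) auto
    finally show ?thesis unfolding inp N_def[symmetric] by (intro power_increasing) auto
  qed
  obtain t s x w K where *: "exec (2 ^ (20 * (input_bits inp + \<rho>) ^ 20)) solver s0 t s"
    "optimal_solution A G S g b c x" "holds_vec s ''x'' x"
    "t \<le> 4000 * (n * n) + 70 * m ^ 4 + 30 * \<rho> + \<rho> * (K * K * (390 * w))"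
    "real w \<le> 2 * real m * max 1 (log 2 (real_of_int \<bar>det S\<bar>))"
    "real K \<le> real_of_int \<Delta> * (9 * (\<kappa> * \<eta> m)) ^ m * real_of_int \<bar>det S\<bar>" "1 \<le> \<kappa>"
    using exec_solver[OF W] 2 by blast
  have "real t \<le> real (4000 * (n * n) + 70 * m ^ 4 + 30 * \<rho> + \<rho> * (K * K * (390 * w)))"
    using *(4) by (simp only: of_nat_le_iff)
  also have "\<dots> = 4000 * real (n * n) + (70 * real (m ^ 4) + 30 * real \<rho> + real \<rho> * (real K * real K * (390 * real w)))"
    by simp
  \<comment> \<open>One constant serves both as the coefficient of the linear term, which pays for
    all work of order \<open>n * n\<close>, and as the base of the exponential factor.\<close>
  also have "\<dots> \<le> 4000 * real (input_length inp) + real \<rho> * real m * (4000 * (\<kappa> * \<eta> m)) ^ (2 * m) * (real_of_int \<Delta>)\<^sup>2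
            * (real_of_int \<bar>det S\<bar>)\<^sup>2 * max 1 (log 2 (real_of_int \<bar>det S\<bar>))"
  proof (rule add_mono)
    show "4000 * real (n * n) \<le> 4000 * real (input_length inp)" using square_le_input_length unfolding inp by (simp only: mult_left_mono of_nat_le_iff)
    show "70 * real (m ^ 4) + 30 * real \<rho> + real \<rho> * (real K * real K * (390 * real w))
      \<le> real \<rho> * real m * (4000 * (\<kappa> * \<eta> m)) ^ (2 * m) * (real_of_int \<Delta>)\<^sup>2
            * (real_of_int \<bar>det S\<bar>)\<^sup>2 * max 1 (log 2 (real_of_int \<bar>det S\<bar>))"
    proof (rule total_time)
      show "1 \<le> \<kappa> * \<eta> m" using mult_mono[of 1 \<kappa> 1 "\<eta> m"] *(7) h_ge_1 by simp
      show "1 \<le> real_of_int \<Delta>" using max_minor_pos 2 by simp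
      show "1 \<le> real_of_int \<bar>det S\<bar>" using det_S_pos by simp
    qed (use * m0 \<rho>0 in auto)
  qed
  finally have "real t \<le> 4000 * real (input_length inp) + real \<rho> * real m * (4000 * \<kappa> * \<eta> m) ^ (2 * m) * (real_of_int \<Delta>)\<^sup>2
            * (real_of_int \<bar>det S\<bar>)\<^sup>2 * max 1 (log 2 (real_of_int \<bar>det S\<bar>))" by (simp only: mult.assoc)
  note le = this
  have e: "exec (2 ^ (20 * (input_bits inp + \<rho>) ^ 20)) solver (initial_store inp) t s"
    using *(1) unfolding s0_def inp .
  show ?case
    by (rule exI[of _ t], rule exI[of _ s], rule exI[of _ x]) (rule conjI[OF e conjI[OF *(2) conjI[OF *(3) le]]])
qed

end
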